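(* Let $l\ge1$ and let $\vec Q=(Q_1,\dots,Q_l)$, where $Q_j$ is a nondegenerate symmetric bilinear form on $\mathbb R^{n_j}$, $1\le j\le l$. Define $d_{2j-1}=d_{2j}=n_j$ for $1\le j\le l$. Suppose $E_i\subset\mathbb R^{d_i}$, $1\le i\le 2l$, are compact with $$\sum_{i=1}^{2l}\dim_{\mathcal H}(E_i)>1+\frac12\sum_{i=1}^{2l}d_i=1+\sum_{j=1}^l n_j.$$ Then the set $$\Sigma_{\vec Q}(E_1,\dots,E_{2l}):=\left\{\sum_{j=1}^l Q_j\left(x^{2j-1},x^{2j}\right): x^i\in E_i,\ 1\le i\le 2l\right\}\subset\mathbb R$$ has nonempty interior.
   Context: $\dim_{\mathcal H}$ denotes Hausdorff dimension. *)

theory Defs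
  imports "HOL-Analysis.Analysis"
begin

text \<open>Euclidean space R^n rendered as functions nat => real vanishing at all
  indices >= n (so that spaces of different, index-dependent dimensions can be
  handled uniformly).\<close>

definition Rn :: "nat \<Rightarrow> (nat \<Rightarrow> real) set" where
  "Rn n = {x. \<forall>i\<ge>n. x i = 0}"

definition edist :: "nat \<Rightarrow> (nat \<Rightarrow> real) \<Rightarrow> (nat \<Rightarrow> real) \<Rightarrow> real" where
  "edist n x y = sqrt (\<Sum>i<n. (x i - y i)^2)"

definition ediam :: "nat \<Rightarrow> (nat \<Rightarrow> real) set \<Rightarrow> real" where
  "ediam n C = (if C = {} then 0 else Sup {edist n x y | x y. x \<in> C \<and> y \<in> C})"

definition hausdorff_pre :: "nat \<Rightarrow> real \<Rightarrow> real \<Rightarrow> (nat \<Rightarrow> real) set \<Rightarrow> ennreal" where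
  "hausdorff_pre n s \<delta> E =
     (INF C \<in> {C :: nat \<Rightarrow> (nat \<Rightarrow> real) set.
                (\<forall>k. C k \<subseteq> Rn n \<and> (\<forall>x\<in>C k. \<forall>y\<in>C k. edist n x y \<le> \<delta>)) \<and> E \<subseteq> (\<Union>k. C k)}.
        (\<Sum>k. ennreal (ediam n (C k) powr s)))"

definition hausdorff_measure :: "nat \<Rightarrow> real \<Rightarrow> (nat \<Rightarrow> real) set \<Rightarrow> ennreal" where
  "hausdorff_measure n s E = (SUP \<delta>\<in>{0<..}. hausdorff_pre n s \<delta> E)"

definition hausdorff_dim :: "nat \<Rightarrow> (nat \<Rightarrow> real) set \<Rightarrow> real" where
  "hausdorff_dim n E = Inf {s. s \<ge> 0 \<and> hausdorff_measure n s E = 0}"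

definition nondeg_sym_bilinear :: "nat \<Rightarrow> ((nat \<Rightarrow> real) \<Rightarrow> (nat \<Rightarrow> real) \<Rightarrow> real) \<Rightarrow> bool" where
  "nondeg_sym_bilinear n Q \<longleftrightarrow>
     (\<forall>x\<in>Rn n. \<forall>y\<in>Rn n. Q x y = Q y x) \<and>
     (\<forall>x\<in>Rn n. \<forall>y\<in>Rn n. \<forall>z\<in>Rn n. \<forall>a b::real.
         Q (\<lambda>i. a * x i + b * y i) z = a * Q x z + b * Q y z \<and>
         Q z (\<lambda>i. a * x i + b * y i) = a * Q z x + b * Q z y) \<and>
     (\<forall>x\<in>Rn n. (\<forall>y\<in>Rn n. Q x y = 0) \<longrightarrow> x = (\<lambda>_. 0))"

end

theory Submission
  imports Defs "HOL-Probability.Characteristic_Functions"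
begin

text \<open>The form \<open>\<Sum>j. Q\<^sub>j(x\<^sup>2\<^sup>j\<^sup>-\<^sup>1, x\<^sup>2\<^sup>j)\<close> is a single nondegenerate form on \<open>\<real>\<^sup>N\<close>, \<open>N = \<Sum>j. n\<^sub>j\<close>, evaluated on the product of
  the odd and the product of the even sets, so after a linear change of variables the problem
  concerns the dot products \<open>x \<bullet> y\<close> of \<open>x \<in> E\<close>, \<open>y \<in> F\<close> with measures of finite energies \<open>s + s' > N + 1\<close>.
  Let \<open>f\<^sub>u(t)\<close> be the density at \<open>t\<close> of the distribution of \<open>x \<bullet> y\<close>, smoothed by the heat kernel of variance
  about \<open>u\<close>. In the frequency variable \<open>\<theta>\<close> the kernel \<open>exp (\<i> \<theta> x \<bullet> y)\<close> factors through Gaussians on \<open>\<real>\<^sup>N\<close>, and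
  Cauchy-Schwarz, applied after \<open>k\<close> derivatives in \<open>u\<close>, bounds the \<open>k\<close>-th derivative of \<open>f\<^sub>u(t)\<close>, \<open>t \<noteq> 0\<close>, by
  \<open>u\<close> to the power \<open>(s + s' - N - 1) / 4 - k\<close>: one factor is the energy of \<open>E\<close> against a kernel of
  order \<open>(u + |x - x'|\<^sup>2)\<^sup>-\<^sup>2\<^sup>k\<^sup>-\<^sup>1\<^sup>/\<^sup>2\<close>, and in the other one the hyperplane \<open>{x. x \<bullet> y = t}\<close> is written as
  \<open>{x. x \<bullet> \<lambda>y = \<lambda>t}\<close> with \<open>1 \<le> \<lambda> \<le> 2\<close>, which makes the data \<open>(\<lambda>y, \<lambda>t)\<close> one dimension larger. Hence
  \<open>|f\<^sub>u(t) - f\<^sub>v(t)| \<le> C u\<^sup>\<delta>\<close> for \<open>v \<le> u\<close>. If the image had empty interior, \<open>f\<^sub>v(t) \<rightarrow> 0\<close> on a dense set of \<open>t\<close>,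
  so \<open>f\<^sub>u = O(u\<^sup>\<delta>)\<close> there and all the mass would sit at \<open>0\<close>; without \<open>\<lambda>\<close> the same estimate loses
  only \<open>u\<^sup>-\<^sup>1\<^sup>/\<^sup>4\<close>, which is still enough to exclude an atom at \<open>t = 0\<close>. All bounds depend on the measures
  only through their energies at scales above \<open>v\<close>, so uniform measures on finite sets suffice.\<close>

section \<open>Discrete Frostman measures\<close>

text \<open>The energy exponent \<open>s\<close> may be large, whereas the kernel of order
  \<open>- 1/2\<close> that Cauchy-Schwarz produces without derivatives can use it only up to
  \<open>s = 1\<close>. Each derivative in \<open>u\<close> lowers that order by 2, and once
  \<open>s \<le> 4 * k + 1\<close> the excess is traded for a power of \<open>u\<close>. So a
  derivative of high order is estimated and then integrated back from \<open>u = 1\<close>. This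
  does the work of a dyadic frequency decomposition while every kernel stays an explicit Gaussian.
  The exponents come about as follows. The \<open>X\<close> side contributes \<open>s / 2\<close>,
  the \<open>Y\<close> side \<open>s' / 2\<close>, or \<open>(s' + 1) / 2\<close> with dilations,
  and the normalizations cost \<open>(N + 2) / 2\<close>. Cauchy-Schwarz halves the total, which
  leaves \<open>(s + s' - N - 2) / 4\<close> without and \<open>(s + s' - N - 1) / 4\<close> with
  dilations. The hypothesis makes the second number positive and the first at least
  \<open>- 1/4\<close>. Dilations move the point \<open>(y, t)\<close> transversally only if
  \<open>t\<close> stays away from 0, which forces the separate estimate near 0.\<close>

lemma edist_eq_L2_set: "edist n x y = L2_set (\<lambda>i. x i - y i) {..<n}"
  by (simp add: edist_def L2_set_def)

lemma edist_nonneg [simp]: "0 \<le> edist n x y"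
  by (simp add: edist_eq_L2_set)

lemma edist_self [simp]: "edist n x x = 0"
  by (simp add: edist_def)

lemma edist_commute: "edist n x y = edist n y x"
  by (simp add: edist_def power2_commute)

lemma edist_triangle: "edist n x z \<le> edist n x y + edist n y z"
  unfolding edist_eq_L2_set
  using L2_set_triangle_ineq[of "\<lambda>i. x i - y i" "\<lambda>i. y i - z i" "{..<n}"] by simp

lemma continuous_on_edist: "continuous_on UNIV (edist n x)"
  unfolding edist_def by (intro continuous_intros continuous_on_coordinatewise_then_product) simp_all

text \<open>Compactness refers to the product topology on \<open>nat \<Rightarrow> real\<close>.
  Balls of \<open>edist n\<close> are open there because they constrain only finitely many
  coordinates.\<close>

lemma finite_edist_net:
  assumes "compact E" "r > 0"
  obtains S where "finite S" "S \<subseteq> E" "\<And>x. x \<in> E \<Longrightarrow> \<exists>y\<in>S. edist n y x < r"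
proof -
  have "open {y. edist n x y < r}" for x
    by (intro open_Collect_less continuous_on_edist continuous_on_const)
  hence op: "\<And>x. x \<in> E \<Longrightarrow> open {y. edist n x y < r}" .
  have cov: "E \<subseteq> (\<Union>x\<in>E. {y. edist n x y < r})"
    using assms(2) by auto
  obtain S where "S \<subseteq> E" "finite S" "E \<subseteq> (\<Union>x\<in>S. {y. edist n x y < r})"
    by (rule compactE_image[OF assms(1) op cov])
  thus ?thesis using that[of S] by blast
qed


text \<open>Greedy selection as in Vitali's covering lemma. \<open>g\<close> is meant to be the
  dyadic exponent of a radius, so a least \<open>g\<close> is a largest ball: keep it, discard
  whatever it meets, and recurse.\<close>

lemma disjoint_dominating_subset:
  fixes g :: "'a \<Rightarrow> nat"
  assumes "finite B" "\<And>b b'. R b b' \<Longrightarrow> R b' b"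
  shows "\<exists>D\<subseteq>B. (\<forall>b\<in>D. \<forall>b'\<in>D. b \<noteq> b' \<longrightarrow> \<not> R b b') \<and> (\<forall>b\<in>B. \<exists>b'\<in>D. (b = b' \<or> R b b') \<and> g b' \<le> g b)"
  using assms(1)
proof (induction B rule: finite_psubset_induct)
  case (psubset B)
  show ?case
  proof (cases "B = {}")
    case False
    obtain b0 where b0: "b0 \<in> B" "\<And>b. b \<in> B \<Longrightarrow> g b0 \<le> g b"
      using ex_min_if_finite[of "g ` B"] psubset(1) False
      by (metis arg_min_if_finite(1) arg_min_least)
    define B' where "B' = {b \<in> B. b \<noteq> b0 \<and> \<not> R b b0}"
    have "B' \<subset> B" using b0 by (auto simp: B'_def)
    then obtain D where D: "D \<subseteq> B'" "\<forall>b\<in>D. \<forall>b'\<in>D. b \<noteq> b' \<longrightarrow> \<not> R b b'"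
        "\<forall>b\<in>B'. \<exists>b'\<in>D. (b = b' \<or> R b b') \<and> g b' \<le> g b"
      using psubset(2) by meson
    show ?thesis
    proof (intro exI[of _ "insert b0 D"] conjI ballI)
      show "insert b0 D \<subseteq> B" using D b0 by (auto simp: B'_def)
      show "b \<noteq> b' \<longrightarrow> \<not> R b b'" if "b \<in> insert b0 D" "b' \<in> insert b0 D" for b b'
      proof -
        have "\<not> R c b0 \<and> \<not> R b0 c" if "c \<in> D" for c
          using that D(1) assms(2)[of b0 c] by (auto simp: B'_def)
        thus ?thesis using that D(2) by blast
      qed
      show "\<exists>b'\<in>insert b0 D. (b = b' \<or> R b b') \<and> g b' \<le> g b" if "b \<in> B" for b
      proof (cases "b \<in> B'")
        case True
        thus ?thesis using D(3) by blast
      next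
        case False
        hence "b = b0 \<or> R b b0" using that by (auto simp: B'_def)
        thus ?thesis using b0(2)[OF that] by blast
      qed
    qed
  qed auto
qed

section \<open>Hausdorff content and finite covers\<close>

lemma ediam_le:
  assumes "\<And>x y. x \<in> C \<Longrightarrow> y \<in> C \<Longrightarrow> edist n x y \<le> b" "0 \<le> b"
  shows "0 \<le> ediam n C" "ediam n C \<le> b"
proof -
  show "ediam n C \<le> b"
  proof (cases "C = {}")
    case False
    then obtain x where "x \<in> C" by auto
    hence "{edist n x y | x y. x \<in> C \<and> y \<in> C} \<noteq> {}" by blast
    hence "Sup {edist n x y | x y. x \<in> C \<and> y \<in> C} \<le> b"
      by (rule cSup_least) (use assms in blast)
    thus ?thesis using False by (simp add: ediam_def)
  qed (use assms in \<open>simp add: ediam_def\<close>)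
  show "0 \<le> ediam n C"
  proof (cases "C = {}")
    case False
    then obtain x where "x \<in> C" by auto
    hence "edist n x x \<le> Sup {edist n x y | x y. x \<in> C \<and> y \<in> C}"
      using assms \<open>x \<in> C\<close> by (intro cSup_upper) (blast, auto simp: bdd_above_def)
    thus ?thesis using False by (simp add: ediam_def)
  qed (simp add: ediam_def)
qed

lemma hausdorff_pre_le_finite_cover:
  assumes "finite D" and C: "\<And>d. d \<in> D \<Longrightarrow> C d \<subseteq> Rn n"
    and b: "\<And>d x y. d \<in> D \<Longrightarrow> x \<in> C d \<Longrightarrow> y \<in> C d \<Longrightarrow> edist n x y \<le> b d"
    and b\<delta>: "\<And>d. d \<in> D \<Longrightarrow> 0 \<le> b d \<and> b d \<le> \<delta>" and E: "E \<subseteq> (\<Union>d\<in>D. C d)" and s: "0 \<le> s"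
  shows "hausdorff_pre n s \<delta> E \<le> ennreal (\<Sum>d\<in>D. b d powr s)"
proof -
  obtain e where e: "bij_betw e {..<card D} D"
    using ex_bij_betw_nat_finite[OF assms(1)] by (auto simp: atLeast0LessThan)
  define K where "K k = (if k < card D then C (e k) else {})" for k
  have eD: "e k \<in> D" if "k < card D" for k using e that by (auto simp: bij_betw_def)
  have "E \<subseteq> (\<Union>k. K k)"
  proof
    fix x assume "x \<in> E"
    then obtain d where "d \<in> D" "x \<in> C d" using E by auto
    moreover from this obtain k where "k < card D" "e k = d" using e
      unfolding bij_betw_def by (metis imageE lessThan_iff)
    ultimately show "x \<in> (\<Union>k. K k)" by (auto simp: K_def)
  qed
  moreover have "K k \<subseteq> Rn n" "\<forall>x\<in>K k. \<forall>y\<in>K k. edist n x y \<le> \<delta>" for k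
  proof -
    show "K k \<subseteq> Rn n" using C eD by (auto simp: K_def)
    show "\<forall>x\<in>K k. \<forall>y\<in>K k. edist n x y \<le> \<delta>"
    proof (cases "k < card D")
      case True
      show ?thesis using b[OF eD[OF True]] b\<delta>[OF eD[OF True]] True by (force simp: K_def)
    qed (simp add: K_def)
  qed
  ultimately have "hausdorff_pre n s \<delta> E \<le> (\<Sum>k. ennreal (ediam n (K k) powr s))"
    unfolding hausdorff_pre_def by (intro INF_lower) auto
  \<comment> \<open>Padding by empty sets is free: \<open>ediam\<close> is 0 on them and
    \<open>0 powr s = 0\<close>, even for \<open>s = 0\<close>.\<close>
  also have "\<dots> = (\<Sum>k<card D. ennreal (ediam n (K k) powr s))"
    by (intro suminf_finite) (auto simp: K_def ediam_def)
  also have "\<dots> \<le> (\<Sum>k<card D. ennreal (b (e k) powr s))"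
  proof (intro sum_mono ennreal_leI powr_mono2)
    fix k assume "k \<in> {..<card D}"
    thus "0 \<le> ediam n (K k)" "ediam n (K k) \<le> b (e k)"
      using ediam_le[of "K k" n "b (e k)"] b b\<delta> eD by (auto simp: K_def)
  qed (use s in auto)
  also have "\<dots> = (\<Sum>d\<in>D. ennreal (b d powr s))"
    by (rule sum.reindex_bij_betw[OF e])
  also have "\<dots> = ennreal (\<Sum>d\<in>D. b d powr s)" by (rule sum_ennreal) simp
  finally show ?thesis .
qed
lemma hausdorff_pre_pos:
  assumes "0 \<le> s" "s < hausdorff_dim n E"
  obtains \<delta> c where "\<delta> > 0" "c > 0" "ennreal c \<le> hausdorff_pre n s \<delta> E"
proof -
  have "hausdorff_measure n s E \<noteq> 0"
  proof
    assume "hausdorff_measure n s E = 0"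
    hence "hausdorff_dim n E \<le> s"
      unfolding hausdorff_dim_def using assms by (intro cInf_lower) (auto simp: bdd_below_def)
    thus False using assms by simp
  qed
  then obtain \<delta> where \<delta>: "\<delta> > 0" "hausdorff_pre n s \<delta> E \<noteq> 0"
    unfolding hausdorff_measure_def by (metis (no_types, lifting) SUP_bot_conv(2) bot_ennreal greaterThan_iff)
  show ?thesis
  proof (cases "hausdorff_pre n s \<delta> E")
    case (real c)
    thus ?thesis using \<delta> that[of \<delta> c] by (cases "c = 0") auto
  next
    case top
    thus ?thesis using \<delta> that[of \<delta> 1] by auto
  qed
qed

text \<open>Instead of passing to a weak limit, the Frostman condition is imposed on counting measures:
  a maximal set of points of a \<open>2\<^sup>-\<^sup>K\<close>-net with few points in every ball must be large,
  because the balls in which the bound is attained cover \<open>E\<close>.\<close>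

lemma finite_frostman_at_scale:
  assumes E: "compact E" "E \<subseteq> Rn n" and s: "0 \<le> s" and c: "c > 0" "ennreal c \<le> hausdorff_pre n s \<delta> E"
    and j0: "8 * (1/2) ^ j0 \<le> \<delta>" "j0 \<le> K"
  shows "\<exists>P. finite P \<and> P \<noteq> {} \<and> P \<subseteq> E \<and> (\<forall>p\<in>P. \<forall>j\<in>{j0..K}.
     real (card {p'\<in>P. edist n p p' \<le> (1/2) ^ j}) \<le> 2 * (8 powr s / c) * 2 powr (- real j * s) * card P)"
proof -
  obtain S where S: "finite S" "S \<subseteq> E" "\<And>x. x \<in> E \<Longrightarrow> \<exists>y\<in>S. edist n y x < (1/2) ^ K"
    using finite_edist_net[OF E(1), of "(1/2) ^ K" n] by auto
  \<comment> \<open>If a point carries mass \<open>2 powr (- K * s)\<close>, then \<open>a j\<close>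
    points carry the mass \<open>2 powr (- j * s)\<close> that a ball of radius
    \<open>(1/2) ^ j\<close> may have. The slack \<open>+ 1\<close> in \<open>good\<close> ensures
    that a ball which forbids one more point already contains \<open>a j\<close> points.\<close>
  define a where "a j = 2 powr ((real K - real j) * s)" for j
  define B where "B P x j = {p\<in>P. edist n x p \<le> (1/2) ^ j}" for P x j
  define good where "good P \<longleftrightarrow> P \<subseteq> S \<and> (\<forall>x\<in>S. \<forall>j\<in>{j0..K}. real (card (B P x j)) < a j + 1)" for P
  have a1: "1 \<le> a j" if "j \<le> K" for j
    unfolding a_def using that s by (intro ge_one_powr_ge_zero) auto
  have g0: "good {}" using a1 by (fastforce simp: good_def B_def a_def add_pos_pos)
  have fin_good: "finite {P. good P}" by (rule finite_subset[of _ "Pow S"]) (use S(1) in \<open>auto simp: good_def\<close>)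
  have ne_good: "{P. good P} \<noteq> {}" using g0 by blast
  obtain P where P': "P \<in> {P. good P}" "\<forall>P'\<in>{P. good P}. P \<subseteq> P' \<longrightarrow> P = P'"
    by (rule bexE[OF finite_has_maximal[OF fin_good ne_good]])
  have P: "good P" using P'(1) by simp
  have Pmax: "P = P'" if "good P'" "P \<subseteq> P'" for P' using P'(2) that by simp
  have PS: "P \<subseteq> S" and finP: "finite P" using P S(1) by (auto simp: good_def intro: finite_subset)
  define sat where "sat = {(x, j). x \<in> S \<and> j \<in> {j0..K} \<and> a j \<le> real (card (B P x j))}"
  have fsat: "finite sat" by (rule finite_subset[of _ "S \<times> {j0..K}"]) (use S(1) in \<open>auto simp: sat_def\<close>)
  have cover: "\<exists>(x, j)\<in>sat. edist n x q \<le> (1/2) ^ j" if q: "q \<in> S" for q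
  proof (cases "q \<in> P")
    case True
    \<comment> \<open>A point of \<open>P\<close> saturates the smallest ball around itself, because
      \<open>a K = 1\<close>.\<close>
    hence "card (B P q K) \<noteq> 0" using finP by (auto simp: B_def)
    hence "(q, K) \<in> sat" using q j0 by (auto simp: sat_def a_def)
    thus ?thesis by (intro bexI[of _ "(q, K)"]) auto
  next
    case False
    hence "\<not> good (insert q P)" using Pmax[of "insert q P"] by auto
    then obtain x j where xj: "x \<in> S" "j \<in> {j0..K}" "real (card (B (insert q P) x j)) \<ge> a j + 1"
      using PS q by (auto simp: good_def not_less)
    have "edist n x q \<le> (1/2) ^ j"
    proof (rule ccontr)
      assume "\<not> edist n x q \<le> (1/2) ^ j"
      hence "B (insert q P) x j = B P x j" by (auto simp: B_def)
      moreover have "real (card (B P x j)) < a j + 1" using P xj(1,2) unfolding good_def by blast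
      ultimately show False using xj(3) by simp
    qed
    moreover from this have "B (insert q P) x j = insert q (B P x j)" by (auto simp: B_def)
    hence "card (B (insert q P) x j) = card (B P x j) + 1"
      using False finP by (simp add: B_def)
    hence "(x, j) \<in> sat" using xj by (simp add: sat_def)
    ultimately show ?thesis by (intro bexI[of _ "(x, j)"]) auto
  qed
  \<comment> \<open>Balls conflict only if they share points of \<open>P\<close>. Geometric overlap
    is harmless, since only cardinalities have to add up.\<close>
  define R where "R b b' \<longleftrightarrow> B P (fst b) (snd b) \<inter> B P (fst b') (snd b') \<noteq> {}" for b b'
  have symR: "R b b' \<Longrightarrow> R b' b" for b b' unfolding R_def by (simp add: Int_commute)
  have "\<exists>D\<subseteq>sat. (\<forall>b\<in>D. \<forall>b'\<in>D. b \<noteq> b' \<longrightarrow> \<not> R b b') \<and> (\<forall>b\<in>sat. \<exists>b'\<in>D. (b = b' \<or> R b b') \<and> snd b' \<le> snd b)"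
    by (rule disjoint_dominating_subset[OF fsat]) (rule symR)
  then obtain D where
    D': "D \<subseteq> sat" "\<forall>b\<in>D. \<forall>b'\<in>D. b \<noteq> b' \<longrightarrow> \<not> R b b'" "\<forall>b\<in>sat. \<exists>b'\<in>D. (b = b' \<or> R b b') \<and> snd b' \<le> snd b"
    by (elim exE conjE)
  note D = D'(1) D'(2)[rule_format] D'(3)[rule_format]
  have finD: "finite D" using D(1) fsat finite_subset by auto
  have pow_le: "(1/2) ^ j \<le> ((1/2) ^ j' :: real)" if "j' \<le> j" for j j' :: nat
    using that by (intro power_decreasing) auto
  \<comment> \<open>A net point in a saturated ball lies within \<open>3 * (1/2) ^ j'\<close> of the
    centre of the selected ball dominating it, and a point of \<open>E\<close> is at most
    \<open>(1/2) ^ K\<close> further away. This gives the radius factor 4 and the diameter factor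
    8.\<close>
  have "hausdorff_pre n s \<delta> E \<le> ennreal (\<Sum>d\<in>D. (8 * (1/2) ^ snd d) powr s)"
  proof (rule hausdorff_pre_le_finite_cover[OF finD, where C = "\<lambda>d. {y \<in> Rn n. edist n (fst d) y \<le> 4 * (1/2) ^ snd d}"])
    show "edist n x y \<le> 8 * (1/2) ^ snd d"
      if "x \<in> {y \<in> Rn n. edist n (fst d) y \<le> 4 * (1/2) ^ snd d}" "y \<in> {y \<in> Rn n. edist n (fst d) y \<le> 4 * (1/2) ^ snd d}" for d x y
      using that edist_triangle[of n x y "fst d"] edist_commute[of n x "fst d"] by auto
    show "0 \<le> 8 * (1 / 2 :: real) ^ snd d \<and> 8 * (1 / 2) ^ snd d \<le> \<delta>" if "d \<in> D" for d
    proof -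
      have "j0 \<le> snd d" using that D(1) by (auto simp: sat_def)
      from pow_le[OF this] have "8 * (1/2) ^ snd d \<le> \<delta>" using j0 by linarith
      thus ?thesis by simp
    qed
    show "E \<subseteq> (\<Union>d\<in>D. {y \<in> Rn n. edist n (fst d) y \<le> 4 * (1 / 2) ^ snd d})"
    proof
      fix y assume y: "y \<in> E"
      then obtain q where q: "q \<in> S" "edist n q y < (1/2) ^ K" using S by auto
      obtain x j where xj: "(x, j) \<in> sat" "edist n x q \<le> (1/2) ^ j" using cover[OF q(1)] by auto
      obtain x' j' where x': "(x', j') \<in> D" "(x, j) = (x', j') \<or> R (x, j) (x', j')" "j' \<le> j"
        using D(3)[OF xj(1)] by (metis prod.collapse snd_conv)
      have "j \<le> K" using xj by (auto simp: sat_def)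
      have x'q: "edist n x' q \<le> 3 * (1/2) ^ j'"
      proof (cases "(x, j) = (x', j')")
        case True
        hence "edist n x' q \<le> (1/2) ^ j'" using xj by simp
        moreover have "0 \<le> (1/2 :: real) ^ j'" by simp
        ultimately show ?thesis by linarith
      next
        case False
        then obtain p where p: "edist n x p \<le> (1/2) ^ j" "edist n x' p \<le> (1/2) ^ j'"
          using x'(2) False unfolding R_def B_def by auto
        have "edist n x' q \<le> edist n x' p + edist n p x + edist n x q"
          using edist_triangle[of n x' q p] edist_triangle[of n p q x] by linarith
        thus ?thesis using p xj(2) pow_le[OF x'(3)] edist_commute[of n x p] by linarith
      qed
      have "edist n x' y \<le> edist n x' q + edist n q y" by (rule edist_triangle)
      moreover have "(1/2) ^ K \<le> ((1/2) ^ j' :: real)" using x'(3) \<open>j \<le> K\<close> by (intro pow_le) simp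
      ultimately have "edist n x' y \<le> 4 * (1/2) ^ j'" using x'q q(2) by linarith
      thus "y \<in> (\<Union>d\<in>D. {y \<in> Rn n. edist n (fst d) y \<le> 4 * (1 / 2) ^ snd d})"
        using y E(2) by (intro UN_I[OF x'(1)]) auto
    qed
  qed (use s in auto)
  with c have "ennreal c \<le> ennreal (\<Sum>d\<in>D. (8 * (1/2) ^ snd d) powr s)" by (rule_tac order_trans)
  hence "c \<le> (\<Sum>d\<in>D. (8 * (1/2) ^ snd d) powr s)" by (simp add: sum_nonneg ennreal_le_iff)
  also have "\<dots> = (\<Sum>d\<in>D. 8 powr s * 2 powr (- real K * s) * a (snd d))"
  proof (rule sum.cong)
    fix d
    have "(1/2) ^ snd d = (2::real) powr (- real (snd d))"
      by (simp add: powr_minus powr_realpow power_one_over inverse_eq_divide)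
    hence "(8 * (1/2) ^ snd d) powr s = 8 powr s * (2 powr (- real (snd d))) powr s"
      by (simp only:) (rule powr_mult)
    hence "(8 * (1/2) ^ snd d) powr s = 8 powr s * 2 powr (- real (snd d) * s)"
      by (simp only: powr_powr)
    thus "(8 * (1/2) ^ snd d) powr s = 8 powr s * 2 powr (- real K * s) * a (snd d)"
      by (simp add: a_def left_diff_distrib flip: powr_add)
  qed simp
  also have "\<dots> \<le> (\<Sum>d\<in>D. 8 powr s * 2 powr (- real K * s) * real (card (B P (fst d) (snd d))))"
    using D(1) by (intro sum_mono mult_left_mono) (auto simp: sat_def)
  also have "\<dots> = 8 powr s * 2 powr (- real K * s) * real (card (\<Union>d\<in>D. B P (fst d) (snd d)))"
  proof -
    have "card (\<Union>d\<in>D. B P (fst d) (snd d)) = (\<Sum>d\<in>D. card (B P (fst d) (snd d)))"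
      using finD finP D(2) by (intro card_UN_disjoint) (auto simp: B_def R_def)
    thus ?thesis by (simp add: sum_distrib_left)
  qed
  also have "\<dots> \<le> 8 powr s * 2 powr (- real K * s) * card P"
    using finP by (intro mult_left_mono of_nat_mono card_mono) (auto simp: B_def)
  finally have cP: "c \<le> 8 powr s * 2 powr (- real K * s) * card P" .
  hence "card P \<noteq> 0" using c by (intro notI) simp
  hence Pne: "P \<noteq> {}" by auto
  \<comment> \<open>The lower bound for \<open>card P\<close> converts the absolute capacities
    \<open>a j\<close> into multiples of \<open>card P\<close>, as needed for the uniform
    probability measure on \<open>P\<close>.\<close>
  have "2 powr (real K * s) \<le> 8 powr s / c * card P"
    using mult_right_mono[OF cP, of "2 powr (real K * s) / c"] c
    by (simp add: powr_minus field_simps)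
  show ?thesis
  proof (intro exI[of _ P] conjI ballI finP Pne)
    show "P \<subseteq> E" using PS S by auto
    fix p j assume p: "p \<in> P" and j: "j \<in> {j0..K}"
    have "real (card (B P p j)) \<le> 2 * a j"
    proof -
      have "real (card (B P p j)) < a j + 1" using P p j PS unfolding good_def by blast
      thus ?thesis using a1[of j] j by simp
    qed
    also have "2 * a j = 2 * (2 powr (real K * s)) * 2 powr (- real j * s)"
      by (simp add: a_def left_diff_distrib flip: powr_add)
    also have "\<dots> \<le> 2 * (8 powr s / c * card P) * 2 powr (- real j * s)"
      by (intro mult_right_mono mult_left_mono) (fact, auto)
    finally show "real (card {p'\<in>P. edist n p p' \<le> (1/2) ^ j}) \<le> 2 * (8 powr s / c) * 2 powr (- real j * s) * card P"
      by (simp add: B_def mult_ac)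
  qed
qed

text \<open>Scales coarser than \<open>j0\<close>, where covers would be too wide for
  \<open>\<delta>\<close>, are handled by the trivial bound \<open>card P\<close> and a larger
  constant. What matters is that \<open>C\<close> is chosen before \<open>K\<close>.\<close>

lemma finite_frostman:
  assumes E: "compact E" "E \<subseteq> Rn n" and s: "0 \<le> s" "s < hausdorff_dim n E"
  shows "\<exists>C>0. \<forall>K. \<exists>P. finite P \<and> P \<noteq> {} \<and> P \<subseteq> E \<and> (\<forall>p\<in>P. \<forall>j\<le>K.
     real (card {p'\<in>P. edist n p p' \<le> (1/2) ^ j}) \<le> C * 2 powr (- real j * s) * card P)"
proof -
  obtain \<delta> c where \<delta>: "\<delta> > 0" and c: "c > 0" "ennreal c \<le> hausdorff_pre n s \<delta> E"
    using hausdorff_pre_pos[OF s] by blast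
  obtain j0 where "(1/2) ^ j0 < \<delta> / 8"
    using real_arch_pow_inv[of "\<delta> / 8" "1/2"] \<delta> by auto
  hence j0: "8 * (1/2) ^ j0 \<le> \<delta>" by linarith
  define C where "C = 2 * (8 powr s / c) + 2 powr (real j0 * s)"
  have "2 * (8 powr s / c) > 0" using c by simp
  moreover have "2 powr (real j0 * s) > 0" by simp
  ultimately have C: "C > 0" "2 * (8 powr s / c) \<le> C" "2 powr (real j0 * s) \<le> C" unfolding C_def by linarith+
  show ?thesis
  proof (intro exI[of _ C] conjI C allI)
    fix K
    have "\<exists>P. finite P \<and> P \<noteq> {} \<and> P \<subseteq> E \<and> (\<forall>p\<in>P. \<forall>j\<in>{j0..max K j0}.
        real (card {p'\<in>P. edist n p p' \<le> (1/2) ^ j}) \<le> 2 * (8 powr s / c) * 2 powr (- real j * s) * card P)"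
      by (rule finite_frostman_at_scale[OF E s(1) c j0]) simp
    then obtain P where P: "finite P" "P \<noteq> {}" "P \<subseteq> E" and
      card_le: "\<forall>p\<in>P. \<forall>j\<in>{j0..max K j0}. real (card {p'\<in>P. edist n p p' \<le> (1/2) ^ j}) \<le> 2 * (8 powr s / c) * 2 powr (- real j * s) * card P"
      by (elim exE conjE)
    show "\<exists>P. finite P \<and> P \<noteq> {} \<and> P \<subseteq> E \<and> (\<forall>p\<in>P. \<forall>j\<le>K.
     real (card {p'\<in>P. edist n p p' \<le> (1/2) ^ j}) \<le> C * 2 powr (- real j * s) * card P)"
    proof (intro exI[of _ P] conjI ballI allI impI P)
      fix p j assume p: "p \<in> P" and j: "j \<le> K"
      show "real (card {p'\<in>P. edist n p p' \<le> (1/2) ^ j}) \<le> C * 2 powr (- real j * s) * card P"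
      proof (cases "j0 \<le> j")
        case True
        have "real (card {p'\<in>P. edist n p p' \<le> (1/2) ^ j}) \<le> 2 * (8 powr s / c) * 2 powr (- real j * s) * card P"
          using True j by (intro bspec[OF bspec[OF card_le p]]) auto
        also have "\<dots> \<le> C * 2 powr (- real j * s) * card P"
          using C by (intro mult_right_mono) auto
        finally show ?thesis .
      next
        case False
        have "real (card {p'\<in>P. edist n p p' \<le> (1/2) ^ j}) \<le> 1 * card P"
          using P(1) by (auto intro!: card_mono)
        moreover have "1 \<le> C * 2 powr (- real j * s)"
        proof -
          have "1 \<le> 2 powr ((real j0 - real j) * s)"
            using False s by (intro ge_one_powr_ge_zero) auto
          also have "\<dots> = 2 powr (real j0 * s) * 2 powr (- real j * s)"
            by (simp add: left_diff_distrib flip: powr_add)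
          also have "\<dots> \<le> C * 2 powr (- real j * s)" using C by (intro mult_right_mono) auto
          finally show ?thesis .
        qed
        ultimately show ?thesis using mult_right_mono[of 1 "C * 2 powr (- real j * s)" "real (card P)"] by simp
      qed
    qed
  qed
qed

text \<open>A single term of the sum suffices, the one for the largest \<open>j \<le> K\<close> with
  \<open>d \<le> (1/2) ^ j\<close>. Below it the sum \<open>u + d\<^sup>2\<close> is controlled by
  \<open>d\<close> if \<open>j < K\<close> and by \<open>u\<close> if \<open>j = K\<close>. The
  summand 1 covers \<open>d > 1\<close>.\<close>

lemma riesz_kernel_dyadic_bound:
  fixes d u s :: real
  assumes u: "(1/2) ^ (2 * K) \<le> u" and d: "0 \<le> d" and s: "0 \<le> s"
  shows "(u + d\<^sup>2) powr (- s / 2) \<le> 1 + (\<Sum>j\<le>K. 2 powr (real (Suc j) * s) * (if d \<le> (1/2) ^ j then 1 else 0))"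
    (is "_ \<le> 1 + ?S")
proof -
  have u0: "u > 0" using u by (rule less_le_trans[rotated]) simp
  have S0: "?S \<ge> 0" by (intro sum_nonneg) auto
  show ?thesis
  proof (cases "d \<le> 1")
    case False
    hence "1 \<le> d\<^sup>2" by simp
    hence "1 \<le> u + d\<^sup>2" using u0 by linarith
    hence "(u + d\<^sup>2) powr (- s / 2) \<le> 1 powr (- s / 2)" using s by (intro powr_mono2') auto
    thus ?thesis using S0 by simp
  next
    case True
    define A where "A = {j. j \<le> K \<and> d \<le> (1/2) ^ j}"
    have A: "finite A" "0 \<in> A" using True by (auto simp: A_def)
    define j where "j = Max A"
    have jA: "j \<in> A" using A unfolding j_def by (intro Max_in) auto
    have jK: "j \<le> K" "d \<le> (1/2) ^ j" using jA by (auto simp: A_def)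
    have "(1/2) ^ (2 * Suc j) \<le> u + d\<^sup>2"
    proof (cases "j = K")
      case True
      have "(1/2::real) ^ (2 * Suc j) \<le> (1/2) ^ (2 * K)" using True by (intro power_decreasing) auto
      thus ?thesis using u by (smt (verit) zero_le_power2)
    next
      case False
      have "Suc j \<notin> A" using A by (metis Max_ge Suc_n_not_le_n j_def)
      hence "(1/2) ^ Suc j \<le> d" using False jK by (auto simp: A_def)
      hence "((1/2) ^ Suc j)\<^sup>2 \<le> d\<^sup>2" by (intro power_mono) auto
      thus ?thesis unfolding power_even_eq using u0 by linarith
    qed
    hence "(u + d\<^sup>2) powr (- s / 2) \<le> ((1/2) ^ (2 * Suc j)) powr (- s / 2)"
      using s by (intro powr_mono2') auto
    also have "((1/2::real) ^ (2 * Suc j)) = 2 powr (- real (2 * Suc j))"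
      by (simp only: powr_minus powr_realpow power_one_over inverse_eq_divide zero_less_numeral)
    also have "(2 powr (- real (2 * Suc j))) powr (- s / 2) = 2 powr (real (Suc j) * s)"
      unfolding powr_powr by (intro arg_cong2[where f="(powr)"] refl) (simp add: field_simps)
    also have "\<dots> = 2 powr (real (Suc j) * s) * (if d \<le> (1/2) ^ j then 1 else 0)" using jK by simp
    also have "\<dots> \<le> ?S"
      using jK by (intro member_le_sum) auto
    finally show ?thesis using S0 by linarith
  qed
qed

text \<open>A Frostman exponent \<open>s'\<close> strictly between \<open>s\<close> and the
  dimension makes the dyadic sum geometric with ratio \<open>2 powr (s - s')\<close>, so
  \<open>C\<close> does not depend on the finest scale. The exponent 0 is treated apart, with a
  single point, because the dimension may itself be 0.\<close>

lemma finite_energy: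
  assumes E: "compact E" "E \<subseteq> Rn n" "E \<noteq> {}" and s: "0 \<le> s" "s = 0 \<or> s < hausdorff_dim n E"
  shows "\<exists>C>0. \<forall>u0>0. \<exists>P. finite P \<and> P \<noteq> {} \<and> P \<subseteq> E \<and>
     (\<forall>u\<ge>u0. (\<Sum>p\<in>P. \<Sum>p'\<in>P. (u + (edist n p p')\<^sup>2) powr (- s / 2)) \<le> C * (real (card P))\<^sup>2)"
proof (cases "s = 0")
  case True
  obtain x where "x \<in> E" using E by auto
  thus ?thesis using True by (intro exI[of _ 1] conjI allI impI exI[of _ "{x}"]) auto
next
  case False
  define s' where "s' = (s + hausdorff_dim n E) / 2"
  have s': "0 \<le> s'" "s < s'" "s' < hausdorff_dim n E" using s False by (auto simp: s'_def)
  obtain C where C: "C > 0" and P_ex: "\<And>K. \<exists>P. finite P \<and> P \<noteq> {} \<and> P \<subseteq> E \<and> (\<forall>p\<in>P. \<forall>j\<le>K.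
     real (card {p'\<in>P. edist n p p' \<le> (1/2) ^ j}) \<le> C * 2 powr (- real j * s') * card P)"
    using finite_frostman[OF E(1,2) s'(1,3)] by blast
  define q where "q = 2 powr (s - s')"
  have q: "0 < q" "q < 1" using s' by (auto simp: q_def powr_less_one)
  define C' where "C' = 1 + C * 2 powr s * (1 / (1 - q))"
  show ?thesis
  proof (intro exI[of _ C'] conjI allI impI)
    show "C' > 0" using C q by (auto simp: C'_def intro!: add_pos_nonneg)
    fix u0 :: real assume "u0 > 0"
    then obtain K where "(1/4) ^ K < u0" using real_arch_pow_inv[of u0 "1/4"] by auto
    hence K: "(1/2) ^ (2 * K) \<le> u0" by (simp add: power_mult power_divide)
    obtain P where P: "finite P" "P \<noteq> {}" "P \<subseteq> E" and
      card_le: "\<And>p j. p \<in> P \<Longrightarrow> j \<le> K \<Longrightarrow> real (card {p'\<in>P. edist n p p' \<le> (1/2) ^ j}) \<le> C * 2 powr (- real j * s') * card P"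
      using P_ex[of K] by auto
    show "\<exists>P. finite P \<and> P \<noteq> {} \<and> P \<subseteq> E \<and>
     (\<forall>u\<ge>u0. (\<Sum>p\<in>P. \<Sum>p'\<in>P. (u + (edist n p p')\<^sup>2) powr (- s / 2)) \<le> C' * (real (card P))\<^sup>2)"
    proof (intro exI[of _ P] conjI allI impI P)
      fix u assume u: "u0 \<le> u"
      have "(\<Sum>p'\<in>P. (u + (edist n p p')\<^sup>2) powr (- s / 2)) \<le> C' * card P" if p: "p \<in> P" for p
      proof -
        have "(\<Sum>p'\<in>P. (u + (edist n p p')\<^sup>2) powr (- s / 2)) \<le>
          (\<Sum>p'\<in>P. 1 + (\<Sum>j\<le>K. 2 powr (real (Suc j) * s) * (if edist n p p' \<le> (1/2) ^ j then 1 else 0)))"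
          using K u s by (intro sum_mono riesz_kernel_dyadic_bound) auto
        also have "\<dots> = card P + (\<Sum>j\<le>K. 2 powr (real (Suc j) * s) * (\<Sum>p'\<in>P. (if edist n p p' \<le> (1/2) ^ j then 1 else 0)))"
          unfolding sum.distrib sum_distrib_left by (subst sum.swap) simp
        also have "(\<Sum>j\<le>K. 2 powr (real (Suc j) * s) * (\<Sum>p'\<in>P. (if edist n p p' \<le> (1/2) ^ j then 1 else 0)))
          \<le> (\<Sum>j\<le>K. C * 2 powr s * card P * q ^ j)"
        proof (intro sum_mono)
          fix j assume "j \<in> {..K}"
          have "(\<Sum>p'\<in>P. (if edist n p p' \<le> (1/2) ^ j then 1 else 0)) = real (card {p'\<in>P. edist n p p' \<le> (1/2) ^ j})"
            using P(1) by (simp add: sum.If_cases Int_def)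
          also have "\<dots> \<le> C * 2 powr (- real j * s') * card P" using \<open>j \<in> {..K}\<close> by (intro card_le p) simp
          finally have "2 powr (real (Suc j) * s) * (\<Sum>p'\<in>P. (if edist n p p' \<le> (1/2) ^ j then 1 else 0))
            \<le> 2 powr (real (Suc j) * s) * (C * 2 powr (- real j * s') * card P)"
            by (intro mult_left_mono) auto
          also have "\<dots> = C * (2 powr (real (Suc j) * s) * 2 powr (- real j * s')) * card P" by simp
          also have "2 powr (real (Suc j) * s) * 2 powr (- real j * s') = 2 powr s * q ^ j"
          proof -
            have "q ^ j = 2 powr (real j * (s - s'))" unfolding q_def by (rule powr_power) simp
            thus ?thesis by (simp add: algebra_simps flip: powr_add)
          qed
          finally show "2 powr (real (Suc j) * s) * (\<Sum>p'\<in>P. (if edist n p p' \<le> (1/2) ^ j then 1 else 0))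
            \<le> C * 2 powr s * card P * q ^ j" by (simp add: mult_ac)
        qed
        also have "\<dots> = C * 2 powr s * card P * (\<Sum>j\<le>K. q ^ j)" by (simp add: sum_distrib_left)
        also have "\<dots> \<le> C * 2 powr s * card P * (1 / (1 - q))"
        proof (rule mult_left_mono)
          show "(\<Sum>j\<le>K. q ^ j) \<le> 1 / (1 - q)"
            using q sum_le_suminf[of "\<lambda>j. q ^ j" "{..K}"] summable_geometric[of q] suminf_geometric[of q] by simp
        qed (use C in auto)
        finally show ?thesis by (simp add: C'_def algebra_simps)
      qed
      hence "(\<Sum>p\<in>P. \<Sum>p'\<in>P. (u + (edist n p p')\<^sup>2) powr (- s / 2)) \<le> (\<Sum>p\<in>P. C' * card P)"
        by (intro sum_mono)
      thus "(\<Sum>p\<in>P. \<Sum>p'\<in>P. (u + (edist n p p')\<^sup>2) powr (- s / 2)) \<le> C' * (real (card P))\<^sup>2"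
        by (simp add: power2_eq_square mult_ac)
    qed
  qed
qed

section \<open>Gaussian integrals\<close>

text \<open>The substitution of \<open>y + sqrt u * z\<close> for \<open>z\<close> reduces this to
  the characteristic function of the standard normal distribution.\<close>

lemma has_integral_gaussian_iexp:
  fixes t y u :: real
  assumes "u > 0"
  shows "has_bochner_integral lborel (\<lambda>z. iexp (t * z) * exp (- (z - y)\<^sup>2 / (2 * u)))
           (iexp (t * y) * (sqrt (2 * pi * u) * exp (- u * t\<^sup>2 / 2)))"
proof -
  define a where "a = t * sqrt u"
  have int: "integrable lborel (\<lambda>z. iexp (a * z) * std_normal_density z)"
  proof (rule Bochner_Integration.integrable_bound)
    show "integrable lborel std_normal_density" by simp
  qed (auto simp: norm_mult)
  have "(CLINT z|lborel. iexp (a * z) * std_normal_density z) = char std_normal_distribution a"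
    unfolding char_def by (subst integral_density) (auto simp: scaleR_conv_of_real mult.commute)
  hence "has_bochner_integral lborel (\<lambda>z. iexp (a * z) * std_normal_density z) (exp (- (a\<^sup>2) / 2))"
    using int by (simp add: has_bochner_integral_iff char_std_normal_distribution)
  hence "has_bochner_integral lborel (\<lambda>z. iexp (t * y) * sqrt (2 * pi * u) * (iexp (a * z) * std_normal_density z))
     (iexp (t * y) * sqrt (2 * pi * u) * exp (- (a\<^sup>2) / 2))"
    by (rule has_bochner_integral_mult_right)
  also have "(\<lambda>z. iexp (t * y) * sqrt (2 * pi * u) * (iexp (a * z) * std_normal_density z))
     = (\<lambda>z. (sqrt u) * (iexp (t * (y + sqrt u * z)) * exp (- (y + sqrt u * z - y)\<^sup>2 / (2 * u))))"
  proof
    fix z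
    have "iexp (t * (y + sqrt u * z)) = iexp (t * y) * iexp (a * z)"
      by (simp add: a_def algebra_simps flip: exp_add)
    moreover have "(y + sqrt u * z - y)\<^sup>2 / (2 * u) = z\<^sup>2 / 2"
      using assms by (simp add: power_mult_distrib)
    ultimately show "iexp (t * y) * sqrt (2 * pi * u) * (iexp (a * z) * std_normal_density z)
       = (sqrt u) * (iexp (t * (y + sqrt u * z)) * exp (- (y + sqrt u * z - y)\<^sup>2 / (2 * u)))"
      using assms by (simp add: std_normal_density_def real_sqrt_mult)
  qed
  finally have "has_bochner_integral lborel (\<lambda>z. inverse (sqrt u) * (sqrt u * (iexp (t * (y + sqrt u * z)) * exp (- (y + sqrt u * z - y)\<^sup>2 / (2 * u)))))
     (inverse (sqrt u) * (iexp (t * y) * sqrt (2 * pi * u) * exp (- (a\<^sup>2) / 2)))"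
    by (rule has_bochner_integral_mult_right)
  hence "has_bochner_integral lborel (\<lambda>z. (iexp (t * (y + sqrt u * z)) * exp (- (y + sqrt u * z - y)\<^sup>2 / (2 * u))))
     ((iexp (t * y) * (sqrt (2 * pi * u) * exp (- u * t\<^sup>2 / 2))) /\<^sub>R \<bar>sqrt u\<bar>)"
    using assms by (simp only: mult.assoc[symmetric] scaleR_conv_of_real)
       (simp add: a_def power_mult_distrib mult_ac)
  thus ?thesis
    using assms by (subst lborel_has_bochner_integral_real_affine_iff[where c="sqrt u" and t=y]) auto
qed

lemma has_integral_gaussian_cos:
  fixes t u :: real
  assumes "u > 0"
  shows "has_bochner_integral lborel (\<lambda>z. cos (t * z) * exp (- u * z\<^sup>2 / 2))
           (sqrt (2 * pi / u) * exp (- t\<^sup>2 / (2 * u)))"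
proof -
  have "has_bochner_integral lborel (\<lambda>z. Re (iexp (t * z) * exp (- (z - 0)\<^sup>2 / (2 * (1/u)))))
           (Re (iexp (t * 0) * (sqrt (2 * pi * (1/u)) * exp (- (1/u) * t\<^sup>2 / 2))))"
    using assms by (intro has_bochner_integral_bounded_linear[OF bounded_linear_Re] has_integral_gaussian_iexp) auto
  thus ?thesis
    by (simp add: Re_exp mult_ac flip: of_real_mult)
qed

lemma has_integral_gaussian_moment:
  fixes u :: real
  assumes "u > 0"
  shows "has_bochner_integral lborel (\<lambda>z. z ^ (2*k) * exp (- u * z\<^sup>2 / 2))
           (sqrt (2 * pi) * (fact (2 * k) / (2^k * fact k)) * u powr (- real k - 1/2))"
proof -
  let ?f = "\<lambda>z::real. z ^ (2*k) * exp (- u * z\<^sup>2 / 2)"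
  define s where "s = 1 / sqrt u"
  have s: "s > 0" "s\<^sup>2 = 1 / u" using assms by (auto simp: s_def power_divide)
  have "has_bochner_integral lborel (\<lambda>z. (sqrt (2 * pi) * s ^ (2*k)) * (std_normal_density z * z ^ (2*k)))
     (sqrt (2 * pi) * s ^ (2*k) * (fact (2 * k) / (2^k * fact k)))"
    by (intro has_bochner_integral_mult_right std_normal_moment_even)
  also have "(\<lambda>z. (sqrt (2 * pi) * s ^ (2*k)) * (std_normal_density z * z ^ (2*k))) = (\<lambda>z. ?f (0 + s * z))"
    using assms s by (auto simp: std_normal_density_def power_mult_distrib fun_eq_iff)
  also have "sqrt (2 * pi) * s ^ (2*k) * (fact (2 * k) / (2^k * fact k)) =
     (sqrt (2 * pi) * (fact (2 * k) / (2^k * fact k)) * u powr (- real k - 1/2)) /\<^sub>R \<bar>s\<bar>"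
  proof -
    have "u powr (- real k - 1/2) = u powr (- real k) / u powr (1/2)"
      by (rule powr_diff)
    hence "s ^ (2*k) * s = u powr (- real k - 1/2)"
      unfolding power_mult s(2) s_def using assms
      by (simp add: powr_minus powr_half_sqrt powr_realpow field_simps)
    thus ?thesis using s by (simp add: field_simps)
  qed
  finally show ?thesis
    using s by (subst lborel_has_bochner_integral_real_affine_iff[where c=s and t=0]) auto
qed

text \<open>By Fubini the sum is the squared \<open>L2\<close> norm of a combination of tensor
  products \<open>\<Prod>i\<in>I. f j i (x i)\<close> with coefficients \<open>c j\<close>. It
  serves as Cauchy-Schwarz on the product space while only one-dimensional integrals need to be
  computed.\<close>

lemma gram_product_nonneg:
  fixes f :: "'j \<Rightarrow> 'i \<Rightarrow> real \<Rightarrow> complex" and c :: "'j \<Rightarrow> complex"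
  assumes "finite J" "finite I"
    and int: "\<And>j j' i. \<lbrakk>j \<in> J; j' \<in> J; i \<in> I\<rbrakk> \<Longrightarrow> integrable lborel (\<lambda>z. f j i z * cnj (f j' i z))"
  shows "0 \<le> Re (\<Sum>j\<in>J. \<Sum>j'\<in>J. c j * cnj (c j') * (\<Prod>i\<in>I. CLINT z|lborel. f j i z * cnj (f j' i z)))"
proof -
  interpret product_sigma_finite "\<lambda>_::'i. lborel :: real measure" by standard
  let ?M = "Pi\<^sub>M I (\<lambda>_. lborel :: real measure)"
  let ?F = "\<lambda>j x. \<Prod>i\<in>I. f j i (x i)"
  have i1: "integrable ?M (\<lambda>x. c j * cnj (c j') * (\<Prod>i\<in>I. f j i (x i) * cnj (f j' i (x i))))" if "j \<in> J" "j' \<in> J" for j j'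
    by (intro integrable_mult_right product_integrable_prod assms int that)
  have "(\<Sum>j\<in>J. \<Sum>j'\<in>J. c j * cnj (c j') * (\<Prod>i\<in>I. CLINT z|lborel. f j i z * cnj (f j' i z)))
     = (\<Sum>j\<in>J. \<Sum>j'\<in>J. CLINT x|?M. c j * cnj (c j') * (\<Prod>i\<in>I. f j i (x i) * cnj (f j' i (x i))))"
    by (intro sum.cong refl, subst integral_mult_right_zero, subst product_integral_prod) (auto intro!: assms)
  also have "\<dots> = (CLINT x|?M. \<Sum>j\<in>J. \<Sum>j'\<in>J. c j * cnj (c j') * (\<Prod>i\<in>I. f j i (x i) * cnj (f j' i (x i))))"
    by (simp add: Bochner_Integration.integral_sum Bochner_Integration.integrable_sum i1)
  also have "\<dots> = (CLINT x|?M. complex_of_real ((cmod (\<Sum>j\<in>J. c j * ?F j x))\<^sup>2))"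
    by (intro Bochner_Integration.integral_cong refl)
       (simp only: complex_norm_square sum_product prod.distrib cnj_sum complex_cnj_mult cnj_prod mult_ac)
  also have "\<dots> = complex_of_real (LINT x|?M. (cmod (\<Sum>j\<in>J. c j * ?F j x))\<^sup>2)"
    by (rule integral_complex_of_real)
  finally show ?thesis by simp
qed

section \<open>A bilinear Gaussian inequality\<close>

text \<open>The \<open>k\<close>-th derivative in \<open>v\<close> of \<open>gauss_osc 0 v s\<close>, up to the factor \<open>(-1/2)\<^sup>k\<close>.\<close>

definition gauss_osc :: "nat \<Rightarrow> real \<Rightarrow> real \<Rightarrow> real" where
  "gauss_osc k v s = (LINT \<theta>|lborel. cos (s * \<theta>) * (\<theta> ^ (2*k) * exp (- v * \<theta>\<^sup>2 / 2)))"

lemma integrable_gauss_osc: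
  fixes v s :: real
  assumes "v > 0"
  shows "integrable lborel (\<lambda>\<theta>. cos (s * \<theta>) * (\<theta> ^ (2*k) * exp (- v * \<theta>\<^sup>2 / 2)))"
proof (rule Bochner_Integration.integrable_bound)
  show "integrable lborel (\<lambda>z. z ^ (2*k) * exp (- v * z\<^sup>2 / 2))"
    using has_integral_gaussian_moment[OF assms] by (auto simp: has_bochner_integral_iff)
qed (auto simp: abs_mult intro!: mult_left_le_one_le)

text \<open>Completing the square, the two Gaussians combine to one of variance \<open>u / 2\<close>
  about the midpoint \<open>m\<close>, times \<open>exp (- (y - y')\<^sup>2 / (4 * u))\<close>. Half
  of the new exponent absorbs the growing weight \<open>exp (z\<^sup>2 / 4)\<close> because
  \<open>u \<le> 1\<close>, at the cost of \<open>exp (R\<^sup>2 / 2)\<close>; the other half is a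
  Gaussian of variance \<open>u\<close>.\<close>

lemma gauss_overlap:
  fixes u y y' R :: real
  assumes u: "0 < u" "u \<le> 1" and R: "\<bar>y\<bar> \<le> R" "\<bar>y'\<bar> \<le> R"
  defines "h \<equiv> (\<lambda>z. (exp (- (z - y)\<^sup>2 / (2 * u)) * exp (z\<^sup>2 / 8)) * (exp (- (z - y')\<^sup>2 / (2 * u)) * exp (z\<^sup>2 / 8)))"
  shows "integrable lborel h" "0 \<le> integral\<^sup>L lborel h"
    "integral\<^sup>L lborel h \<le> sqrt (2 * pi * u) * exp (R\<^sup>2 / 2) * exp (- (y - y')\<^sup>2 / (4 * u))"
proof -
  define m where "m = (y + y') / 2"
  let ?g = "\<lambda>z. exp (R\<^sup>2 / 2) * exp (- (y - y')\<^sup>2 / (4 * u)) * (sqrt (2 * pi * u) * normal_density m (sqrt u) z)"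
  have le: "h z \<le> ?g z" for z
  proof -
    have "\<bar>m\<bar> \<le> R" using R by (auto simp: m_def)
    hence "m\<^sup>2 \<le> R\<^sup>2" using R by (auto simp: abs_le_square_iff[symmetric])
    have "z\<^sup>2 / 4 \<le> (z - m)\<^sup>2 / 2 + m\<^sup>2 / 2"
      using zero_le_power2[of "z/2 - m"] by (simp add: power2_eq_square field_simps)
    also have "(z - m)\<^sup>2 / 2 \<le> (z - m)\<^sup>2 / (2 * u)"
      using u by (intro divide_left_mono) auto
    finally have 1: "z\<^sup>2 / 4 \<le> (z - m)\<^sup>2 / (2 * u) + R\<^sup>2 / 2"
      using \<open>m\<^sup>2 \<le> R\<^sup>2\<close> by linarith
    have 2: "(z - y)\<^sup>2 / (2 * u) + (z - y')\<^sup>2 / (2 * u) = (z - m)\<^sup>2 / u + (y - y')\<^sup>2 / (4 * u)"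
      using u by (simp add: m_def power2_eq_square field_simps)
    have "h z = exp (z\<^sup>2 / 4 - ((z - y)\<^sup>2 / (2 * u) + (z - y')\<^sup>2 / (2 * u)))"
      unfolding h_def by (simp add: field_simps flip: exp_add)
    also have "\<dots> \<le> exp (R\<^sup>2 / 2 - (y - y')\<^sup>2 / (4 * u) - (z - m)\<^sup>2 / (2 * u))"
    proof -
      have "(z - m)\<^sup>2 / u = 2 * ((z - m)\<^sup>2 / (2 * u))" using u by simp
      thus ?thesis unfolding 2 exp_le_cancel_iff using 1 by linarith
    qed
    also have "\<dots> = ?g z"
    proof -
      have "sqrt (2 * pi * u) * normal_density m (sqrt u) z = exp (- ((z - m)\<^sup>2 / (2 * u)))"
        using u by (simp add: normal_density_def)
      thus ?thesis by (simp flip: exp_add)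
    qed
    finally show ?thesis .
  qed
  have gi: "integrable lborel ?g"
    using u by (intro integrable_mult_right integrable_normal_density) simp
  show hi: "integrable lborel h"
  proof (rule Bochner_Integration.integrable_bound[OF gi])
    show "AE z in lborel. norm (h z) \<le> norm (?g z)"
    proof (rule AE_I2)
      fix z
      have "0 \<le> h z" by (simp add: h_def)
      thus "norm (h z) \<le> norm (?g z)" using le[of z] by simp
    qed
  qed (simp add: h_def)
  show "0 \<le> integral\<^sup>L lborel h"
    by (intro Bochner_Integration.integral_nonneg) (auto simp: h_def)
  have "integral\<^sup>L lborel h \<le> integral\<^sup>L lborel ?g"
    by (intro integral_mono hi gi le)
  also have "\<dots> = sqrt (2 * pi * u) * exp (R\<^sup>2 / 2) * exp (- (y - y')\<^sup>2 / (4 * u))"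
    using u by simp
  finally show "integral\<^sup>L lborel h \<le> sqrt (2 * pi * u) * exp (R\<^sup>2 / 2) * exp (- (y - y')\<^sup>2 / (4 * u))" .
qed

lemma Re_prod_iexp:
  fixes \<theta> s c :: real
  shows "Re (of_real a * cnj (of_real b * iexp (\<theta> * r)) * (of_real c * iexp (\<theta> * s))) = a * b * c * cos (\<theta> * (s - r))"
proof -
  have "of_real a * cnj (of_real b * cis (\<theta> * r)) * (of_real c * cis (\<theta> * s)) = of_real (a * b * c) * (cis (- (\<theta> * r)) * cis (\<theta> * s))"
    by (simp add: cis_cnj mult_ac)
  also have "cis (- (\<theta> * r)) * cis (\<theta> * s) = cis (\<theta> * (s - r))"
    by (simp add: cis_mult right_diff_distrib)
  finally show ?thesis by (simp only: cis_conv_exp[symmetric]) simp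
qed

lemma prod_gaussian_iexp:
  fixes K \<theta> :: real
  assumes "finite I"
  shows "(\<Prod>i\<in>I. complex_of_real (K * exp (e i)) * iexp (\<theta> * w i)) =
    complex_of_real (K ^ card I * exp (\<Sum>i\<in>I. e i)) * iexp (\<theta> * (\<Sum>i\<in>I. w i))"
  using assms
proof (induction I rule: finite_induct)
  case (insert a I)
  have "iexp (\<theta> * (w a + sum w I)) = iexp (\<theta> * w a) * iexp (\<theta> * sum w I)"
    by (simp add: distrib_left flip: exp_add)
  moreover have "exp (e a + sum e I) = exp (e a) * exp (sum e I)"
    by (rule exp_add)
  ultimately show ?case
    unfolding prod.insert[OF insert.hyps] sum.insert[OF insert.hyps] card_insert_disjoint[OF insert.hyps] insert.IH
    by (simp only: of_real_mult of_real_power power_Suc mult_ac)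
qed simp

text \<open>Positivity of the Gram matrix of the functions \<open>exp (\<i> \<theta> X p \<bullet> z) w(z)\<close> and \<open>exp (-|z - Y q|\<^sup>2 / (2u)) / w(z)\<close> on \<open>\<real>\<^sup>I\<close>,
  with the weight \<open>w(z) = exp (-|z|\<^sup>2 / 8)\<close>.\<close>

lemma bilinear_gaussian_pointwise:
  fixes X :: "'p \<Rightarrow> 'i \<Rightarrow> real" and Y :: "'q \<Rightarrow> 'i \<Rightarrow> real" and r :: "'q \<Rightarrow> real"
    and \<alpha> :: "'p \<Rightarrow> real"
  assumes fin: "finite P" "finite T" "finite I" and u: "0 < u" "u \<le> 1"
    and R: "\<And>q i. q \<in> T \<Longrightarrow> i \<in> I \<Longrightarrow> \<bar>Y q i\<bar> \<le> R"
  defines "h \<equiv> (\<lambda>y y'. LINT z|lborel. (exp (- (z - y)\<^sup>2 / (2 * u)) * exp (z\<^sup>2 / 8)) * (exp (- (z - y')\<^sup>2 / (2 * u)) * exp (z\<^sup>2 / 8)))"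
  shows "2 * (\<Sum>p\<in>P. \<Sum>q\<in>T. \<alpha> p * \<beta> * (sqrt (2*pi*u) ^ card I * exp (- u * \<theta>\<^sup>2 * (\<Sum>i\<in>I. (X p i)\<^sup>2) / 2)) * cos (\<theta> * ((\<Sum>i\<in>I. X p i * Y q i) - r q)))
     \<le> (\<Sum>p\<in>P. \<Sum>p'\<in>P. \<alpha> p * \<alpha> p' * (sqrt (4*pi) ^ card I * exp (- (\<theta>\<^sup>2 * (\<Sum>i\<in>I. (X p i - X p' i)\<^sup>2)))))
      + (\<Sum>q\<in>T. \<Sum>q'\<in>T. \<beta>\<^sup>2 * cos (\<theta> * (r q - r q')) * (\<Prod>i\<in>I. h (Y q i) (Y q' i)))"
proof -
  define f :: "'p + 'q \<Rightarrow> 'i \<Rightarrow> real \<Rightarrow> complex" where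
    "f j i z = (case j of Inl p \<Rightarrow> iexp (\<theta> * X p i * z) * exp (- z\<^sup>2 / 8)
                 | Inr q \<Rightarrow> of_real (exp (- (z - Y q i)\<^sup>2 / (2 * u)) * exp (z\<^sup>2 / 8)))" for j i z
  \<comment> \<open>The minus sign makes positivity an upper bound for the cross terms, and the
    phase brings in the shift \<open>r q\<close>.\<close>
  define c :: "'p + 'q \<Rightarrow> complex" where
    "c j = (case j of Inl p \<Rightarrow> of_real (\<alpha> p) | Inr q \<Rightarrow> - (of_real \<beta> * iexp (\<theta> * r q)))" for j
  let ?ip = "\<lambda>j j'. \<Prod>i\<in>I. CLINT z|lborel. f j i z * cnj (f j' i z)"
  \<comment> \<open>The squared weight \<open>exp (- z\<^sup>2 / 4)\<close> is a Gaussian of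
    variance 2, whence \<open>sqrt (4 * pi)\<close>.\<close>
  have pp: "has_bochner_integral lborel (\<lambda>z. f (Inl p) i z * cnj (f (Inl p') i z))
      (of_real (sqrt (4 * pi) * exp (- (\<theta>\<^sup>2 * (X p i - X p' i)\<^sup>2))))" for p p' i
  proof -
    have "(\<lambda>z. f (Inl p) i z * cnj (f (Inl p') i z)) = (\<lambda>z. iexp ((\<theta> * (X p i - X p' i)) * z) * exp (- (z - 0)\<^sup>2 / (2 * 2)))"
    proof
      fix z
      have "f (Inl p) i z * cnj (f (Inl p') i z) = (iexp (\<theta> * X p i * z) * iexp (- (\<theta> * X p' i * z))) * complex_of_real (exp (- z\<^sup>2 / 8) * exp (- z\<^sup>2 / 8))"
        by (simp add: f_def exp_cnj mult_ac)
      moreover have "iexp (\<theta> * X p i * z) * iexp (- (\<theta> * X p' i * z)) = iexp ((\<theta> * (X p i - X p' i)) * z)"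
        by (simp add: algebra_simps flip: exp_add)
      moreover have "exp (- z\<^sup>2 / 8) * exp (- z\<^sup>2 / 8) = exp (- (z - 0)\<^sup>2 / (2 * 2))"
        by (simp flip: exp_add)
      ultimately show "f (Inl p) i z * cnj (f (Inl p') i z) = iexp ((\<theta> * (X p i - X p' i)) * z) * exp (- (z - 0)\<^sup>2 / (2 * 2))"
        by (simp only:)
    qed
    thus ?thesis
      using has_integral_gaussian_iexp[of 2 "\<theta> * (X p i - X p' i)" 0] by (simp add: power_mult_distrib)
  qed
  \<comment> \<open>In the mixed products the weights cancel, and the Fourier transform of the
    Gaussian about \<open>Y q i\<close> remains.\<close>
  have pq: "has_bochner_integral lborel (\<lambda>z. f (Inl p) i z * cnj (f (Inr q) i z))
      (of_real (sqrt (2 * pi * u) * exp (- u * \<theta>\<^sup>2 * (X p i)\<^sup>2 / 2)) * iexp (\<theta> * (X p i * Y q i)))" for p q i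
  proof -
    have "(\<lambda>z. f (Inl p) i z * cnj (f (Inr q) i z)) = (\<lambda>z. iexp ((\<theta> * X p i) * z) * exp (- (z - Y q i)\<^sup>2 / (2 * u)))"
      by (simp add: f_def fun_eq_iff exp_minus)
    thus ?thesis
      using has_integral_gaussian_iexp[OF u(1), of "\<theta> * X p i" "Y q i"] by (simp add: power_mult_distrib mult_ac)
  qed
  have qp: "has_bochner_integral lborel (\<lambda>z. f (Inr q) i z * cnj (f (Inl p) i z))
      (cnj (of_real (sqrt (2 * pi * u) * exp (- u * \<theta>\<^sup>2 * (X p i)\<^sup>2 / 2)) * iexp (\<theta> * (X p i * Y q i))))" for p q i
    using has_bochner_integral_bounded_linear[OF bounded_linear_cnj pq] by (simp add: mult_ac)
  have qq: "has_bochner_integral lborel (\<lambda>z. f (Inr q) i z * cnj (f (Inr q') i z)) (of_real (h (Y q i) (Y q' i)))"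
    if "q \<in> T" "q' \<in> T" "i \<in> I" for q q' i
  proof -
    have "has_bochner_integral lborel (\<lambda>z. (exp (- (z - Y q i)\<^sup>2 / (2 * u)) * exp (z\<^sup>2 / 8)) * (exp (- (z - Y q' i)\<^sup>2 / (2 * u)) * exp (z\<^sup>2 / 8)))
        (h (Y q i) (Y q' i))"
      unfolding h_def using gauss_overlap(1)[OF u R R] that by (auto simp: has_bochner_integral_iff)
    from has_bochner_integral_bounded_linear[OF bounded_linear_of_real this]
    show ?thesis by (simp add: f_def)
  qed
  have "0 \<le> Re (\<Sum>j\<in>P <+> T. \<Sum>j'\<in>P <+> T. c j * cnj (c j') * ?ip j j')"
  proof (rule gram_product_nonneg)
    show "integrable lborel (\<lambda>z. f j i z * cnj (f j' i z))" if "j \<in> P <+> T" "j' \<in> P <+> T" "i \<in> I" for j j' i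
      using that pp pq qp qq by (auto simp: has_bochner_integral_iff)
  qed (use fin in auto)
  also have "\<dots> = (\<Sum>j\<in>P <+> T. \<Sum>j'\<in>P <+> T. Re (c j * cnj (c j') * ?ip j j'))"
    by simp
  also have "\<dots> = (\<Sum>p\<in>P. \<Sum>p'\<in>P. Re (c (Inl p) * cnj (c (Inl p')) * ?ip (Inl p) (Inl p')))
      + (\<Sum>p\<in>P. \<Sum>q\<in>T. Re (c (Inl p) * cnj (c (Inr q)) * ?ip (Inl p) (Inr q)))
      + (\<Sum>q\<in>T. \<Sum>p\<in>P. Re (c (Inr q) * cnj (c (Inl p)) * ?ip (Inr q) (Inl p)))
      + (\<Sum>q\<in>T. \<Sum>q'\<in>T. Re (c (Inr q) * cnj (c (Inr q')) * ?ip (Inr q) (Inr q')))"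
    using fin by (simp only: sum.Plus o_def sum.distrib add_ac)
  also have "(\<Sum>p\<in>P. \<Sum>p'\<in>P. Re (c (Inl p) * cnj (c (Inl p')) * ?ip (Inl p) (Inl p')))
    = (\<Sum>p\<in>P. \<Sum>p'\<in>P. \<alpha> p * \<alpha> p' * (sqrt (4*pi) ^ card I * exp (- (\<theta>\<^sup>2 * (\<Sum>i\<in>I. (X p i - X p' i)\<^sup>2)))))"
  proof (intro sum.cong refl)
    fix p p'
    have "?ip (Inl p) (Inl p') =
        of_real (sqrt (4*pi) ^ card I * (\<Prod>i\<in>I. exp (- (\<theta>\<^sup>2 * (X p i - X p' i)\<^sup>2))))"
      unfolding has_bochner_integral_integral_eq[OF pp] of_real_prod[symmetric] prod.distrib prod_constant ..
    also have "(\<Prod>i\<in>I. exp (- (\<theta>\<^sup>2 * (X p i - X p' i)\<^sup>2))) = exp (- (\<theta>\<^sup>2 * (\<Sum>i\<in>I. (X p i - X p' i)\<^sup>2)))"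
      by (simp add: exp_sum[OF fin(3), symmetric] sum_distrib_left sum_negf)
    finally show "Re (c (Inl p) * cnj (c (Inl p')) * ?ip (Inl p) (Inl p')) =
        \<alpha> p * \<alpha> p' * (sqrt (4*pi) ^ card I * exp (- (\<theta>\<^sup>2 * (\<Sum>i\<in>I. (X p i - X p' i)\<^sup>2))))"
      by (simp only: c_def sum.case complex_cnj_complex_of_real of_real_mult[symmetric] Re_complex_of_real)
  qed
  also have "(\<Sum>q\<in>T. \<Sum>p\<in>P. Re (c (Inr q) * cnj (c (Inl p)) * ?ip (Inr q) (Inl p)))
     = (\<Sum>p\<in>P. \<Sum>q\<in>T. Re (cnj (c (Inl p) * cnj (c (Inr q)) * ?ip (Inl p) (Inr q))))"
    by (subst sum.swap) (simp only: has_bochner_integral_integral_eq[OF pq] has_bochner_integral_integral_eq[OF qp] cnj_prod complex_cnj_mult complex_cnj_cnj mult_ac)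
  also have "\<dots> = (\<Sum>p\<in>P. \<Sum>q\<in>T. Re (c (Inl p) * cnj (c (Inr q)) * ?ip (Inl p) (Inr q)))"
    by (intro sum.cong refl) (rule cnj.simps(1))
  also have "\<dots> = - (\<Sum>p\<in>P. \<Sum>q\<in>T. \<alpha> p * \<beta> * (sqrt (2*pi*u) ^ card I * exp (- u * \<theta>\<^sup>2 * (\<Sum>i\<in>I. (X p i)\<^sup>2) / 2)) * cos (\<theta> * ((\<Sum>i\<in>I. X p i * Y q i) - r q)))"
    unfolding sum_negf[symmetric]
  proof (intro sum.cong refl)
    fix p q
    have "?ip (Inl p) (Inr q) =
        of_real (sqrt (2 * pi * u) ^ card I * exp (- u * \<theta>\<^sup>2 * (\<Sum>i\<in>I. (X p i)\<^sup>2) / 2)) * iexp (\<theta> * (\<Sum>i\<in>I. X p i * Y q i))"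
      unfolding has_bochner_integral_integral_eq[OF pq] prod_gaussian_iexp[OF fin(3)]
      by (simp only: sum_distrib_left sum_divide_distrib)
    thus "Re (c (Inl p) * cnj (c (Inr q)) * ?ip (Inl p) (Inr q)) =
      - (\<alpha> p * \<beta> * (sqrt (2*pi*u) ^ card I * exp (- u * \<theta>\<^sup>2 * (\<Sum>i\<in>I. (X p i)\<^sup>2) / 2)) * cos (\<theta> * ((\<Sum>i\<in>I. X p i * Y q i) - r q)))"
      using Re_prod_iexp[of "\<alpha> p" \<beta> \<theta> "r q" "sqrt (2*pi*u) ^ card I * exp (- u * \<theta>\<^sup>2 * (\<Sum>i\<in>I. (X p i)\<^sup>2) / 2)" "\<Sum>i\<in>I. X p i * Y q i"]
      by (simp only: c_def sum.case complex_cnj_minus mult_minus_left mult_minus_right uminus_complex.sel)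
  qed
  also have "(\<Sum>q\<in>T. \<Sum>q'\<in>T. Re (c (Inr q) * cnj (c (Inr q')) * ?ip (Inr q) (Inr q')))
     = (\<Sum>q\<in>T. \<Sum>q'\<in>T. \<beta>\<^sup>2 * cos (\<theta> * (r q - r q')) * (\<Prod>i\<in>I. h (Y q i) (Y q' i)))"
  proof (intro sum.cong refl)
    fix q q' assume q: "q \<in> T" "q' \<in> T"
    have "?ip (Inr q) (Inr q') = of_real (\<Prod>i\<in>I. h (Y q i) (Y q' i))"
      unfolding of_real_prod by (intro prod.cong refl has_bochner_integral_integral_eq[OF qq] q)
    moreover have "c (Inr q) * cnj (c (Inr q')) = of_real (\<beta>\<^sup>2) * (cis (\<theta> * r q) * cis (- (\<theta> * r q')))"
      unfolding c_def sum.case cis_conv_exp[symmetric]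
      by (simp add: cis_cnj power2_eq_square mult_ac)
    moreover have "cis (\<theta> * r q) * cis (- (\<theta> * r q')) = cis (\<theta> * (r q - r q'))"
      by (simp add: cis_mult right_diff_distrib)
    ultimately show "Re (c (Inr q) * cnj (c (Inr q')) * ?ip (Inr q) (Inr q')) =
        \<beta>\<^sup>2 * cos (\<theta> * (r q - r q')) * (\<Prod>i\<in>I. h (Y q i) (Y q' i))"
      by (simp add: mult_ac del: of_real_prod)
  qed
  finally show ?thesis by linarith
qed

text \<open>The first line collects the constants of the \<open>X\<close> side: the mass of the
  squared weight in each coordinate and the Gaussian moment of order \<open>4 * k\<close>. The
  second line collects those of the \<open>Y\<close> side.\<close>

definition gauss_const :: "nat \<Rightarrow> nat \<Rightarrow> real \<Rightarrow> real" where
  "gauss_const N k R = sqrt (4 * pi) ^ N * (sqrt (2 * pi) * (fact (2 * (2*k)) / (2^(2*k) * fact (2*k))))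
     * ((exp (R\<^sup>2 / 2) / sqrt (2 * pi)) ^ N * sqrt pi)"

lemma gauss_const_pos: "gauss_const N k R > 0"
  by (simp add: gauss_const_def)

text \<open>Gram positivity yields Cauchy-Schwarz in additive form with a free weight
  \<open>e\<close>; the two terms balance at \<open>e = sqrt b / sqrt a\<close>.\<close>

lemma optimize_eps:
  fixes x a b :: real
  assumes "a > 0" "b > 0" "\<And>e. e > 0 \<Longrightarrow> 2 * \<bar>x\<bar> \<le> e * a + b / e"
  shows "x\<^sup>2 \<le> a * b"
proof -
  define e where "e = sqrt b / sqrt a"
  have "e > 0" using assms by (simp add: e_def)
  have "e * a = sqrt a * sqrt b" "b / e = sqrt a * sqrt b"
    using assms by (auto simp: e_def field_simps)
  with assms(3)[OF \<open>e > 0\<close>] have "\<bar>x\<bar> \<le> sqrt a * sqrt b" by linarith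
  hence "\<bar>x\<bar>\<^sup>2 \<le> (sqrt a * sqrt b)\<^sup>2" by (intro power_mono) auto
  thus ?thesis using assms by (simp add: power_mult_distrib)
qed

abbreviation riesz_energy :: "'i set \<Rightarrow> ('p \<Rightarrow> 'i \<Rightarrow> real) \<Rightarrow> real \<Rightarrow> real \<Rightarrow> 'p set \<Rightarrow> real" where
  "riesz_energy I X s u P \<equiv> \<Sum>p\<in>P. \<Sum>p'\<in>P. (u + (\<Sum>i\<in>I. (X p i - X p' i)\<^sup>2)) powr (- s / 2)"

abbreviation gauss_energy :: "'i set \<Rightarrow> ('q \<Rightarrow> 'i \<Rightarrow> real) \<Rightarrow> ('q \<Rightarrow> real) \<Rightarrow> real \<Rightarrow> 'q set \<Rightarrow> real" where
  "gauss_energy I Y r u T \<equiv> \<Sum>q\<in>T. \<Sum>q'\<in>T. exp (- ((\<Sum>i\<in>I. (Y q i - Y q' i)\<^sup>2) + (r q - r q')\<^sup>2) / (4 * u))"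

text \<open>Since \<open>L\<close> exceeds \<open>|X p|\<^sup>2 + 1\<close>, the Gaussian of variance \<open>L u\<close> in \<open>\<theta>\<close> splits into the part \<open>u |X p|\<^sup>2\<close> produced by
  smoothing \<open>Y\<close> at scale \<open>u\<close>, a part \<open>u\<close> attached to \<open>Y\<close>, and a remainder of at least \<open>u\<close> attached to \<open>X\<close>.\<close>

lemma bilinear_gauss_osc:
  fixes X :: "'p \<Rightarrow> 'i \<Rightarrow> real" and Y :: "'q \<Rightarrow> 'i \<Rightarrow> real" and r :: "'q \<Rightarrow> real"
  assumes fin: "finite P" "finite T" "finite I" and ne: "P \<noteq> {}" "T \<noteq> {}"
    and u: "0 < u" "u \<le> 1"
    and RX: "\<And>p. p \<in> P \<Longrightarrow> 2 + (\<Sum>i\<in>I. (X p i)\<^sup>2) \<le> L"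
    and RY: "\<And>q i. q \<in> T \<Longrightarrow> i \<in> I \<Longrightarrow> \<bar>Y q i\<bar> \<le> R"
  shows "(\<Sum>p\<in>P. \<Sum>q\<in>T. gauss_osc k (L * u) ((\<Sum>i\<in>I. X p i * Y q i) - r q))\<^sup>2
    \<le> gauss_const (card I) k R * (\<Sum>p\<in>P. \<Sum>p'\<in>P. (u + (\<Sum>i\<in>I. (X p i - X p' i)\<^sup>2)) powr (- 2 * real k - 1/2))
      * (u powr (- (real (card I) + 1) / 2) *
         gauss_energy I Y r u T)"
proof -
  define N where "N = card I"
  define s where "s p q = (\<Sum>i\<in>I. X p i * Y q i) - r q" for p q
  define D where "D p p' = (\<Sum>i\<in>I. (X p i - X p' i)\<^sup>2)" for p p'
  define S where "S p = (\<Sum>i\<in>I. (X p i)\<^sup>2)" for p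
  define V where "V p = L - 1 - S p" for p
  define h where "h = (\<lambda>y y'. LINT z|lborel. (exp (- (z - y)\<^sup>2 / (2 * u)) * exp (z\<^sup>2 / 8)) * (exp (- (z - y')\<^sup>2 / (2 * u)) * exp (z\<^sup>2 / 8)))"
  define H where "H q q' = (\<Prod>i\<in>I. h (Y q i) (Y q' i))" for q q'
  define C where "C = sqrt (2 * pi) * (fact (2 * (2*k)) / (2^(2*k) * fact (2*k)))"
  define m where "m = - 2 * real k - 1/2"
  define \<Phi> where "\<Phi> = (\<Sum>p\<in>P. \<Sum>q\<in>T. gauss_osc k (L * u) (s p q))"
  define SP where "SP = (\<Sum>p\<in>P. \<Sum>p'\<in>P. (u + D p p') powr m)"
  define E where "E q q' = (\<Sum>i\<in>I. (Y q i - Y q' i)\<^sup>2)" for q q'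
  define ST where "ST = (\<Sum>q\<in>T. \<Sum>q'\<in>T. exp (- (E q q' + (r q - r q')\<^sup>2) / (4 * u)))"
  define a where "a = sqrt (4 * pi) ^ N * C * SP"
  define b where "b = (exp (R\<^sup>2 / 2) / sqrt (2 * pi)) ^ N * sqrt pi * (u powr (- (real N + 1) / 2) * ST)"
  have C: "C > 0" by (simp add: C_def)
  have D0: "D p p' \<ge> 0" for p p' by (auto simp: D_def intro: sum_nonneg)
  have V: "V p \<ge> 1" if "p \<in> P" for p using RX[OF that] by (simp add: V_def S_def)
  have L: "L > 0"
  proof -
    obtain p where "p \<in> P" using ne by auto
    from RX[OF this] show ?thesis using sum_nonneg[of I "\<lambda>i. (X p i)\<^sup>2"] by auto
  qed
  have SP0: "SP > 0"
    unfolding SP_def using fin ne u D0 by (intro sum_pos) (auto simp: add_pos_nonneg[THEN less_imp_neq, symmetric])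
  have ST0: "ST > 0"
    unfolding ST_def using fin ne by (intro sum_pos) auto
  \<comment> \<open>\<open>e\<close> is the free weight for \<open>optimize_eps\<close>, and the
    sign \<open>sg\<close> lets the same inequality bound both \<open>\<Phi>\<close> and
    \<open>- \<Phi>\<close>.\<close>
  have pw: "2 * (\<Sum>p\<in>P. \<Sum>q\<in>T. sg * (cos (s p q * \<theta>) * (\<theta> ^ (2*k) * exp (- (L * u) * \<theta>\<^sup>2 / 2))))
      \<le> (\<Sum>p\<in>P. \<Sum>p'\<in>P. e * sqrt (4*pi) ^ N * (\<theta> ^ (2 * (2*k)) * exp (- ((V p + V p') * u + 2 * D p p') * \<theta>\<^sup>2 / 2)))
      + (\<Sum>q\<in>T. \<Sum>q'\<in>T. (1 / sqrt (2*pi*u)) ^ N * (1 / sqrt (2*pi*u)) ^ N / e * H q q' * (cos ((r q - r q') * \<theta>) * exp (- (2 * u) * \<theta>\<^sup>2 / 2)))"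
    if e: "e > 0" and sg: "\<bar>sg\<bar> = 1" for e sg \<theta> :: real
  proof -
    \<comment> \<open>The whole factor \<open>\<theta> ^ (2*k)\<close> goes to the \<open>X\<close>
      side, where squaring turns it into a moment of order \<open>4 * k\<close> and hence the kernel
      exponent \<open>m\<close>. The \<open>Y\<close> side keeps a plain Gaussian in
      \<open>\<theta>\<close>.\<close>
    define \<alpha> where "\<alpha> p = sqrt e * \<theta> ^ (2*k) * exp (- V p * u * \<theta>\<^sup>2 / 2)" for p
    define \<beta> where "\<beta> = sg * exp (- u * \<theta>\<^sup>2 / 2) * (1 / sqrt (2*pi*u)) ^ N / sqrt e"
    have "2 * (\<Sum>p\<in>P. \<Sum>q\<in>T. \<alpha> p * \<beta> * (sqrt (2*pi*u) ^ N * exp (- u * \<theta>\<^sup>2 * S p / 2)) * cos (\<theta> * s p q))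
      \<le> (\<Sum>p\<in>P. \<Sum>p'\<in>P. \<alpha> p * \<alpha> p' * (sqrt (4*pi) ^ N * exp (- (\<theta>\<^sup>2 * D p p'))))
      + (\<Sum>q\<in>T. \<Sum>q'\<in>T. \<beta>\<^sup>2 * cos (\<theta> * (r q - r q')) * H q q')"
      using bilinear_gaussian_pointwise[where X=X and Y=Y and R=R and \<alpha>=\<alpha> and \<beta>=\<beta> and \<theta>=\<theta> and r=r, OF fin u RY]
      unfolding N_def S_def s_def D_def H_def h_def by simp
    moreover have "\<alpha> p * \<beta> * (sqrt (2*pi*u) ^ N * exp (- u * \<theta>\<^sup>2 * S p / 2)) * cos (\<theta> * s p q)
        = sg * (cos (s p q * \<theta>) * (\<theta> ^ (2*k) * exp (- (L * u) * \<theta>\<^sup>2 / 2)))" for p q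
    proof -
      have "exp (- V p * u * \<theta>\<^sup>2 / 2) * exp (- u * \<theta>\<^sup>2 / 2) * exp (- u * \<theta>\<^sup>2 * S p / 2) = exp (- (L * u) * \<theta>\<^sup>2 / 2)"
        unfolding exp_add[symmetric] by (simp add: V_def field_simps)
      moreover have "(1 / sqrt (2*pi*u)) ^ N * sqrt (2*pi*u) ^ N = 1"
        using u by (simp flip: power_mult_distrib)
      moreover have "\<alpha> p * \<beta> * (sqrt (2*pi*u) ^ N * exp (- u * \<theta>\<^sup>2 * S p / 2)) * cos (\<theta> * s p q) =
        (sqrt e / sqrt e) * ((1 / sqrt (2*pi*u)) ^ N * sqrt (2*pi*u) ^ N) * (sg * (cos (\<theta> * s p q) * (\<theta> ^ (2*k) *
         (exp (- V p * u * \<theta>\<^sup>2 / 2) * exp (- u * \<theta>\<^sup>2 / 2) * exp (- u * \<theta>\<^sup>2 * S p / 2)))))"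
        unfolding \<alpha>_def \<beta>_def by (simp only: divide_inverse mult_ac)
      ultimately show ?thesis using e by (simp add: mult.commute)
    qed
    moreover have "\<alpha> p * \<alpha> p' * (sqrt (4*pi) ^ N * exp (- (\<theta>\<^sup>2 * D p p')))
        = e * sqrt (4*pi) ^ N * (\<theta> ^ (2 * (2*k)) * exp (- ((V p + V p') * u + 2 * D p p') * \<theta>\<^sup>2 / 2))" for p p'
    proof -
      have "exp (- V p * u * \<theta>\<^sup>2 / 2) * exp (- V p' * u * \<theta>\<^sup>2 / 2) * exp (- (\<theta>\<^sup>2 * D p p')) = exp (- ((V p + V p') * u + 2 * D p p') * \<theta>\<^sup>2 / 2)"
        unfolding exp_add[symmetric] by (simp add: field_simps)
      moreover have "\<theta> ^ (2 * (2*k)) = \<theta> ^ (2*k) * \<theta> ^ (2*k)" by (simp flip: power_add)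
      moreover have "\<alpha> p * \<alpha> p' * (sqrt (4*pi) ^ N * exp (- (\<theta>\<^sup>2 * D p p'))) = (sqrt e * sqrt e) * sqrt (4*pi) ^ N * ((\<theta> ^ (2*k) * \<theta> ^ (2*k)) *
           (exp (- V p * u * \<theta>\<^sup>2 / 2) * exp (- V p' * u * \<theta>\<^sup>2 / 2) * exp (- (\<theta>\<^sup>2 * D p p'))))"
        unfolding \<alpha>_def by (simp only: mult_ac)
      ultimately show ?thesis using e by simp
    qed
    moreover have "\<beta>\<^sup>2 * cos (\<theta> * (r q - r q')) * H q q' =
        (1 / sqrt (2*pi*u)) ^ N * (1 / sqrt (2*pi*u)) ^ N / e * H q q' * (cos ((r q - r q') * \<theta>) * exp (- (2 * u) * \<theta>\<^sup>2 / 2))" for q q'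
    proof -
      have "exp (- u * \<theta>\<^sup>2 / 2) * exp (- u * \<theta>\<^sup>2 / 2) = exp (- (2 * u) * \<theta>\<^sup>2 / 2)"
        unfolding exp_add[symmetric] by (simp add: field_simps)
      moreover have "sg * sg = 1" using sg by (metis abs_mult_self_eq mult_1)
      moreover have "\<beta>\<^sup>2 = (sg * sg) * ((1 / sqrt (2*pi*u)) ^ N * (1 / sqrt (2*pi*u)) ^ N / (sqrt e * sqrt e)) * (exp (- u * \<theta>\<^sup>2 / 2) * exp (- u * \<theta>\<^sup>2 / 2))"
        unfolding \<beta>_def power2_eq_square by (simp only: times_divide_times_eq times_divide_eq_right times_divide_eq_left divide_divide_eq_left mult_ac)
      ultimately show ?thesis using e by (simp add: mult_ac)
    qed
    ultimately show ?thesis by simp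
  qed
  have iA: "has_bochner_integral lborel (\<lambda>\<theta>. \<theta> ^ (2 * (2*k)) * exp (- ((V p + V p') * u + 2 * D p p') * \<theta>\<^sup>2 / 2))
      (C * ((V p + V p') * u + 2 * D p p') powr m)" if "p \<in> P" "p' \<in> P" for p p'
  proof -
    have "(V p + V p') * u + 2 * D p p' > 0"
      using V[OF that(1)] V[OF that(2)] u D0[of p p'] by (intro add_pos_nonneg mult_pos_pos) auto
    from has_integral_gaussian_moment[OF this, of "2*k"] show ?thesis by (simp add: C_def m_def)
  qed
  have iB: "has_bochner_integral lborel (\<lambda>\<theta>. cos ((r q - r q') * \<theta>) * exp (- (2 * u) * \<theta>\<^sup>2 / 2))
      (sqrt (2 * pi / (2 * u)) * exp (- (r q - r q')\<^sup>2 / (2 * (2 * u))))" for q q'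
    using u by (intro has_integral_gaussian_cos) simp
  have iL: "has_bochner_integral lborel (\<lambda>\<theta>. cos (s p q * \<theta>) * (\<theta> ^ (2*k) * exp (- (L * u) * \<theta>\<^sup>2 / 2))) (gauss_osc k (L * u) (s p q))" for p q
    unfolding has_bochner_integral_iff gauss_osc_def
    using u L by (intro conjI integrable_gauss_osc mult_pos_pos refl)
  have gen: "c ^ N * c ^ N / e * ((x * y) ^ N * E1) * (w * F1) = ((c * c * (x * y)) ^ N * w) / e * (E1 * F1)"
    for c e x y E1 w F1 :: real
    by (simp add: power_mult_distrib)
  have main: "2 * (sg * \<Phi>) \<le> e * a + b / e" if e: "e > 0" and sg: "\<bar>sg\<bar> = 1" for e sg :: real
  proof -
    have l: "has_bochner_integral lborel (\<lambda>\<theta>. 2 * (\<Sum>p\<in>P. \<Sum>q\<in>T. sg * (cos (s p q * \<theta>) * (\<theta> ^ (2*k) * exp (- (L * u) * \<theta>\<^sup>2 / 2)))))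
        (2 * (\<Sum>p\<in>P. \<Sum>q\<in>T. sg * gauss_osc k (L * u) (s p q)))"
      by (intro has_bochner_integral_mult_right has_bochner_integral_sum iL)
    have rr: "has_bochner_integral lborel (\<lambda>\<theta>. (\<Sum>p\<in>P. \<Sum>p'\<in>P. e * sqrt (4*pi) ^ N * (\<theta> ^ (2 * (2*k)) * exp (- ((V p + V p') * u + 2 * D p p') * \<theta>\<^sup>2 / 2)))
      + (\<Sum>q\<in>T. \<Sum>q'\<in>T. (1 / sqrt (2*pi*u)) ^ N * (1 / sqrt (2*pi*u)) ^ N / e * H q q' * (cos ((r q - r q') * \<theta>) * exp (- (2 * u) * \<theta>\<^sup>2 / 2))))
      ((\<Sum>p\<in>P. \<Sum>p'\<in>P. e * sqrt (4*pi) ^ N * (C * ((V p + V p') * u + 2 * D p p') powr m))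
      + (\<Sum>q\<in>T. \<Sum>q'\<in>T. (1 / sqrt (2*pi*u)) ^ N * (1 / sqrt (2*pi*u)) ^ N / e * H q q' * (sqrt (2 * pi / (2 * u)) * exp (- (r q - r q')\<^sup>2 / (2 * (2 * u))))))"
      by (intro has_bochner_integral_add has_bochner_integral_mult_right has_bochner_integral_sum iA iB)
    have "2 * (\<Sum>p\<in>P. \<Sum>q\<in>T. sg * gauss_osc k (L * u) (s p q)) \<le>
      (\<Sum>p\<in>P. \<Sum>p'\<in>P. e * sqrt (4*pi) ^ N * (C * ((V p + V p') * u + 2 * D p p') powr m))
      + (\<Sum>q\<in>T. \<Sum>q'\<in>T. (1 / sqrt (2*pi*u)) ^ N * (1 / sqrt (2*pi*u)) ^ N / e * H q q' * (sqrt (2 * pi / (2 * u)) * exp (- (r q - r q')\<^sup>2 / (2 * (2 * u)))))"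
      using l rr pw[OF e sg]
      unfolding has_bochner_integral_iff by (metis (no_types, lifting) integral_mono)
    also have "(\<Sum>p\<in>P. \<Sum>p'\<in>P. e * sqrt (4*pi) ^ N * (C * ((V p + V p') * u + 2 * D p p') powr m))
       \<le> (\<Sum>p\<in>P. \<Sum>p'\<in>P. e * sqrt (4*pi) ^ N * (C * (u + D p p') powr m))"
    proof (intro sum_mono mult_left_mono)
      fix p p' assume p: "p \<in> P" "p' \<in> P"
      have "1 * u \<le> (V p + V p') * u"
        using V[OF p(1)] V[OF p(2)] u by (intro mult_right_mono) auto
      hence "u + D p p' \<le> (V p + V p') * u + 2 * D p p'" using D0[of p p'] by linarith
      thus "((V p + V p') * u + 2 * D p p') powr m \<le> (u + D p p') powr m"
        using u D0[of p p'] by (intro powr_mono2') (auto simp: m_def)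
    qed (use e C in auto)
    also have "\<dots> = e * a"
      by (simp add: a_def SP_def sum_distrib_left mult_ac)
    also have "(\<Sum>q\<in>T. \<Sum>q'\<in>T. (1 / sqrt (2*pi*u)) ^ N * (1 / sqrt (2*pi*u)) ^ N / e * H q q' * (sqrt (2 * pi / (2 * u)) * exp (- (r q - r q')\<^sup>2 / (2 * (2 * u)))))
      \<le> (\<Sum>q\<in>T. \<Sum>q'\<in>T. (exp (R\<^sup>2 / 2) / sqrt (2 * pi)) ^ N * sqrt pi * (u powr (- (real N + 1) / 2)) / e * exp (- (E q q' + (r q - r q')\<^sup>2) / (4 * u)))"
    proof (intro sum_mono)
      fix q q' assume q: "q \<in> T" "q' \<in> T"
      have "H q q' \<le> (\<Prod>i\<in>I. sqrt (2 * pi * u) * exp (R\<^sup>2 / 2) * exp (- (Y q i - Y q' i)\<^sup>2 / (4 * u)))"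
        unfolding H_def h_def using gauss_overlap[OF u RY RY] q by (intro prod_mono) auto
      also have "\<dots> = (sqrt (2 * pi * u) * exp (R\<^sup>2 / 2)) ^ N * exp (- E q q' / (4 * u))"
        by (simp add: prod.distrib N_def E_def fin exp_sum[symmetric] sum_divide_distrib sum_negf)
      finally have H: "H q q' \<le> \<dots>" .
      have "(1 / sqrt (2*pi*u)) ^ N * (1 / sqrt (2*pi*u)) ^ N / e * H q q' * (sqrt (2 * pi / (2 * u)) * exp (- (r q - r q')\<^sup>2 / (2 * (2 * u))))
        \<le> (1 / sqrt (2*pi*u)) ^ N * (1 / sqrt (2*pi*u)) ^ N / e * ((sqrt (2 * pi * u) * exp (R\<^sup>2 / 2)) ^ N * exp (- E q q' / (4 * u))) * (sqrt (2 * pi / (2 * u)) * exp (- (r q - r q')\<^sup>2 / (2 * (2 * u))))"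
        using e u by (intro mult_right_mono mult_left_mono H) auto
      also have "\<dots> = (((1 / sqrt (2*pi*u)) * (1 / sqrt (2*pi*u)) * (sqrt (2 * pi * u) * exp (R\<^sup>2 / 2))) ^ N * sqrt (2 * pi / (2 * u))) / e
          * (exp (- E q q' / (4 * u)) * exp (- (r q - r q')\<^sup>2 / (2 * (2 * u))))"
        by (rule gen)
      also have "exp (- E q q' / (4 * u)) * exp (- (r q - r q')\<^sup>2 / (2 * (2 * u))) = exp (- (E q q' + (r q - r q')\<^sup>2) / (4 * u))"
        unfolding exp_add[symmetric] using u by (simp add: add_divide_distrib diff_divide_distrib)
      also have "(1 / sqrt (2*pi*u)) * (1 / sqrt (2*pi*u)) * (sqrt (2 * pi * u) * exp (R\<^sup>2 / 2)) = (exp (R\<^sup>2 / 2) / sqrt (2 * pi)) * (1 / sqrt u)"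
        using u by (simp add: real_sqrt_mult)
      also have "(exp (R\<^sup>2 / 2) / sqrt (2 * pi) * (1 / sqrt u)) ^ N * sqrt (2 * pi / (2 * u)) = (exp (R\<^sup>2 / 2) / sqrt (2 * pi)) ^ N * sqrt pi * ((1 / sqrt u) ^ N * (1 / sqrt u))"
        using u by (simp add: power_mult_distrib power_divide real_sqrt_divide)
      \<comment> \<open>The \<open>N\<close> factors come from normalizing the Gaussians in the
        coordinates, the last one from integrating over \<open>\<theta>\<close>.\<close>
      also have "(1 / sqrt u) ^ N * (1 / sqrt u) = u powr (- (real N + 1) / 2)"
      proof -
        have e: "1 / sqrt u = u powr (- (1/2))" using u by (simp only: powr_minus powr_half_sqrt less_imp_le inverse_eq_divide)
        have "(1 / sqrt u) ^ N * (1 / sqrt u) = (u powr (- (1/2))) ^ Suc N"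
          unfolding e by (simp only: power_Suc mult.commute)
        also have "\<dots> = u powr (real (Suc N) * - (1/2))"
          using u by (intro powr_power) simp
        also have "real (Suc N) * - (1/2) = - (real N + 1) / 2" by (simp add: field_simps)
        finally show ?thesis .
      qed
      finally show "(1 / sqrt (2*pi*u)) ^ N * (1 / sqrt (2*pi*u)) ^ N / e * H q q' * (sqrt (2 * pi / (2 * u)) * exp (- (r q - r q')\<^sup>2 / (2 * (2 * u))))
        \<le> (exp (R\<^sup>2 / 2) / sqrt (2 * pi)) ^ N * sqrt pi * (u powr (- (real N + 1) / 2)) / e * exp (- (E q q' + (r q - r q')\<^sup>2) / (4 * u))" .
    qed
    also have "\<dots> = b / e"
      by (simp add: b_def ST_def sum_distrib_left sum_divide_distrib mult_ac)
    finally show ?thesis by (simp add: \<Phi>_def sum_distrib_left)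
  qed
  have "\<Phi>\<^sup>2 \<le> a * b"
  proof (rule optimize_eps)
    show "a > 0" using C SP0 by (simp add: a_def)
    show "b > 0" using u ST0 by (simp add: b_def)
    show "2 * \<bar>\<Phi>\<bar> \<le> e * a + b / e" if "e > 0" for e
      using main[OF that, of 1] main[OF that, of "-1"] by (auto simp: abs_if)
  qed
  also have "a * b = gauss_const N k R * SP * (u powr (- (real N + 1) / 2) * ST)"
    by (simp only: a_def b_def gauss_const_def C_def mult_ac)
  finally show ?thesis
    by (simp only: \<Phi>_def SP_def ST_def s_def D_def E_def m_def N_def)
qed

section \<open>Estimates for averaged kernels\<close>

lemma exp_taylor_bound: "\<bar>exp y - 1 - y\<bar> \<le> y\<^sup>2 * exp \<bar>y\<bar>" for y :: real
proof -
  have "1 - y \<le> exp (- y)" using exp_ge_add_one_self[of "- y"] by simp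
  hence "exp y * (1 - y) \<le> exp y * exp (- y)" by (intro mult_left_mono) auto
  hence 1: "exp y - 1 \<le> y * exp y" by (simp add: algebra_simps flip: exp_add)
  have 2: "y \<le> exp y - 1" using exp_ge_add_one_self[of y] by linarith
  have "exp y - 1 - y \<le> y * (exp y - 1)" using 1 by (simp add: algebra_simps)
  also have "\<dots> \<le> y\<^sup>2 * exp \<bar>y\<bar>"
  proof (cases "y \<ge> 0")
    case True
    hence "y * (exp y - 1) \<le> y * (y * exp y)" using 1 by (intro mult_left_mono) auto
    thus ?thesis using True by (simp add: power2_eq_square)
  next
    case False
    hence "y * (exp y - 1) \<le> y * y" using 2 by (intro mult_left_mono_neg) auto
    also have "\<dots> \<le> y\<^sup>2 * exp \<bar>y\<bar>" by (simp add: power2_eq_square mult_le_cancel_left1)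
    finally show ?thesis .
  qed
  finally show ?thesis using 2 by simp
qed

lemma gauss_osc_bound:
  fixes v s :: real
  assumes "v > 0"
  shows "\<bar>gauss_osc k v s\<bar> \<le> gauss_osc k v 0"
proof -
  have "\<bar>gauss_osc k v s\<bar> \<le> (LINT \<theta>|lborel. \<bar>cos (s * \<theta>) * (\<theta> ^ (2*k) * exp (- v * \<theta>\<^sup>2 / 2))\<bar>)"
    unfolding gauss_osc_def by (rule integral_abs_bound)
  also have "\<dots> \<le> (LINT \<theta>|lborel. cos (0 * \<theta>) * (\<theta> ^ (2*k) * exp (- v * \<theta>\<^sup>2 / 2)))"
  proof (rule integral_mono)
    show "integrable lborel (\<lambda>\<theta>. \<bar>cos (s * \<theta>) * (\<theta> ^ (2*k) * exp (- v * \<theta>\<^sup>2 / 2))\<bar>)"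
      by (intro integrable_abs integrable_gauss_osc assms)
    show "\<bar>cos (s * \<theta>) * (\<theta> ^ (2*k) * exp (- v * \<theta>\<^sup>2 / 2))\<bar> \<le> cos (0 * \<theta>) * (\<theta> ^ (2*k) * exp (- v * \<theta>\<^sup>2 / 2))" for \<theta>
      by (auto simp: abs_mult intro!: mult_left_le_one_le)
  qed (intro integrable_gauss_osc assms)
  finally show ?thesis by (simp add: gauss_osc_def)
qed

lemma gauss_osc_0:
  fixes v s :: real
  assumes "v > 0"
  shows "gauss_osc 0 v s = sqrt (2 * pi / v) * exp (- s\<^sup>2 / (2 * v))"
  unfolding gauss_osc_def mult_0_right power_0 mult_1
  by (rule has_bochner_integral_integral_eq[OF has_integral_gaussian_cos[OF assms]])

text \<open>Differentiation under the integral with an explicit remainder. The second-order Taylor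
  error of \<open>exp (- h * \<theta>\<^sup>2 / 2)\<close> carries four more powers of
  \<open>\<theta>\<close>, whence the index \<open>k + 2\<close>, and
  \<open>\<bar>h\<bar> \<le> v / 2\<close> leaves half of the Gaussian exponent to absorb its
  exponential factor.\<close>

lemma gauss_osc_second_order:
  fixes v s h :: real
  assumes v: "v > 0" and h: "\<bar>h\<bar> \<le> v / 2"
  shows "\<bar>gauss_osc k (v + h) s - gauss_osc k v s - h * (- gauss_osc (Suc k) v s / 2)\<bar>
    \<le> h\<^sup>2 * (gauss_osc (k + 2) (v / 2) 0 / 4)"
proof -
  let ?f = "\<lambda>k v \<theta>. cos (s * \<theta>) * (\<theta> ^ (2*k) * exp (- v * \<theta>\<^sup>2 / 2))"
  let ?g = "\<lambda>\<theta>. ?f k (v + h) \<theta> - ?f k v \<theta> + h / 2 * ?f (Suc k) v \<theta>"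
  let ?bd = "\<lambda>\<theta>. cos (0 * \<theta>) * (\<theta> ^ (2 * (k + 2)) * exp (- (v / 2) * \<theta>\<^sup>2 / 2))"
  have vh: "v + h > 0" using v h by linarith
  have f: "has_bochner_integral lborel (?f k w) (gauss_osc k w s)" if "w > 0" for k w
    unfolding has_bochner_integral_iff gauss_osc_def using that by (intro conjI integrable_gauss_osc refl)
  have g: "has_bochner_integral lborel ?g (gauss_osc k (v + h) s - gauss_osc k v s + h / 2 * gauss_osc (Suc k) v s)"
    by (intro has_bochner_integral_add has_bochner_integral_diff has_bochner_integral_mult_right f v vh)
  hence i: "integrable lborel ?g" by (simp only: has_bochner_integral_iff)
  have pw: "\<bar>?g \<theta>\<bar> \<le> h\<^sup>2 / 4 * ?bd \<theta>" for \<theta> :: real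
  proof -
    define y where "y = - h * \<theta>\<^sup>2 / 2"
    have e: "exp (- (v + h) * \<theta>\<^sup>2 / 2) = exp (- v * \<theta>\<^sup>2 / 2) * exp y"
      unfolding exp_add[symmetric] y_def by (simp add: field_simps)
    have g: "?g \<theta> = cos (s * \<theta>) * (\<theta> ^ (2*k) * exp (- v * \<theta>\<^sup>2 / 2) * (exp y - 1 - y))"
    proof -
      have p: "\<theta> ^ (2 * Suc k) = \<theta> ^ (2*k) * \<theta>\<^sup>2" by (simp flip: power_add)
      have alg: "c * (A * (E * Y)) - c * (A * E) + h / 2 * (c * (A * t * E)) = c * (A * E * (Y - 1 - (- h * t / 2)))"
        for c A E Y t :: real by (simp add: algebra_simps)
      show ?thesis unfolding e p y_def by (rule alg)
    qed
    have "\<bar>?g \<theta>\<bar> = \<bar>cos (s * \<theta>)\<bar> * (\<theta> ^ (2*k) * exp (- v * \<theta>\<^sup>2 / 2) * \<bar>exp y - 1 - y\<bar>)"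
      unfolding g by (simp add: abs_mult)
    also have "\<dots> \<le> 1 * (\<theta> ^ (2*k) * exp (- v * \<theta>\<^sup>2 / 2) * (y\<^sup>2 * exp \<bar>y\<bar>))"
      by (intro mult_mono mult_left_mono exp_taylor_bound) auto
    also have "\<dots> = y\<^sup>2 * \<theta> ^ (2*k) * exp (\<bar>y\<bar> - v * \<theta>\<^sup>2 / 2)"
    proof -
      have "exp (\<bar>y\<bar> - v * \<theta>\<^sup>2 / 2) = exp (- v * \<theta>\<^sup>2 / 2) * exp \<bar>y\<bar>"
        by (simp flip: exp_add)
      thus ?thesis by (simp only: mult_ac mult_1)
    qed
    also have "\<dots> \<le> y\<^sup>2 * \<theta> ^ (2*k) * exp (- (v / 2) * \<theta>\<^sup>2 / 2)"
    proof -
      have "\<bar>h\<bar> * \<theta>\<^sup>2 \<le> v / 2 * \<theta>\<^sup>2" using h by (intro mult_right_mono) auto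
      thus ?thesis by (intro mult_left_mono) (auto simp: y_def abs_mult)
    qed
    also have "y\<^sup>2 * \<theta> ^ (2*k) = h\<^sup>2 / 4 * \<theta> ^ (2 * (k + 2))"
      by (simp add: y_def power_mult power_add power_mult_distrib power_divide power4_eq_xxxx power2_eq_square mult_ac)
    finally show ?thesis by simp
  qed
  have i0: "integrable lborel ?bd" using v by (intro integrable_gauss_osc) simp
  have "\<bar>LINT \<theta>|lborel. ?g \<theta>\<bar> \<le> (LINT \<theta>|lborel. \<bar>?g \<theta>\<bar>)" by (rule integral_abs_bound)
  moreover have "(LINT \<theta>|lborel. \<bar>?g \<theta>\<bar>) \<le> (LINT \<theta>|lborel. h\<^sup>2 / 4 * ?bd \<theta>)"
    by (rule integral_mono[OF integrable_abs[OF i] integrable_mult_right[OF i0] pw])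
  moreover have "(LINT \<theta>|lborel. h\<^sup>2 / 4 * ?bd \<theta>) = h\<^sup>2 * (gauss_osc (k + 2) (v / 2) 0 / 4)"
    unfolding gauss_osc_def integral_mult_right_zero by simp
  ultimately have "\<bar>LINT \<theta>|lborel. ?g \<theta>\<bar> \<le> h\<^sup>2 * (gauss_osc (k + 2) (v / 2) 0 / 4)"
    by linarith
  thus ?thesis unfolding has_bochner_integral_integral_eq[OF g] by simp
qed

lemma has_real_derivative_of_quadratic_bound:
  fixes f :: "real \<Rightarrow> real"
  assumes "r > 0" "\<And>h. \<bar>h\<bar> \<le> r \<Longrightarrow> \<bar>f (x + h) - f x - h * D\<bar> \<le> h\<^sup>2 * M"
  shows "(f has_real_derivative D) (at x)"
  unfolding DERIV_def
proof (rule LIM_zero_cancel, rule Lim_null_comparison)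
  have "\<forall>\<^sub>F h in at 0. \<bar>h\<bar> \<le> r \<and> h \<noteq> 0"
    using assms(1) by (auto simp: eventually_at dist_real_def intro!: exI[of _ r])
  thus "\<forall>\<^sub>F h in at 0. norm ((f (x + h) - f x) / h - D) \<le> \<bar>h\<bar> * M"
  proof eventually_elim
    case (elim h)
    have "norm ((f (x + h) - f x) / h - D) = \<bar>f (x + h) - f x - h * D\<bar> / \<bar>h\<bar>"
      using elim by (simp add: field_simps flip: abs_divide)
    also have "\<dots> \<le> h\<^sup>2 * M / \<bar>h\<bar>" using assms(2)[of h] elim by (intro divide_right_mono) auto
    also have "\<dots> = \<bar>h\<bar> * M" using elim by (simp add: power2_eq_square abs_if)
    finally show ?case .
  qed
  show "((\<lambda>h. \<bar>h\<bar> * M) \<longlongrightarrow> 0) (at 0)" by (auto intro!: tendsto_eq_intros)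
qed

lemma gauss_osc_derivative:
  fixes v s :: real
  assumes "v > 0"
  shows "((\<lambda>v. gauss_osc k v s) has_real_derivative - gauss_osc (Suc k) v s / 2) (at v)"
  using gauss_osc_second_order[OF assms] assms
  by (intro has_real_derivative_of_quadratic_bound[where r="v/2" and M="gauss_osc (k + 2) (v / 2) 0 / 4"]) auto

text \<open>With \<open>g x = B * x powr \<beta> / \<beta>\<close>, both \<open>g + f\<close> and
  \<open>g - f\<close> are nondecreasing, whatever the sign of \<open>\<beta>\<close>. Negative
  exponents occur when bounds for derivatives are integrated down, positive ones for the final
  Hoelder estimate.\<close>

lemma powr_derivative_difference_bound:
  fixes f :: "real \<Rightarrow> real"
  assumes ab: "0 < a" "a \<le> b" and b: "\<beta> \<noteq> 0"
    and f: "\<And>x. a \<le> x \<Longrightarrow> x \<le> b \<Longrightarrow> (f has_real_derivative f' x) (at x)"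
    and bd: "\<And>x. a \<le> x \<Longrightarrow> x \<le> b \<Longrightarrow> \<bar>f' x\<bar> \<le> B * x powr (\<beta> - 1)"
  shows "\<bar>f b - f a\<bar> \<le> B * (b powr \<beta> - a powr \<beta>) / \<beta>"
proof -
  let ?g = "\<lambda>x. B * x powr \<beta> / \<beta>"
  have g: "(?g has_real_derivative B * x powr (\<beta> - 1)) (at x)" if "a \<le> x" for x
    using that ab b by (auto intro!: derivative_eq_intros)
  have "?g a + f a \<le> ?g b + f b"
  proof (rule DERIV_nonneg_imp_nondecreasing[OF ab(2)])
    fix x assume x: "a \<le> x" "x \<le> b"
    show "\<exists>y. ((\<lambda>x. ?g x + f x) has_real_derivative y) (at x) \<and> 0 \<le> y"
      by (intro exI conjI, rule DERIV_add[OF g[OF x(1)] f[OF x]]) (use bd[OF x] in linarith)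
  qed
  moreover have "?g a - f a \<le> ?g b - f b"
  proof (rule DERIV_nonneg_imp_nondecreasing[OF ab(2)])
    fix x assume x: "a \<le> x" "x \<le> b"
    show "\<exists>y. ((\<lambda>x. ?g x - f x) has_real_derivative y) (at x) \<and> 0 \<le> y"
      by (intro exI conjI, rule DERIV_diff[OF g[OF x(1)] f[OF x]]) (use bd[OF x] in linarith)
  qed
  ultimately show ?thesis by (simp add: algebra_simps diff_divide_distrib)
qed

text \<open>Integrating from \<open>u\<close> to 1 lowers the order by one and improves the power of
  \<open>u\<close> by one, as long as the resulting exponent is negative;
  \<open>\<alpha> < 1\<close> allows this down to order 1. The quantifier order records that
  \<open>K\<close> is independent of the functions, of \<open>C\<close> and of
  \<open>u0\<close>.\<close>

lemma derivative_chain_bound: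
  fixes \<alpha> c :: real
  assumes "\<alpha> < 1"
  shows "\<exists>K>0. \<forall>\<phi> C u0. 0 < u0 \<and> u0 \<le> 1 \<and> 0 \<le> C \<and>
     (\<forall>j u. u > 0 \<longrightarrow> (\<phi> j has_real_derivative c * \<phi> (Suc j) u) (at u)) \<and>
     (\<forall>u\<in>{u0..1}. \<bar>\<phi> (Suc k) u\<bar> \<le> C * u powr (\<alpha> - real (Suc k))) \<and> (\<forall>j\<le>k. \<bar>\<phi> j 1\<bar> \<le> C) \<longrightarrow>
     (\<forall>u\<in>{u0..1}. \<bar>\<phi> 1 u\<bar> \<le> K * C * u powr (\<alpha> - 1))"
proof (induction k)
  case 0
  show ?case by (intro exI[of _ 1]) auto
next
  case (Suc k)
  then obtain K where K: "K > 0" and IH: "\<forall>\<phi> C u0. 0 < u0 \<and> u0 \<le> 1 \<and> 0 \<le> C \<and>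
     (\<forall>j u. u > 0 \<longrightarrow> (\<phi> j has_real_derivative c * \<phi> (Suc j) u) (at u)) \<and>
     (\<forall>u\<in>{u0..1}. \<bar>\<phi> (Suc k) u\<bar> \<le> C * u powr (\<alpha> - real (Suc k))) \<and> (\<forall>j\<le>k. \<bar>\<phi> j 1\<bar> \<le> C) \<longrightarrow>
     (\<forall>u\<in>{u0..1}. \<bar>\<phi> 1 u\<bar> \<le> K * C * u powr (\<alpha> - 1))"
    by (elim exE conjE)
  \<comment> \<open>The 1 pays for the value at \<open>u = 1\<close>, the fraction for the integral
    over \<open>{u..1}\<close>.\<close>
  define M where "M = 1 + \<bar>c\<bar> / (real (Suc k) - \<alpha>)"
  have gap: "real (Suc k) - \<alpha> > 0" using assms by simp
  hence M: "M \<ge> 1" by (simp add: M_def)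
  show ?case
  proof (intro exI[of _ "K * M"] conjI allI impI)
    show "K * M > 0" using K M by simp
    fix \<phi> :: "nat \<Rightarrow> real \<Rightarrow> real" and C u0 :: real
    assume H: "0 < u0 \<and> u0 \<le> 1 \<and> 0 \<le> C \<and>
     (\<forall>j u. u > 0 \<longrightarrow> (\<phi> j has_real_derivative c * \<phi> (Suc j) u) (at u)) \<and>
     (\<forall>u\<in>{u0..1}. \<bar>\<phi> (Suc (Suc k)) u\<bar> \<le> C * u powr (\<alpha> - real (Suc (Suc k)))) \<and> (\<forall>j\<le>Suc k. \<bar>\<phi> j 1\<bar> \<le> C)"
    have CM: "C \<le> M * C" using M H by (simp add: mult_le_cancel_right1)
    have step: "\<bar>\<phi> (Suc k) u\<bar> \<le> (M * C) * u powr (\<alpha> - real (Suc k))" if u: "u \<in> {u0..1}" for u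
    proof -
      define \<beta> where "\<beta> = \<alpha> - real (Suc k)"
      have \<beta>: "\<beta> < 0" using gap by (simp add: \<beta>_def)
      have u': "0 < u" "u \<le> 1" using u H by auto
      have "\<bar>\<phi> (Suc k) 1 - \<phi> (Suc k) u\<bar> \<le> \<bar>c\<bar> * C * (1 powr \<beta> - u powr \<beta>) / \<beta>"
      proof (rule powr_derivative_difference_bound)
        fix x assume x: "u \<le> x" "x \<le> 1"
        show "(\<phi> (Suc k) has_real_derivative c * \<phi> (Suc (Suc k)) x) (at x)" using H x u' by auto
        have "\<bar>\<phi> (Suc (Suc k)) x\<bar> \<le> C * x powr (\<alpha> - real (Suc (Suc k)))" using H x u by auto
        also have "\<alpha> - real (Suc (Suc k)) = \<beta> - 1" by (simp add: \<beta>_def)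
        finally show "\<bar>c * \<phi> (Suc (Suc k)) x\<bar> \<le> \<bar>c\<bar> * C * x powr (\<beta> - 1)"
          unfolding abs_mult mult.assoc by (intro mult_left_mono) auto
      qed (use u' \<beta> in auto)
      also have "\<dots> = \<bar>c\<bar> * C * (u powr \<beta> - 1) / (real (Suc k) - \<alpha>)"
        unfolding \<beta>_def by (simp add: divide_simps) (simp add: algebra_simps)
      also have "\<dots> \<le> \<bar>c\<bar> * C * u powr \<beta> / (real (Suc k) - \<alpha>)"
        using gap H by (intro divide_right_mono mult_left_mono) auto
      finally have 1: "\<bar>\<phi> (Suc k) 1 - \<phi> (Suc k) u\<bar> \<le> \<bar>c\<bar> / (real (Suc k) - \<alpha>) * C * u powr \<beta>" by simp
      have "1 powr \<beta> \<le> u powr \<beta>" using u' \<beta> by (intro powr_mono2') auto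
      hence "C \<le> C * u powr \<beta>" using H by (simp add: mult_le_cancel_left1)
      moreover have "\<bar>\<phi> (Suc k) 1\<bar> \<le> C" using H by auto
      ultimately have "\<bar>\<phi> (Suc k) u\<bar> \<le> C * u powr \<beta> + \<bar>c\<bar> / (real (Suc k) - \<alpha>) * C * u powr \<beta>"
        using 1 by linarith
      thus ?thesis by (simp add: M_def \<beta>_def distrib_right)
    qed
    have "\<forall>u\<in>{u0..1}. \<bar>\<phi> 1 u\<bar> \<le> K * (M * C) * u powr (\<alpha> - 1)"
    proof (rule IH[THEN spec, THEN spec, THEN spec, THEN mp], intro conjI)
      show "\<forall>j\<le>k. \<bar>\<phi> j 1\<bar> \<le> M * C" using H CM by (meson le_SucI order_trans)
      show "0 \<le> M * C" using H CM by linarith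
    qed (use H step in blast)+
    thus "\<forall>u\<in>{u0..1}. \<bar>\<phi> 1 u\<bar> \<le> K * M * C * u powr (\<alpha> - 1)" by (simp add: mult.assoc)
  qed
qed

text \<open>For \<open>j = 0\<close> this is, up to the factor \<open>2 * pi\<close>, the density at
  0 of the values \<open>(\<Sum>i\<in>I. X p i * Y q i) - r q\<close>, smoothed with variance
  \<open>L * u\<close>. For general \<open>j\<close> it is the \<open>j\<close>-th derivative of
  that in \<open>u\<close>, up to \<open>(- L / 2) ^ j\<close>.\<close>

definition osc_avg :: "'i set \<Rightarrow> 'p set \<Rightarrow> 'q set \<Rightarrow> ('p \<Rightarrow> 'i \<Rightarrow> real) \<Rightarrow> ('q \<Rightarrow> 'i \<Rightarrow> real) \<Rightarrow> ('q \<Rightarrow> real)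
    \<Rightarrow> real \<Rightarrow> nat \<Rightarrow> real \<Rightarrow> real" where
  "osc_avg I P T X Y r L j u =
     (\<Sum>p\<in>P. \<Sum>q\<in>T. gauss_osc j (L * u) ((\<Sum>i\<in>I. X p i * Y q i) - r q)) / (real (card P) * real (card T))"

text \<open>\<open>\<kappa>\<close> is the decay rate of the Gaussian energy of the data
  \<open>(Y q, r q)\<close>: it will be \<open>s' / 2\<close> for constant \<open>r\<close> and
  \<open>(s' + 1) / 2\<close> for dilated data. Everything is required only at scales from
  \<open>u0\<close> on, so finite sets qualify.\<close>

definition admissible :: "'i set \<Rightarrow> 'p set \<Rightarrow> 'q set \<Rightarrow> ('p \<Rightarrow> 'i \<Rightarrow> real) \<Rightarrow> ('q \<Rightarrow> 'i \<Rightarrow> real) \<Rightarrow> ('q \<Rightarrow> real)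
    \<Rightarrow> real \<Rightarrow> real \<Rightarrow> real \<Rightarrow> real \<Rightarrow> real \<Rightarrow> real \<Rightarrow> real \<Rightarrow> bool" where
  "admissible I P T X Y r L R s C1 \<kappa> C2 u0 \<longleftrightarrow>
     finite P \<and> P \<noteq> {} \<and> finite T \<and> T \<noteq> {} \<and> 0 < u0 \<and> u0 \<le> 1 \<and>
     (\<forall>p\<in>P. 2 + (\<Sum>i\<in>I. (X p i)\<^sup>2) \<le> L) \<and> (\<forall>q\<in>T. \<forall>i\<in>I. \<bar>Y q i\<bar> \<le> R) \<and>
     (\<forall>u\<in>{u0..1}. riesz_energy I X s u P \<le> C1 * (real (card P))\<^sup>2) \<and>
     (\<forall>u\<in>{u0..1}. gauss_energy I Y r u T
        \<le> C2 * u powr \<kappa> * (real (card T))\<^sup>2)"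

lemma osc_avg_derivative:
  assumes "L > 0" "u > 0"
  shows "(osc_avg I P T X Y r L j has_real_derivative (- L / 2) * osc_avg I P T X Y r L (Suc j) u) (at u)"
proof -
  have "((\<lambda>u. gauss_osc j (L * u) s) has_real_derivative (- gauss_osc (Suc j) (L * u) s / 2) * L) (at u)" for s
    by (rule DERIV_chain2[OF gauss_osc_derivative])
       (use assms in \<open>auto intro!: derivative_eq_intros\<close>)
  hence "((\<lambda>u. (\<Sum>p\<in>P. \<Sum>q\<in>T. gauss_osc j (L * u) ((\<Sum>i\<in>I. X p i * Y q i) - r q)) / (real (card P) * real (card T)))
     has_real_derivative (\<Sum>p\<in>P. \<Sum>q\<in>T. (- gauss_osc (Suc j) (L * u) ((\<Sum>i\<in>I. X p i * Y q i) - r q) / 2) * L) / (real (card P) * real (card T))) (at u)"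
    by (intro DERIV_cdivide DERIV_sum)
  also have "(\<Sum>p\<in>P. \<Sum>q\<in>T. (- gauss_osc (Suc j) (L * u) ((\<Sum>i\<in>I. X p i * Y q i) - r q) / 2) * L) / (real (card P) * real (card T))
    = (- L / 2) * osc_avg I P T X Y r L (Suc j) u"
    by (simp add: osc_avg_def sum_distrib_left sum_negf mult_ac)
  finally show ?thesis unfolding osc_avg_def[abs_def] .
qed

lemma osc_avg_bound_at_1:
  assumes "L > 0"
  shows "\<bar>osc_avg I P T X Y r L j 1\<bar> \<le> gauss_osc j L 0"
proof -
  have g0: "0 \<le> gauss_osc j L 0" using gauss_osc_bound[OF assms, of j 0] by linarith
  have "\<bar>\<Sum>p\<in>P. \<Sum>q\<in>T. gauss_osc j (L * 1) ((\<Sum>i\<in>I. X p i * Y q i) - r q)\<bar>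
     \<le> (\<Sum>p\<in>P. \<Sum>q\<in>T. \<bar>gauss_osc j (L * 1) ((\<Sum>i\<in>I. X p i * Y q i) - r q)\<bar>)"
    by (rule order_trans[OF sum_abs]) (intro sum_mono sum_abs)
  also have "\<dots> \<le> (\<Sum>p\<in>P. \<Sum>q\<in>T. gauss_osc j L 0)"
    using gauss_osc_bound[OF assms] by (intro sum_mono) simp
  also have "\<dots> = gauss_osc j L 0 * (real (card P) * real (card T))" by simp
  finally have *: "\<bar>\<Sum>p\<in>P. \<Sum>q\<in>T. gauss_osc j (L * 1) ((\<Sum>i\<in>I. X p i * Y q i) - r q)\<bar> \<le> gauss_osc j L 0 * (real (card P) * real (card T))" .
  show ?thesis
  proof (cases "real (card P) * real (card T) = 0")
    case True
    show ?thesis unfolding osc_avg_def True div_by_0 abs_zero by (rule g0)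
  next
    case False
    hence "real (card P) * real (card T) > 0" by (intro le_neq_trans) auto
    thus ?thesis using * unfolding osc_avg_def abs_divide by (simp add: pos_divide_le_eq)
  qed
qed

text \<open>Half of the total exponent
  \<open>(s / 2 - 2 * k - 1/2) - (card I + 1) / 2 + \<kappa>\<close> from the bilinear inequality.
  The condition \<open>s \<le> 4 * k + 1\<close> decides how many derivatives are needed before the
  full energy exponent \<open>s\<close> can be used.\<close>

lemma osc_avg_bound:
  assumes A: "admissible I P T X Y r L R s C1 \<kappa> C2 u0" and I: "finite I" and u: "u \<in> {u0..1}" and s: "s \<le> 4 * real k + 1"
    and C: "0 \<le> C1" "0 \<le> C2"
  shows "\<bar>osc_avg I P T X Y r L k u\<bar> \<le> sqrt (gauss_const (card I) k R * C1 * C2) * u powr ((s - real (card I) - 2 + 2 * \<kappa>) / 4 - real k)"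
proof -
  define G where "G = gauss_const (card I) k R"
  define n where "n = real (card P) * real (card T)"
  define S where "S = (\<Sum>p\<in>P. \<Sum>q\<in>T. gauss_osc k (L * u) ((\<Sum>i\<in>I. X p i * Y q i) - r q))"
  define \<gamma> where "\<gamma> = (s - real (card I) - 2 + 2 * \<kappa>) / 4 - real k"
  note A' = A[unfolded admissible_def]
  have u0: "0 < u" "u \<le> 1" using u A' by auto
  have n: "n > 0" using A' by (auto simp: n_def card_gt_0_iff)
  have e1: "(\<Sum>p\<in>P. \<Sum>p'\<in>P. (u + (\<Sum>i\<in>I. (X p i - X p' i)\<^sup>2)) powr (- 2 * real k - 1/2))
     \<le> u powr (s / 2 - 2 * real k - 1/2) * (C1 * (real (card P))\<^sup>2)"
  proof -
    have "(\<Sum>p\<in>P. \<Sum>p'\<in>P. (u + (\<Sum>i\<in>I. (X p i - X p' i)\<^sup>2)) powr (- 2 * real k - 1/2))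
      \<le> (\<Sum>p\<in>P. \<Sum>p'\<in>P. u powr (s / 2 - 2 * real k - 1/2) * (u + (\<Sum>i\<in>I. (X p i - X p' i)\<^sup>2)) powr (- s / 2))"
    proof (intro sum_mono)
      fix p p'
      define D where "D = (\<Sum>i\<in>I. (X p i - X p' i)\<^sup>2)"
      have D: "D \<ge> 0" by (auto simp: D_def intro: sum_nonneg)
      have "(u + D) powr (- 2 * real k - 1/2) = (u + D) powr (s / 2 - 2 * real k - 1/2) * (u + D) powr (- s / 2)"
        by (simp flip: powr_add)
      \<comment> \<open>This exponent is nonpositive by \<open>s \<le> 4 * k + 1\<close>, so
        omitting \<open>D\<close> only enlarges the power.\<close>
      also have "\<dots> \<le> u powr (s / 2 - 2 * real k - 1/2) * (u + D) powr (- s / 2)"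
        using D u0 s by (intro mult_right_mono powr_mono2') auto
      finally show "(u + D) powr (- 2 * real k - 1/2) \<le> u powr (s / 2 - 2 * real k - 1/2) * (u + D) powr (- s / 2)" .
    qed
    also have "\<dots> = u powr (s / 2 - 2 * real k - 1/2) * riesz_energy I X s u P"
      by (simp add: sum_distrib_left)
    also have "\<dots> \<le> u powr (s / 2 - 2 * real k - 1/2) * (C1 * (real (card P))\<^sup>2)"
      using A' u by (intro mult_left_mono) auto
    finally show ?thesis .
  qed
  have e2: "gauss_energy I Y r u T
        \<le> C2 * u powr \<kappa> * (real (card T))\<^sup>2" using A' u by blast
  have "S\<^sup>2 \<le> G * (\<Sum>p\<in>P. \<Sum>p'\<in>P. (u + (\<Sum>i\<in>I. (X p i - X p' i)\<^sup>2)) powr (- 2 * real k - 1/2))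
      * (u powr (- (real (card I) + 1) / 2) *
         gauss_energy I Y r u T)"
    unfolding S_def G_def using A' u0 I by (intro bilinear_gauss_osc) auto
  also have "\<dots> \<le> G * (u powr (s / 2 - 2 * real k - 1/2) * (C1 * (real (card P))\<^sup>2))
      * (u powr (- (real (card I) + 1) / 2) * (C2 * u powr \<kappa> * (real (card T))\<^sup>2))"
    using e1 e2 C gauss_const_pos[of "card I" k R]
    by (intro mult_mono mult_left_mono mult_nonneg_nonneg sum_nonneg) (auto simp: G_def less_imp_le)
  also have "\<dots> = (sqrt (G * C1 * C2) * u powr \<gamma> * n)\<^sup>2"
  proof -
    have "u powr (s / 2 - 2 * real k - 1/2) * u powr (- (real (card I) + 1) / 2) * u powr \<kappa> = (u powr \<gamma>)\<^sup>2"
      unfolding power2_eq_square powr_add[symmetric]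
      by (rule arg_cong[where f="\<lambda>x. u powr x"]) (simp add: \<gamma>_def field_simps)
    moreover have "(sqrt (G * C1 * C2))\<^sup>2 = G * C1 * C2"
      using C gauss_const_pos[of "card I" k R] by (simp add: G_def)
    moreover have "G * (a * (C1 * p)) * (b * (C2 * c * t)) = (G * C1 * C2) * (a * b * c) * (p * t)" for a b c p t
      by (simp only: mult_ac)
    ultimately show ?thesis unfolding power_mult_distrib n_def by (simp only:)
  qed
  finally have "\<bar>S\<bar> \<le> \<bar>sqrt (G * C1 * C2) * u powr \<gamma> * n\<bar>" by (simp only: abs_le_square_iff)
  also have "\<dots> = sqrt (G * C1 * C2) * u powr \<gamma> * n"
    using n C gauss_const_pos[of "card I" k R] by (simp add: G_def abs_mult)
  finally have "\<bar>S\<bar> / n \<le> sqrt (G * C1 * C2) * u powr \<gamma>" using n by (simp add: pos_divide_le_eq)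
  moreover have "osc_avg I P T X Y r L k u = S / n" by (simp add: osc_avg_def S_def n_def)
  ultimately show ?thesis using n by (simp add: G_def \<gamma>_def)
qed

text \<open>\<open>osc_avg_bound\<close> applies at the high order \<open>Suc k\<close> only; the
  chain lemma carries its conclusion down to order 1. The values at \<open>u = 1\<close> are bounded
  by absolute constants, so \<open>K\<close> is uniform in the point sets and in
  \<open>u0\<close>.\<close>

lemma osc_avg_first_derivative_bound:
  fixes I :: "'i set"
  assumes I: "finite I" and \<alpha>: "\<alpha> < 1" "\<alpha> \<le> (s - real (card I) - 2 + 2 * \<kappa>) / 4" and C: "0 \<le> C1" "0 \<le> C2" and L: "L > 0"
  shows "\<exists>K>0. \<forall>(P :: 'p set) (T :: 'q set) X Y r u0. admissible I P T X Y r L R s C1 \<kappa> C2 u0 \<longrightarrow>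
     (\<forall>u\<in>{u0..1}. \<bar>osc_avg I P T X Y r L 1 u\<bar> \<le> K * u powr (\<alpha> - 1))"
proof -
  obtain k where k: "s \<le> real k" using real_arch_simple by blast
  obtain K where K: "K > 0" and chain: "\<forall>\<phi> C u0. 0 < u0 \<and> u0 \<le> 1 \<and> 0 \<le> C \<and>
     (\<forall>j u. u > 0 \<longrightarrow> (\<phi> j has_real_derivative (- L / 2) * \<phi> (Suc j) u) (at u)) \<and>
     (\<forall>u\<in>{u0..1}. \<bar>\<phi> (Suc k) u\<bar> \<le> C * u powr (\<alpha> - real (Suc k))) \<and> (\<forall>j\<le>k. \<bar>\<phi> j 1\<bar> \<le> C) \<longrightarrow>
     (\<forall>u\<in>{u0..1}. \<bar>\<phi> 1 u\<bar> \<le> K * C * u powr (\<alpha> - 1))"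
    using derivative_chain_bound[OF \<alpha>(1), of "- L / 2" k] by (elim exE conjE)
  define C where "C = 1 + sqrt (gauss_const (card I) (Suc k) R * C1 * C2) + (\<Sum>j\<le>k. gauss_osc j L 0)"
  have g0: "0 \<le> gauss_osc j L 0" for j using gauss_osc_bound[OF L, of j 0] by linarith
  have q0: "0 \<le> sqrt (gauss_const (card I) (Suc k) R * C1 * C2)"
    using C gauss_const_pos[of "card I" "Suc k" R] by simp
  have sum0: "0 \<le> (\<Sum>j\<le>k. gauss_osc j L 0)" using g0 by (intro sum_nonneg)
  have C0: "C > 0" unfolding C_def using q0 sum0 by linarith
  show ?thesis
  proof (intro exI[of _ "K * C"] conjI allI impI)
    show "K * C > 0" using K C0 by simp
    fix P :: "'p set" and T :: "'q set" and X Y r u0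
    assume A: "admissible I P T X Y r L R s C1 \<kappa> C2 u0"
    show "\<forall>u\<in>{u0..1}. \<bar>osc_avg I P T X Y r L 1 u\<bar> \<le> K * C * u powr (\<alpha> - 1)"
    proof (rule chain[THEN spec, THEN spec, THEN spec, THEN mp], intro conjI allI impI ballI)
      show "0 < u0" "u0 \<le> 1" using A by (auto simp: admissible_def)
      show "0 \<le> C" using C0 by simp
      show "(osc_avg I P T X Y r L j has_real_derivative - L / 2 * osc_avg I P T X Y r L (Suc j) u) (at u)" if "u > 0" for j u
        using osc_avg_derivative[OF L that] .
      fix u assume u: "u \<in> {u0..1}"
      have u': "0 < u" "u \<le> 1" using u A by (auto simp: admissible_def)
      have "\<bar>osc_avg I P T X Y r L (Suc k) u\<bar> \<le> sqrt (gauss_const (card I) (Suc k) R * C1 * C2) * u powr ((s - real (card I) - 2 + 2 * \<kappa>) / 4 - real (Suc k))"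
        using k by (intro osc_avg_bound[OF A I u _ \<open>0 \<le> C1\<close> \<open>0 \<le> C2\<close>]) simp
      also have "\<dots> \<le> C * u powr (\<alpha> - real (Suc k))"
      proof (rule mult_mono)
        show "u powr ((s - real (card I) - 2 + 2 * \<kappa>) / 4 - real (Suc k)) \<le> u powr (\<alpha> - real (Suc k))"
          using u' \<alpha>(2) by (intro powr_mono') auto
        show "sqrt (gauss_const (card I) (Suc k) R * C1 * C2) \<le> C" using sum0 unfolding C_def by linarith
      qed (use C0 in auto)
      finally show "\<bar>osc_avg I P T X Y r L (Suc k) u\<bar> \<le> C * u powr (\<alpha> - real (Suc k))" .
    next
      fix j assume "j \<le> k"
      hence "gauss_osc j L 0 \<le> (\<Sum>j\<le>k. gauss_osc j L 0)" using g0 by (intro member_le_sum) auto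
      thus "\<bar>osc_avg I P T X Y r L j 1\<bar> \<le> C"
        using osc_avg_bound_at_1[OF L, of I P T X Y r j] q0 unfolding C_def by linarith
    qed
  qed
qed

text \<open>Used with both signs of \<open>\<alpha>\<close>: a negative one limits the growth of the
  smoothed density as \<open>u\<close> decreases, a positive one makes it nearly constant at small
  scales.\<close>

lemma osc_avg_increment:
  fixes I :: "'i set"
  assumes I: "finite I" and \<alpha>: "\<alpha> < 1" "\<alpha> \<le> (s - real (card I) - 2 + 2 * \<kappa>) / 4" "\<alpha> \<noteq> 0" and C: "0 \<le> C1" "0 \<le> C2" and L: "L > 0"
  shows "\<exists>K>0. \<forall>(P :: 'p set) (T :: 'q set) X Y r u0. admissible I P T X Y r L R s C1 \<kappa> C2 u0 \<longrightarrow>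
     (\<forall>a b. u0 \<le> a \<and> a \<le> b \<and> b \<le> 1 \<longrightarrow> \<bar>osc_avg I P T X Y r L 0 b - osc_avg I P T X Y r L 0 a\<bar> \<le> K * (b powr \<alpha> - a powr \<alpha>) / \<alpha>)"
proof -
  obtain K where K: "K > 0" and bd: "\<forall>(P :: 'p set) (T :: 'q set) X Y r u0. admissible I P T X Y r L R s C1 \<kappa> C2 u0 \<longrightarrow>
     (\<forall>u\<in>{u0..1}. \<bar>osc_avg I P T X Y r L 1 u\<bar> \<le> K * u powr (\<alpha> - 1))"
    using osc_avg_first_derivative_bound[OF I \<alpha>(1,2) C L, where R=R and ?'p='p and ?'q='q] by (elim exE conjE)
  show ?thesis
  proof (intro exI[of _ "L / 2 * K"] conjI allI impI)
    show "L / 2 * K > 0" using K L by simp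
    fix P :: "'p set" and T :: "'q set" and X Y r u0 a b
    assume A: "admissible I P T X Y r L R s C1 \<kappa> C2 u0" and ab: "u0 \<le> a \<and> a \<le> b \<and> b \<le> 1"
    have u0: "u0 > 0" using A by (auto simp: admissible_def)
    show "\<bar>osc_avg I P T X Y r L 0 b - osc_avg I P T X Y r L 0 a\<bar> \<le> L / 2 * K * (b powr \<alpha> - a powr \<alpha>) / \<alpha>"
    proof (rule powr_derivative_difference_bound)
      fix x assume x: "a \<le> x" "x \<le> b"
      show "(osc_avg I P T X Y r L 0 has_real_derivative - L / 2 * osc_avg I P T X Y r L (Suc 0) x) (at x)"
        using x ab u0 L by (intro osc_avg_derivative) auto
      have "\<bar>osc_avg I P T X Y r L 1 x\<bar> \<le> K * x powr (\<alpha> - 1)"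
        using bd A x ab by auto
      hence "L / 2 * \<bar>osc_avg I P T X Y r L 1 x\<bar> \<le> L / 2 * (K * x powr (\<alpha> - 1))"
        using L by (intro mult_left_mono) auto
      thus "\<bar>- L / 2 * osc_avg I P T X Y r L (Suc 0) x\<bar> \<le> L / 2 * K * x powr (\<alpha> - 1)"
        using L by (simp add: abs_mult)
    qed (use ab u0 \<alpha> in auto)
  qed
qed

abbreviation heat :: "real \<Rightarrow> real \<Rightarrow> real \<Rightarrow> real" where
  "heat L u y \<equiv> sqrt (2 * pi / (L * u)) * exp (- y\<^sup>2 / (2 * (L * u)))"

lemma osc_avg_0:
  assumes "L > 0" "u > 0"
  shows "osc_avg I P T X Y r L 0 u = (\<Sum>p\<in>P. \<Sum>q\<in>T. heat L u ((\<Sum>i\<in>I. X p i * Y q i) - r q)) / (real (card P) * real (card T))"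
  using assms by (simp add: osc_avg_def gauss_osc_0)

section \<open>Densities away from zero\<close>

text \<open>In terms of \<open>x = D / u\<close> the claim says that \<open>exp (c * x)\<close>
  dominates \<open>(1 + x) powr (s / 2)\<close> up to a constant.\<close>

lemma exp_neg_le_riesz:
  fixes c s :: real
  assumes "c > 0" "s \<ge> 0"
  shows "\<exists>M>0. \<forall>u D. u > 0 \<longrightarrow> D \<ge> 0 \<longrightarrow> exp (- (c * D / u)) \<le> M * (u powr (s / 2) * (u + D) powr (- s / 2))"
proof -
  obtain m :: nat where m: "s / 2 \<le> real m" using real_arch_simple by blast
  define k where "k = Suc m"
  \<comment> \<open>Chosen so that \<open>1 + x \<le> B * (1 + c * x / k)\<close>, whose
    \<open>k\<close>-th power is at most \<open>B ^ k * exp (c * x)\<close>.\<close>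
  define B where "B = max 1 (real k / c)"
  have B: "B \<ge> 1" "real k / c \<le> B" by (auto simp: B_def)
  have k0: "real k > 0" by (simp add: k_def)
  show ?thesis
  proof (intro exI[of _ "B ^ k"] conjI allI impI)
    show "B ^ k > 0" using B by simp
    fix u D :: real assume u: "u > 0" and D: "D \<ge> 0"
    define x where "x = D / u"
    have x: "x \<ge> 0" using u D by (simp add: x_def)
    have "x = (real k / c) * (c * x / k)" using assms k0 by simp
    also have "\<dots> \<le> B * (c * x / k)" using B assms x k0 by (intro mult_right_mono) auto
    finally have "1 + x \<le> B * (1 + c * x / k)" using B by (simp add: distrib_left)
    also have "\<dots> \<le> B * exp (c * x / k)" using B by (intro mult_left_mono) auto
    finally have "(1 + x) ^ k \<le> (B * exp (c * x / k)) ^ k" using x by (intro power_mono) auto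
    also have "\<dots> = B ^ k * exp (c * x)"
      using k0 by (simp add: power_mult_distrib flip: exp_of_nat_mult)
    finally have pk: "(1 + x) ^ k \<le> B ^ k * exp (c * x)" .
    have "(1 + x) powr (s / 2) \<le> (1 + x) powr real k"
      using x m by (intro powr_mono) (auto simp: k_def)
    also have "\<dots> = (1 + x) ^ k" using x by (simp add: powr_realpow)
    finally have 1: "(1 + x) powr (s / 2) \<le> B ^ k * exp (c * x)" using pk by linarith
    have "exp (- (c * x)) = (1 + x) powr (s / 2) * ((1 + x) powr (- s / 2) * exp (- (c * x)))"
      using x by (simp flip: powr_add mult.assoc)
    also have "\<dots> \<le> B ^ k * exp (c * x) * ((1 + x) powr (- s / 2) * exp (- (c * x)))"
      using 1 by (intro mult_right_mono) auto
    also have "\<dots> = B ^ k * (1 + x) powr (- s / 2) * (exp (c * x) * exp (- (c * x)))"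
      by (simp only: mult_ac)
    also have "\<dots> = B ^ k * (1 + x) powr (- s / 2)" by (simp flip: exp_add)
    finally have "exp (- (c * x)) \<le> B ^ k * (1 + x) powr (- s / 2)" .
    also have "(1 + x) powr (- s / 2) = u powr (s / 2) * (u + D) powr (- s / 2)"
    proof -
      have "u + D = u * (1 + x)" using u by (simp add: x_def field_simps)
      hence "(u + D) powr (- s / 2) = u powr (- s / 2) * (1 + x) powr (- s / 2)"
        by (simp only: powr_mult)
      moreover have "u powr (s / 2) * u powr (- s / 2) = 1" using u by (simp flip: powr_add)
      ultimately show ?thesis by simp
    qed
    finally show "exp (- (c * D / u)) \<le> B ^ k * (u powr (s / 2) * (u + D) powr (- s / 2))"
      by (simp add: x_def)
  qed
qed

text \<open>Nonnegativity of \<open>(x * m - 1/2)\<^sup>2\<close> with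
  \<open>x = sqrt \<beta>\<close> replaces the Gaussian terms by the geometric series in
  \<open>exp (- x)\<close>, losing only the factor \<open>exp (1/4)\<close>.\<close>

lemma gaussian_sum_half:
  fixes \<beta> :: real
  assumes "\<beta> > 0"
  shows "(\<Sum>m<n. exp (- \<beta> * (real m)\<^sup>2)) \<le> exp (1/4) * (1 + 1 / sqrt \<beta>)"
proof -
  define x where "x = sqrt \<beta>"
  have x: "x > 0" "x\<^sup>2 = \<beta>" using assms by (auto simp: x_def)
  define q where "q = exp (- x)"
  have q: "0 < q" "q < 1" using x by (auto simp: q_def)
  have "(\<Sum>m<n. exp (- \<beta> * (real m)\<^sup>2)) \<le> (\<Sum>m<n. exp (1/4) * q ^ m)"
  proof (rule sum_mono)
    fix m
    have "(x * real m - 1/2)\<^sup>2 = x\<^sup>2 * (real m)\<^sup>2 - x * real m + 1/4"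
      by (simp add: power2_eq_square algebra_simps)
    hence "- \<beta> * (real m)\<^sup>2 \<le> 1/4 + real m * (- x)"
      using zero_le_power2[of "x * real m - 1/2"] unfolding x(2) by (simp add: mult.commute)
    hence "exp (- \<beta> * (real m)\<^sup>2) \<le> exp (1/4 + real m * (- x))" by simp
    also have "\<dots> = exp (1/4) * q ^ m" by (simp only: exp_add q_def exp_of_nat_mult)
    finally show "exp (- \<beta> * (real m)\<^sup>2) \<le> exp (1/4) * q ^ m" .
  qed
  also have "\<dots> = exp (1/4) * (\<Sum>m<n. q ^ m)" by (simp add: sum_distrib_left)
  also have "\<dots> \<le> exp (1/4) * (1 / (1 - q))"
    using q sum_le_suminf[of "\<lambda>j. q ^ j" "{..<n}"] summable_geometric[of q] suminf_geometric[of q]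
    by (intro mult_left_mono) auto
  also have "1 / (1 - q) \<le> 1 + 1 / x"
  proof -
    have "1 + x \<le> exp x" by simp
    hence "q \<le> 1 / (1 + x)" using x by (simp add: q_def exp_minus field_simps)
    hence "1 - q \<ge> x / (1 + x)" using x by (simp add: field_simps)
    hence "1 / (1 - q) \<le> 1 / (x / (1 + x))" using x q by (intro divide_left_mono mult_pos_pos) auto
    thus ?thesis using x by (simp add: field_simps)
  qed
  finally show ?thesis using x by (simp add: x_def)
qed

lemma gaussian_sum_bound:
  fixes \<beta> :: real
  assumes "\<beta> > 0" "i < n"
  shows "(\<Sum>m<n. exp (- \<beta> * (real i - real m)\<^sup>2)) \<le> 2 * (exp (1/4) * (1 + 1 / sqrt \<beta>))"
proof -
  let ?g = "\<lambda>m::nat. exp (- \<beta> * (real m)\<^sup>2)"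
  have "{..<n} = {..i} \<union> {i<..<n}" using assms(2) by auto
  then have "(\<Sum>m<n. exp (- \<beta> * (real i - real m)\<^sup>2)) = (\<Sum>m\<le>i. exp (- \<beta> * (real i - real m)\<^sup>2)) + (\<Sum>m\<in>{i<..<n}. exp (- \<beta> * (real i - real m)\<^sup>2))"
  proof -
    assume eq: "{..<n} = {..i} \<union> {i<..<n}"
    show ?thesis unfolding eq by (intro sum.union_disjoint) auto
  qed
  also have "(\<Sum>m\<le>i. exp (- \<beta> * (real i - real m)\<^sup>2)) = (\<Sum>m\<le>i. ?g (i - m))"
    by (intro sum.cong refl) (auto simp: of_nat_diff)
  also have "\<dots> = (\<Sum>m\<le>i. ?g m)" using sum.atLeastAtMost_rev[of ?g 0 i] by (simp add: atMost_atLeast0)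
  also have "(\<Sum>m\<in>{i<..<n}. exp (- \<beta> * (real i - real m)\<^sup>2)) = (\<Sum>m\<in>{i<..<n}. ?g (m - i))"
    by (intro sum.cong refl) (auto simp: of_nat_diff power2_commute)
  also have "\<dots> \<le> (\<Sum>m<n. ?g m)"
  proof -
    have "inj_on (\<lambda>m. m - i) {i<..<n}" by (auto simp: inj_on_def)
    hence "(\<Sum>m\<in>{i<..<n}. ?g (m - i)) = (\<Sum>m\<in>(\<lambda>m. m - i) ` {i<..<n}. ?g m)"
      by (simp add: sum.reindex)
    also have "\<dots> \<le> (\<Sum>m<n. ?g m)" by (intro sum_mono2) auto
    finally show ?thesis .
  qed
  also have "(\<Sum>m\<le>i. ?g m) = (\<Sum>m<Suc i. ?g m)" by (simp add: lessThan_Suc_atMost)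
  finally show ?thesis
    using gaussian_sum_half[OF assms(1), of "Suc i"] gaussian_sum_half[OF assms(1), of n] by linarith
qed

text \<open>The crude bound \<open>exp (- x) \<le> 1 / x\<close> gains a factor \<open>u\<close>,
  which beats the prefactor of order \<open>1 / sqrt u\<close> and leaves
  \<open>sqrt u\<close>.\<close>

lemma gaussian_tail_small:
  fixes L d \<epsilon> :: real
  assumes "L > 0" "d > 0" "\<epsilon> > 0"
  shows "\<exists>v>0. \<forall>u y. 0 < u \<longrightarrow> u \<le> v \<longrightarrow> d \<le> \<bar>y\<bar> \<longrightarrow> heat L u y \<le> \<epsilon>"
proof -
  define A where "A = sqrt (2 * pi / L) * (2 * L) / d\<^sup>2"
  have A: "A > 0" using assms by (simp add: A_def)
  show ?thesis
  proof (intro exI[of _ "(\<epsilon> / A)\<^sup>2"] conjI allI impI)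
    show "(\<epsilon> / A)\<^sup>2 > 0" using A assms by simp
    fix u y :: real assume u: "0 < u" "u \<le> (\<epsilon> / A)\<^sup>2" and y: "d \<le> \<bar>y\<bar>"
    define x where "x = d\<^sup>2 / (2 * (L * u))"
    have x: "x > 0" using assms u by (simp add: x_def)
    have "d\<^sup>2 \<le> \<bar>y\<bar>\<^sup>2" using y assms by (intro power_mono) auto
    hence "x \<le> y\<^sup>2 / (2 * (L * u))" using assms u unfolding x_def by (intro divide_right_mono) auto
    hence "exp (- y\<^sup>2 / (2 * (L * u))) \<le> exp (- x)" by simp
    also have "\<dots> \<le> 1 / x"
    proof -
      have "x \<le> exp x" using exp_ge_add_one_self[of x] by linarith
      thus ?thesis using x by (simp add: exp_minus field_simps)
    qed
    finally have "heat L u y \<le> sqrt (2 * pi / (L * u)) * (1 / x)"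
      using assms u by (intro mult_left_mono) auto
    also have "\<dots> = A * sqrt u"
    proof -
      have "sqrt (2 * pi / (L * u)) = sqrt (2 * pi / L) / sqrt u"
        by (simp add: real_sqrt_divide real_sqrt_mult)
      moreover have "1 / x = (2 * L) / d\<^sup>2 * (sqrt u * sqrt u)" using u assms by (simp add: x_def)
      ultimately have "sqrt (2 * pi / (L * u)) * (1 / x) = sqrt (2 * pi / L) / sqrt u * ((2 * L) / d\<^sup>2 * (sqrt u * sqrt u))"
        by (simp only:)
      moreover have "k / w * (c * (w * w)) = k * c * w" if "w \<noteq> 0" for k w c :: real using that by simp
      hence "sqrt (2 * pi / L) / sqrt u * ((2 * L) / d\<^sup>2 * (sqrt u * sqrt u)) = sqrt (2 * pi / L) * ((2 * L) / d\<^sup>2) * sqrt u"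
        using u by (metis less_numeral_extra(3) real_sqrt_eq_zero_cancel_iff)
      ultimately show ?thesis by (simp add: A_def)
    qed
    also have "sqrt u \<le> \<epsilon> / A" using u A assms by (intro real_le_lsqrt) auto
    hence "A * sqrt u \<le> A * (\<epsilon> / A)" using A by (intro mult_left_mono) auto
    also have "A * (\<epsilon> / A) = \<epsilon>" using A by simp
    finally show "heat L u y \<le> \<epsilon>" .
  qed
qed

definition energy_bounded :: "'i set \<Rightarrow> ('p \<Rightarrow> 'i \<Rightarrow> real) \<Rightarrow> real \<Rightarrow> real \<Rightarrow> real \<Rightarrow> 'p set \<Rightarrow> bool" where
  "energy_bounded I X s C u0 P \<longleftrightarrow> finite P \<and> P \<noteq> {} \<and>
     (\<forall>u\<ge>u0. riesz_energy I X s u P \<le> C * (real (card P))\<^sup>2)"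

text \<open>This converts an energy exponent \<open>s\<close> into the decay
  \<open>u powr (s / 2)\<close> required by \<open>admissible\<close>.\<close>

lemma gaussian_energy_bound:
  fixes Y :: "'q \<Rightarrow> 'i \<Rightarrow> real"
  assumes c: "c > 0" and s: "s \<ge> 0"
  shows "\<exists>M>0. \<forall>(T :: 'q set) C u0 u. energy_bounded I Y s C u0 T \<and> 0 < u \<and> u0 \<le> u \<longrightarrow>
    (\<Sum>q\<in>T. \<Sum>q'\<in>T. exp (- (c * (\<Sum>i\<in>I. (Y q i - Y q' i)\<^sup>2) / u))) \<le> M * C * u powr (s / 2) * (real (card T))\<^sup>2"
proof -
  obtain M where M: "M > 0" "\<forall>u D. u > 0 \<longrightarrow> D \<ge> 0 \<longrightarrow> exp (- (c * D / u)) \<le> M * (u powr (s / 2) * (u + D) powr (- s / 2))"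
    using exp_neg_le_riesz[OF c s] by blast
  show ?thesis
  proof (intro exI[of _ M] conjI M allI impI)
    fix T :: "'q set" and C u0 u
    assume A: "energy_bounded I Y s C u0 T \<and> 0 < u \<and> u0 \<le> u"
    have "(\<Sum>q\<in>T. \<Sum>q'\<in>T. exp (- (c * (\<Sum>i\<in>I. (Y q i - Y q' i)\<^sup>2) / u)))
      \<le> (\<Sum>q\<in>T. \<Sum>q'\<in>T. M * (u powr (s / 2) * (u + (\<Sum>i\<in>I. (Y q i - Y q' i)\<^sup>2)) powr (- s / 2)))"
      using A by (intro sum_mono M(2)[rule_format] sum_nonneg) auto
    also have "\<dots> = M * u powr (s / 2) * riesz_energy I Y s u T"
      by (simp add: sum_distrib_left mult_ac)
    also have "\<dots> \<le> M * u powr (s / 2) * (C * (real (card T))\<^sup>2)"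
      using A M by (intro mult_left_mono) (auto simp: energy_bounded_def)
    finally show "(\<Sum>q\<in>T. \<Sum>q'\<in>T. exp (- (c * (\<Sum>i\<in>I. (Y q i - Y q' i)\<^sup>2) / u))) \<le> M * C * u powr (s / 2) * (real (card T))\<^sup>2"
      by (simp add: mult_ac)
  qed
qed

text \<open>At \<open>u = \<tau>\<^sup>2\<close> the smoothed density at 0 is of order at most
  \<open>1 / sqrt \<tau>\<close>, while each pair with dot product below \<open>\<tau>\<close>
  contributes at least \<open>c / \<tau>\<close> to the sum of kernels. Dividing leaves the
  proportion \<open>sqrt \<tau>\<close>.\<close>

lemma mass_near_zero:
  fixes I :: "'i set" and X :: "'p \<Rightarrow> 'i \<Rightarrow> real" and Y :: "'q \<Rightarrow> 'i \<Rightarrow> real"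
  assumes I: "finite I" and s: "s' \<ge> 0" "real (card I) + 1 \<le> s + s'" and C: "C \<ge> 0" "C' \<ge> 0"
    and E: "\<And>p. p \<in> E \<Longrightarrow> 2 + (\<Sum>i\<in>I. (X p i)\<^sup>2) \<le> L" and F: "\<And>q i. q \<in> F \<Longrightarrow> i \<in> I \<Longrightarrow> \<bar>Y q i\<bar> \<le> R" and L: "2 \<le> L"
  shows "\<exists>K>0. \<forall>\<tau> u0 P Q. 0 < u0 \<and> u0 \<le> \<tau>\<^sup>2 \<and> 0 < \<tau> \<and> \<tau> \<le> 1 \<and> P \<subseteq> E \<and> Q \<subseteq> F \<and> energy_bounded I X s C u0 P \<and> energy_bounded I Y s' C' u0 Q
    \<longrightarrow> real (card {(p, q). p \<in> P \<and> q \<in> Q \<and> \<bar>\<Sum>i\<in>I. X p i * Y q i\<bar> < \<tau>}) \<le> K * sqrt \<tau> * (real (card P) * real (card Q))"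
proof -
  obtain M where M: "M > 0" and gauss: "\<And>T C u0 u. energy_bounded I Y s' C u0 T \<Longrightarrow> 0 < u \<Longrightarrow> u0 \<le> u \<Longrightarrow>
    (\<Sum>q\<in>T. \<Sum>q'\<in>T. exp (- (1/4 * (\<Sum>i\<in>I. (Y q i - Y q' i)\<^sup>2) / u))) \<le> M * C * u powr (s' / 2) * (real (card T))\<^sup>2"
    using gaussian_energy_bound[of "1/4" s' I Y] s(1) by auto
  \<comment> \<open>With \<open>r = 0\<close> and no dilations \<open>\<kappa> = s' / 2\<close>, and
    \<open>card I + 1 \<le> s + s'\<close> puts the exponent
    \<open>(s + s' - card I - 2) / 4\<close> at \<open>- 1/4\<close> or above.\<close>
  define \<alpha> :: real where "\<alpha> = - 1 / 4"
  have \<alpha>: "\<alpha> < 1" "\<alpha> \<le> (s - real (card I) - 2 + 2 * (s' / 2)) / 4" "\<alpha> \<noteq> 0" using s by (auto simp: \<alpha>_def)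
  have MC: "0 \<le> M * C'" using M C by simp
  have L0: "L > 0" using L by simp
  obtain K where K: "K > 0" and inc: "\<forall>(P :: 'p set) (T :: 'q set) X Y r u0. admissible I P T X Y r L R s C (s' / 2) (M * C') u0 \<longrightarrow>
     (\<forall>a b. u0 \<le> a \<and> a \<le> b \<and> b \<le> 1 \<longrightarrow> \<bar>osc_avg I P T X Y r L 0 b - osc_avg I P T X Y r L 0 a\<bar> \<le> K * (b powr \<alpha> - a powr \<alpha>) / \<alpha>)"
    using osc_avg_increment[OF I \<alpha> C(1) MC L0, where ?'p='p and ?'q='q and R=R] by (elim exE conjE)
  define g where "g = gauss_osc 0 L 0"
  have g: "g \<ge> 0" using gauss_osc_bound[OF L0, of 0 0] by (simp add: g_def)
  define c where "c = sqrt (2 * pi / L) * exp (- 1)"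
  have c: "c > 0" using L0 by (simp add: c_def)
  show ?thesis
  proof (intro exI[of _ "(g + 4 * K) / c"] conjI allI impI)
    show "0 < (g + 4 * K) / c" using g K c by simp
    fix \<tau> u0 P Q
    assume A: "0 < u0 \<and> u0 \<le> \<tau>\<^sup>2 \<and> 0 < \<tau> \<and> \<tau> \<le> 1 \<and> P \<subseteq> E \<and> Q \<subseteq> F \<and> energy_bounded I X s C u0 P \<and> energy_bounded I Y s' C' u0 Q"
    have fin: "finite P" "finite Q" "P \<noteq> {}" "Q \<noteq> {}" using A by (auto simp: energy_bounded_def)
    define n where "n = real (card P) * real (card Q)"
    have n: "n > 0" using fin by (auto simp: n_def card_gt_0_iff)
    have \<tau>1: "\<tau>\<^sup>2 \<le> 1" using A by (simp add: power_le_one)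
    have adm: "admissible I P Q X Y (\<lambda>_. 0) L R s C (s' / 2) (M * C') u0"
      unfolding admissible_def
    proof (intro conjI ballI fin)
      show "0 < u0" "u0 \<le> 1" using A \<tau>1 by auto
      show "2 + (\<Sum>i\<in>I. (X p i)\<^sup>2) \<le> L" if "p \<in> P" for p using E A that by auto
      show "\<bar>Y q i\<bar> \<le> R" if "q \<in> Q" "i \<in> I" for q i using F A that by auto
      show "riesz_energy I X s u P \<le> C * (real (card P))\<^sup>2" if "u \<in> {u0..1}" for u
        using A that by (auto simp: energy_bounded_def)
      show "gauss_energy I Y (\<lambda>_. 0) u Q \<le> M * C' * u powr (s' / 2) * (real (card Q))\<^sup>2" if "u \<in> {u0..1}" for u
        using gauss[of C' u0 Q u] A that by simp
    qed
    define f where "f = osc_avg I P Q X Y (\<lambda>_. 0) L 0"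
    have f1: "\<bar>f 1\<bar> \<le> g" unfolding f_def g_def by (rule osc_avg_bound_at_1[OF L0])
    have "\<bar>f 1 - f (\<tau>\<^sup>2)\<bar> \<le> K * (1 powr \<alpha> - (\<tau>\<^sup>2) powr \<alpha>) / \<alpha>"
      using inc adm A \<tau>1 unfolding f_def by blast
    also have "\<dots> = 4 * K * ((\<tau>\<^sup>2) powr \<alpha> - 1)" by (simp add: \<alpha>_def algebra_simps)
    also have "(\<tau>\<^sup>2) powr \<alpha> = 1 / sqrt \<tau>"
    proof -
      have "(\<tau>\<^sup>2) powr \<alpha> = (\<tau> powr 2) powr \<alpha>" using A by (simp add: powr_numeral)
      also have "\<dots> = \<tau> powr (- (1/2))" unfolding powr_powr by (simp add: \<alpha>_def)
      also have "\<dots> = 1 / sqrt \<tau>" using A by (simp only: powr_minus powr_half_sqrt less_imp_le inverse_eq_divide)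
      finally show ?thesis .
    qed
    finally have "\<bar>f (\<tau>\<^sup>2)\<bar> \<le> g + 4 * K * (1 / sqrt \<tau> - 1)" using f1 by linarith
    also have "\<dots> \<le> (g + 4 * K) / sqrt \<tau>"
    proof -
      have "sqrt \<tau> \<le> 1" "0 < sqrt \<tau>" using A by auto
      hence "1 \<le> 1 / sqrt \<tau>" by simp
      hence "g * 1 \<le> g * (1 / sqrt \<tau>)" using g by (intro mult_left_mono)
      thus ?thesis using K by (simp add: algebra_simps add_divide_distrib)
    qed
    finally have fub: "\<bar>f (\<tau>\<^sup>2)\<bar> \<le> (g + 4 * K) / sqrt \<tau>" .
    let ?B = "{(p, q). p \<in> P \<and> q \<in> Q \<and> \<bar>\<Sum>i\<in>I. X p i * Y q i\<bar> < \<tau>}"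
    let ?k = "\<lambda>p q. heat L (\<tau>\<^sup>2) ((\<Sum>i\<in>I. X p i * Y q i) - 0)"
    have "real (card ?B) * (c / \<tau>) = (\<Sum>(p, q)\<in>?B. c / \<tau>)" by simp
    also have "\<dots> \<le> (\<Sum>(p, q)\<in>?B. ?k p q)"
    proof (intro sum_mono, safe)
      fix p q assume pq: "\<bar>\<Sum>i\<in>I. X p i * Y q i\<bar> < \<tau>"
      have "(\<Sum>i\<in>I. X p i * Y q i)\<^sup>2 \<le> \<tau>\<^sup>2" using pq A by (intro abs_le_square_iff[THEN iffD1]) auto
      also have "\<tau>\<^sup>2 \<le> 2 * (L * \<tau>\<^sup>2)"
        using mult_right_mono[of 1 "2 * L" "\<tau>\<^sup>2"] L by (simp add: mult.assoc)
      finally have "(\<Sum>i\<in>I. X p i * Y q i)\<^sup>2 / (2 * (L * \<tau>\<^sup>2)) \<le> 1"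
        using L A by (simp add: pos_divide_le_eq)
      hence "exp (- 1) \<le> exp (- ((\<Sum>i\<in>I. X p i * Y q i) - 0)\<^sup>2 / (2 * (L * \<tau>\<^sup>2)))" by simp
      moreover have "sqrt (2 * pi / (L * \<tau>\<^sup>2)) = sqrt (2 * pi / L) / \<tau>"
        using A by (simp add: real_sqrt_divide real_sqrt_mult)
      ultimately show "c / \<tau> \<le> ?k p q"
        using A L0 by (simp add: c_def mult_left_mono divide_right_mono)
    qed
    also have "\<dots> \<le> (\<Sum>(p, q)\<in>P \<times> Q. ?k p q)"
      using fin L0 by (intro sum_mono2) auto
    also have "\<dots> = f (\<tau>\<^sup>2) * n"
    proof -
      have "\<tau>\<^sup>2 > 0" using A by simp
      hence "f (\<tau>\<^sup>2) = (\<Sum>p\<in>P. \<Sum>q\<in>Q. ?k p q) / n" unfolding f_def n_def by (rule osc_avg_0[OF L0])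
      hence "f (\<tau>\<^sup>2) * n = (\<Sum>p\<in>P. \<Sum>q\<in>Q. ?k p q)" using n by (simp only: nonzero_eq_divide_eq)
      thus ?thesis by (simp only: sum.cartesian_product)
    qed
    also have "\<dots> \<le> (g + 4 * K) / sqrt \<tau> * n"
      using fub n by (intro mult_right_mono) auto
    finally have "real (card ?B) \<le> (g + 4 * K) / sqrt \<tau> * n * (\<tau> / c)"
      using c A by (simp add: field_simps)
    also have "\<dots> = (g + 4 * K) / c * (\<tau> / sqrt \<tau>) * n" by (simp add: mult_ac)
    also have "\<tau> / sqrt \<tau> = sqrt \<tau>" using A by (simp add: real_div_sqrt)
    finally show "real (card ?B) \<le> (g + 4 * K) / c * sqrt \<tau> * (real (card P) * real (card Q))"
      by (simp add: n_def)
  qed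
qed

section \<open>Averaging over dilations\<close>

lemma sum_Times: "(\<Sum>x\<in>A \<times> B. h x) = (\<Sum>a\<in>A. \<Sum>b\<in>B. h (a, b))"
  by (simp add: sum.cartesian_product)

lemma double_sum_Times_factor:
  fixes f :: "'a \<Rightarrow> 'a \<Rightarrow> real" and g :: "'b \<Rightarrow> 'b \<Rightarrow> real"
  shows "(\<Sum>x\<in>A \<times> B. \<Sum>y\<in>A \<times> B. f (fst x) (fst y) * g (snd x) (snd y)) =
    (\<Sum>a\<in>A. \<Sum>a'\<in>A. f a a') * (\<Sum>b\<in>B. \<Sum>b'\<in>B. g b b')"
proof -
  have "(\<Sum>x\<in>A \<times> B. \<Sum>y\<in>A \<times> B. f (fst x) (fst y) * g (snd x) (snd y)) =
    (\<Sum>a\<in>A. \<Sum>b\<in>B. \<Sum>a'\<in>A. \<Sum>b'\<in>B. f a a' * g b b')"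
    by (simp only: sum_Times fst_conv snd_conv)
  also have "\<dots> = (\<Sum>a\<in>A. \<Sum>a'\<in>A. \<Sum>b\<in>B. \<Sum>b'\<in>B. f a a' * g b b')"
    by (intro sum.cong refl sum.swap)
  also have "\<dots> = (\<Sum>a\<in>A. \<Sum>a'\<in>A. f a a' * (\<Sum>b\<in>B. \<Sum>b'\<in>B. g b b'))"
    by (simp only: sum_distrib_left)
  also have "\<dots> = (\<Sum>a\<in>A. \<Sum>a'\<in>A. f a a') * (\<Sum>b\<in>B. \<Sum>b'\<in>B. g b b')"
    by (simp only: sum_distrib_right)
  finally show ?thesis .
qed

text \<open>The parameter \<open>\<lambda> \<in> [1, 2]\<close> is discretized as well, so that only finite sums occur.\<close>

definition dil :: "nat \<Rightarrow> nat \<Rightarrow> real" where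
  "dil n i = 1 + real i / real n"

text \<open>The kernel at \<open>\<lambda> * y\<close> is \<open>1 / \<lambda>\<close> times the
  kernel at \<open>y\<close> with the variance divided by the square of \<open>\<lambda>\<close>.
  For \<open>\<lambda>\<close> in \<open>[1, 2]\<close> the average is therefore still a smoothed
  density at \<open>t\<close> at scale \<open>u\<close>.\<close>

definition smoothed_density :: "'i set \<Rightarrow> ('p \<Rightarrow> 'i \<Rightarrow> real) \<Rightarrow> ('q \<Rightarrow> 'i \<Rightarrow> real) \<Rightarrow> real \<Rightarrow> 'p set \<Rightarrow> 'q set \<Rightarrow> nat \<Rightarrow> real \<Rightarrow> real \<Rightarrow> real" where
  "smoothed_density I X Y L P Q n t u = (\<Sum>p\<in>P. \<Sum>q\<in>Q. \<Sum>i<n.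
     heat L u (dil n i * ((\<Sum>j\<in>I. X p j * Y q j) - t))) / (real (card P) * (real (card Q) * real n))"

lemma smoothed_density_eq_osc_avg:
  assumes "L > 0" "u > 0"
  shows "smoothed_density I X Y L P Q n t u =
    osc_avg I P (Q \<times> {..<n}) X (\<lambda>x j. dil n (snd x) * Y (fst x) j) (\<lambda>x. dil n (snd x) * t) L 0 u"
proof -
  have "(\<Sum>j\<in>I. X p j * (dil n i * Y q j)) - dil n i * t = dil n i * ((\<Sum>j\<in>I. X p j * Y q j) - t)" for p q i
    by (simp add: sum_distrib_left right_diff_distrib mult_ac)
  thus ?thesis
    unfolding smoothed_density_def osc_avg_0[OF assms] sum_Times fst_conv snd_conv card_cartesian_product card_lessThan of_nat_mult
    by simp
qed

lemma dil_bounds: "1 \<le> dil n i" "i < n \<Longrightarrow> dil n i \<le> 2"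
  by (auto simp: dil_def)

text \<open>The map \<open>(y, l) \<mapsto> (l y, l t)\<close> cannot contract much: the last
  coordinate detects \<open>l - l'\<close> because \<open>\<bar>t\<bar> \<ge> \<tau>\<close>, and
  then \<open>Y - Y'\<close> is recovered from \<open>l * Y - l' * Y'\<close> up to
  \<open>(l - l') * Y'\<close>. The constant deteriorates as \<open>t\<close> tends to 0.\<close>

lemma dilation_separation:
  fixes Y Y' :: "'i \<Rightarrow> real"
  assumes l: "1 \<le> l" and B: "(\<Sum>j\<in>I. (Y' j)\<^sup>2) \<le> B" and \<tau>: "0 < \<tau>" "\<tau> \<le> 1" "\<tau> \<le> \<bar>t\<bar>"
  shows "\<tau>\<^sup>2 / (2 * B + 2) * ((\<Sum>j\<in>I. (Y j - Y' j)\<^sup>2) + (l - l')\<^sup>2)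
    \<le> (\<Sum>j\<in>I. (l * Y j - l' * Y' j)\<^sup>2) + (l * t - l' * t)\<^sup>2"
proof -
  define D where "D = (\<Sum>j\<in>I. (Y j - Y' j)\<^sup>2)"
  define D1 where "D1 = (\<Sum>j\<in>I. (l * Y j - l' * Y' j)\<^sup>2)"
  define w where "w = (l - l')\<^sup>2"
  have "0 \<le> (\<Sum>j\<in>I. (Y' j)\<^sup>2)" by (intro sum_nonneg) auto
  hence B0: "B \<ge> 0" using B by linarith
  have D1: "D1 \<ge> 0" by (auto simp: D1_def intro: sum_nonneg)
  have w0: "w \<ge> 0" by (simp add: w_def)
  have "D \<le> (\<Sum>j\<in>I. 2 * (l * Y j - l' * Y' j)\<^sup>2 + 2 * w * (Y' j)\<^sup>2)"
    unfolding D_def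
  proof (intro sum_mono)
    fix j
    have "1 * (Y j - Y' j)\<^sup>2 \<le> l\<^sup>2 * (Y j - Y' j)\<^sup>2" using l by (intro mult_right_mono) auto
    also have "\<dots> = ((l * Y j - l' * Y' j) - (l - l') * Y' j)\<^sup>2" by (simp add: power2_eq_square algebra_simps)
    also have "\<dots> \<le> 2 * (l * Y j - l' * Y' j)\<^sup>2 + 2 * ((l - l') * Y' j)\<^sup>2"
    proof -
      have "(a - b)\<^sup>2 \<le> 2 * a\<^sup>2 + 2 * b\<^sup>2" for a b :: real
        using zero_le_power2[of "a + b"] by (simp add: power2_eq_square algebra_simps)
      thus ?thesis .
    qed
    finally show "(Y j - Y' j)\<^sup>2 \<le> 2 * (l * Y j - l' * Y' j)\<^sup>2 + 2 * w * (Y' j)\<^sup>2"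
      by (simp add: w_def power_mult_distrib)
  qed
  also have "\<dots> = 2 * D1 + 2 * w * (\<Sum>j\<in>I. (Y' j)\<^sup>2)"
    by (simp add: D1_def sum.distrib sum_distrib_left)
  also have "\<dots> \<le> 2 * D1 + 2 * w * B" using B w0 by (intro add_left_mono mult_left_mono) auto
  finally have D: "D \<le> 2 * D1 + 2 * w * B" .
  have \<tau>2: "\<tau>\<^sup>2 \<le> 1" using \<tau> by (simp add: power_le_one)
  have tt: "\<tau>\<^sup>2 \<le> t\<^sup>2" using \<tau> by (intro abs_le_square_iff[THEN iffD1]) auto
  have "\<tau>\<^sup>2 * (D + w) \<le> \<tau>\<^sup>2 * ((2 * D1 + 2 * w * B) + w)"
    using D by (intro mult_left_mono add_right_mono) auto
  also have "\<dots> = \<tau>\<^sup>2 * (2 * D1) + \<tau>\<^sup>2 * ((2 * B + 1) * w)" by (simp add: algebra_simps)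
  also have "\<tau>\<^sup>2 * (2 * D1) \<le> 1 * ((2 * B + 2) * D1)"
    using \<tau>2 D1 B0 by (intro mult_mono mult_right_mono) auto
  also have "\<tau>\<^sup>2 * ((2 * B + 1) * w) \<le> t\<^sup>2 * ((2 * B + 2) * w)"
    using tt w0 B0 by (intro mult_mono mult_right_mono) auto
  finally have "\<tau>\<^sup>2 * (D + w) \<le> (2 * B + 2) * (D1 + t\<^sup>2 * w)" by (simp add: algebra_simps)
  moreover have "t\<^sup>2 * w = (l * t - l' * t)\<^sup>2" by (simp add: w_def power2_eq_square algebra_simps)
  ultimately show ?thesis using B0 by (simp add: D_def D1_def w_def field_simps)
qed

text \<open>By the separation the Gaussian factors into a part in \<open>q\<close>, giving
  \<open>u powr (s / 2)\<close>, and a part in the dilation index, giving the extra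
  \<open>sqrt u\<close>. The condition \<open>1 \<le> n * sqrt u\<close> says that the mesh
  \<open>1 / n\<close> is finer than the smoothing, so that the discrete sum behaves like the
  integral.\<close>

lemma dilated_energy_bound:
  fixes Y :: "'q \<Rightarrow> 'i \<Rightarrow> real"
  assumes s: "s \<ge> 0" and C: "C \<ge> 0" and B: "\<forall>q\<in>F. (\<Sum>j\<in>I. (Y q j)\<^sup>2) \<le> B" and B0: "B \<ge> 0" and \<tau>: "0 < \<tau>" "\<tau> \<le> 1"
  shows "\<exists>M>0. \<forall>t u0 u Q n. \<tau> \<le> \<bar>t\<bar> \<and> 0 < u \<and> u0 \<le> u \<and> 1 \<le> real n * sqrt u \<and> Q \<subseteq> F \<and> energy_bounded I Y s C u0 Q \<longrightarrow>
    gauss_energy I (\<lambda>x j. dil n (snd x) * Y (fst x) j) (\<lambda>x. dil n (snd x) * t) u (Q \<times> {..<n})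
     \<le> M * C * u powr ((s + 1) / 2) * (real (card (Q \<times> {..<n})))\<^sup>2"
proof -
  \<comment> \<open>The separation constant, divided by the 4 in the denominator
    \<open>4 * u\<close> of \<open>gauss_energy\<close>.\<close>
  define c where "c = \<tau>\<^sup>2 / (2 * B + 2) / 4"
  have c: "c > 0" using \<tau> B0 by (auto simp: c_def)
  have c4: "4 * c = \<tau>\<^sup>2 / (2 * B + 2)"
  proof -
    have "4 * (x / 4) = x" for x :: real by simp
    thus ?thesis by (simp only: c_def)
  qed
  obtain M where M: "M > 0" and gauss: "\<And>T C u0 u. energy_bounded I Y s C u0 T \<Longrightarrow> 0 < u \<Longrightarrow> u0 \<le> u \<Longrightarrow>
    (\<Sum>q\<in>T. \<Sum>q'\<in>T. exp (- (c * (\<Sum>i\<in>I. (Y q i - Y q' i)\<^sup>2) / u))) \<le> M * C * u powr (s / 2) * (real (card T))\<^sup>2"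
    using gaussian_energy_bound[OF c s, of I Y] by auto
  define M2 where "M2 = 2 * (exp (1/4) * (1 + 1 / sqrt c))"
  have M2: "M2 > 0" using c by (auto simp: M2_def intro!: mult_pos_pos add_pos_nonneg)
  show ?thesis
  proof (intro exI[of _ "M * M2"] conjI allI impI)
    show "0 < M * M2" using M M2 by simp
    fix t u0 u Q n
    assume A: "\<tau> \<le> \<bar>t\<bar> \<and> 0 < u \<and> u0 \<le> u \<and> 1 \<le> real n * sqrt u \<and> Q \<subseteq> F \<and> energy_bounded I Y s C u0 Q"
    have n: "n > 0" using A by (intro gr0I) auto
    define \<beta> where "\<beta> = c / u / (real n)\<^sup>2"
    have \<beta>: "\<beta> > 0" using c A n by (simp add: \<beta>_def)
    let ?f = "\<lambda>q q'. exp (- (c * (\<Sum>i\<in>I. (Y q i - Y q' i)\<^sup>2) / u))"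
    let ?g = "\<lambda>i m. exp (- \<beta> * (real i - real m)\<^sup>2)"
    have "gauss_energy I (\<lambda>x j. dil n (snd x) * Y (fst x) j) (\<lambda>x. dil n (snd x) * t) u (Q \<times> {..<n})
       \<le> (\<Sum>x\<in>Q \<times> {..<n}. \<Sum>y\<in>Q \<times> {..<n}. ?f (fst x) (fst y) * ?g (snd x) (snd y))"
    proof (intro sum_mono)
      fix x y assume xy: "x \<in> Q \<times> {..<n}" "y \<in> Q \<times> {..<n}"
      define D where "D = (\<Sum>i\<in>I. (Y (fst x) i - Y (fst y) i)\<^sup>2)"
      define D1 where "D1 = (\<Sum>j\<in>I. (dil n (snd x) * Y (fst x) j - dil n (snd y) * Y (fst y) j)\<^sup>2) + (dil n (snd x) * t - dil n (snd y) * t)\<^sup>2"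
      have "fst y \<in> F" using xy A by auto
      have "4 * c * (D + (dil n (snd x) - dil n (snd y))\<^sup>2) \<le> D1"
        unfolding c4 D_def D1_def
        using dilation_separation[where l="dil n (snd x)" and l'="dil n (snd y)" and Y="Y (fst x)" and t=t, OF dil_bounds(1) B[rule_format, OF \<open>fst y \<in> F\<close>] \<tau>] A by simp
      hence "4 * c * (D + (dil n (snd x) - dil n (snd y))\<^sup>2) / (4 * u) \<le> D1 / (4 * u)"
        using A by (intro divide_right_mono) auto
      moreover have "4 * c * (D + (dil n (snd x) - dil n (snd y))\<^sup>2) / (4 * u) = c * D / u + \<beta> * (real (snd x) - real (snd y))\<^sup>2"
      proof -
        have "dil n (snd x) - dil n (snd y) = (real (snd x) - real (snd y)) / real n"
          by (simp add: dil_def diff_divide_distrib)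
        thus ?thesis using A n by (simp add: \<beta>_def power_divide add_divide_distrib distrib_left)
      qed
      ultimately have "- D1 / (4 * u) \<le> - (c * D / u) + - \<beta> * (real (snd x) - real (snd y))\<^sup>2" by simp
      hence "exp (- D1 / (4 * u)) \<le> exp (- (c * D / u)) * exp (- \<beta> * (real (snd x) - real (snd y))\<^sup>2)"
        by (simp flip: exp_add)
      thus "exp (- ((\<Sum>j\<in>I. (dil n (snd x) * Y (fst x) j - dil n (snd y) * Y (fst y) j)\<^sup>2) + (dil n (snd x) * t - dil n (snd y) * t)\<^sup>2) / (4 * u))
         \<le> ?f (fst x) (fst y) * ?g (snd x) (snd y)"
        unfolding D_def D1_def .
    qed
    also have "\<dots> = (\<Sum>q\<in>Q. \<Sum>q'\<in>Q. ?f q q') * (\<Sum>i<n. \<Sum>m<n. ?g i m)"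
      by (rule double_sum_Times_factor)
    also have "\<dots> \<le> (M * C * u powr (s / 2) * (real (card Q))\<^sup>2) * (M2 * sqrt u * (real n)\<^sup>2)"
    proof (intro mult_mono)
      show "(\<Sum>q\<in>Q. \<Sum>q'\<in>Q. ?f q q') \<le> M * C * u powr (s / 2) * (real (card Q))\<^sup>2"
        using gauss A by blast
      have "(\<Sum>i<n. \<Sum>m<n. ?g i m) \<le> (\<Sum>i<n. M2 * sqrt u * real n)"
      proof (rule sum_mono)
        fix i assume "i \<in> {..<n}"
        hence "(\<Sum>m<n. ?g i m) \<le> 2 * (exp (1/4) * (1 + 1 / sqrt \<beta>))" by (intro gaussian_sum_bound \<beta>) simp
        also have "1 / sqrt \<beta> = (1 / sqrt c) * (real n * sqrt u)"
          using c A n by (simp add: \<beta>_def real_sqrt_divide real_sqrt_mult mult.commute)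
        also have "1 + (1 / sqrt c) * (real n * sqrt u) \<le> (1 + 1 / sqrt c) * (real n * sqrt u)"
          using A by (simp add: distrib_right)
        finally show "(\<Sum>m<n. ?g i m) \<le> M2 * sqrt u * real n" by (simp add: M2_def mult_ac)
      qed
      thus "(\<Sum>i<n. \<Sum>m<n. ?g i m) \<le> M2 * sqrt u * (real n)\<^sup>2" by (simp add: power2_eq_square mult_ac)
    qed (use M C in \<open>auto intro!: sum_nonneg\<close>)
    also have "\<dots> = M * M2 * C * (u powr (s / 2) * sqrt u) * (real (card Q) * real n)\<^sup>2"
      by (simp add: power_mult_distrib mult_ac)
    also have "u powr (s / 2) * sqrt u = u powr ((s + 1) / 2)"
      using A by (simp add: add_divide_distrib powr_add powr_half_sqrt)
    finally show "gauss_energy I (\<lambda>x j. dil n (snd x) * Y (fst x) j) (\<lambda>x. dil n (snd x) * t) u (Q \<times> {..<n})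
     \<le> M * M2 * C * u powr ((s + 1) / 2) * (real (card (Q \<times> {..<n})))\<^sup>2"
      by (simp add: card_cartesian_product)
  qed
qed

lemma smoothed_density_increment:
  fixes I :: "'i set" and X :: "'p \<Rightarrow> 'i \<Rightarrow> real" and Y :: "'q \<Rightarrow> 'i \<Rightarrow> real"
  assumes I: "finite I" and s: "s' \<ge> 0" and \<delta>: "0 < \<delta>" "\<delta> < 1" "\<delta> \<le> (s + s' - real (card I) - 1) / 4"
    and C: "C \<ge> 0" "C' \<ge> 0"
    and E: "\<And>p. p \<in> E \<Longrightarrow> 2 + (\<Sum>i\<in>I. (X p i)\<^sup>2) \<le> L" and F: "\<And>q i. q \<in> F \<Longrightarrow> i \<in> I \<Longrightarrow> \<bar>Y q i\<bar> \<le> R"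
    and L: "2 \<le> L" and R: "R \<ge> 0" and \<tau>: "0 < \<tau>" "\<tau> \<le> 1"
  shows "\<exists>G>0. \<forall>t u0 a P Q n. \<tau> \<le> \<bar>t\<bar> \<and> 0 < u0 \<and> u0 \<le> a \<and> a \<le> 1 \<and> P \<subseteq> E \<and> Q \<subseteq> F \<and> energy_bounded I X s C u0 P \<and> energy_bounded I Y s' C' u0 Q
     \<and> 1 \<le> real n * sqrt u0
    \<longrightarrow> \<bar>smoothed_density I X Y L P Q n t a - smoothed_density I X Y L P Q n t u0\<bar> \<le> G * a powr \<delta>"
proof -
  define B where "B = real (card I) * R\<^sup>2"
  have B0: "B \<ge> 0" by (simp add: B_def)
  have B: "\<forall>q\<in>F. (\<Sum>j\<in>I. (Y q j)\<^sup>2) \<le> B"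
  proof
    fix q assume "q \<in> F"
    have "(\<Sum>j\<in>I. (Y q j)\<^sup>2) \<le> (\<Sum>j\<in>I. R\<^sup>2)"
      using F[OF \<open>q \<in> F\<close>] R by (intro sum_mono abs_le_square_iff[THEN iffD1]) auto
    thus "(\<Sum>j\<in>I. (Y q j)\<^sup>2) \<le> B" by (simp add: B_def)
  qed
  obtain M where M: "M > 0" and en: "\<forall>t u0 u Q n. \<tau> \<le> \<bar>t\<bar> \<and> 0 < u \<and> u0 \<le> u \<and> 1 \<le> real n * sqrt u \<and> Q \<subseteq> F \<and> energy_bounded I Y s' C' u0 Q \<longrightarrow>
    gauss_energy I (\<lambda>x j. dil n (snd x) * Y (fst x) j) (\<lambda>x. dil n (snd x) * t) u (Q \<times> {..<n})
     \<le> M * C' * u powr ((s' + 1) / 2) * (real (card (Q \<times> {..<n})))\<^sup>2"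
    using dilated_energy_bound[where F=F and Y=Y and I=I, OF s C(2) B B0 \<tau>] by (elim exE conjE)
  have MC: "0 \<le> M * C'" using M C by simp
  have L0: "L > 0" using L by simp
  \<comment> \<open>Raising \<open>\<kappa>\<close> from \<open>s' / 2\<close> to
    \<open>(s' + 1) / 2\<close> turns the borderline exponent \<open>- 1/4\<close> into one that can
    be positive.\<close>
  have \<delta>': "\<delta> \<le> (s - real (card I) - 2 + 2 * ((s' + 1) / 2)) / 4" "\<delta> \<noteq> 0" using \<delta> by (auto simp: add_divide_distrib)
  obtain K where K: "K > 0" and inc: "\<forall>(P :: 'p set) (T :: ('q \<times> nat) set) X Y r u0. admissible I P T X Y r L (2 * R) s C ((s' + 1) / 2) (M * C') u0 \<longrightarrow>
     (\<forall>a b. u0 \<le> a \<and> a \<le> b \<and> b \<le> 1 \<longrightarrow> \<bar>osc_avg I P T X Y r L 0 b - osc_avg I P T X Y r L 0 a\<bar> \<le> K * (b powr \<delta> - a powr \<delta>) / \<delta>)"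
    using osc_avg_increment[OF I \<delta>(2) \<delta>' C(1) MC L0, where ?'p='p and ?'q="'q \<times> nat" and R="2 * R"] by (elim exE conjE)
  show ?thesis
  proof (intro exI[of _ "K / \<delta>"] conjI allI impI)
    show "0 < K / \<delta>" using K \<delta> by simp
    fix t u0 a P Q n
    assume A: "\<tau> \<le> \<bar>t\<bar> \<and> 0 < u0 \<and> u0 \<le> a \<and> a \<le> 1 \<and> P \<subseteq> E \<and> Q \<subseteq> F \<and> energy_bounded I X s C u0 P \<and> energy_bounded I Y s' C' u0 Q
     \<and> 1 \<le> real n * sqrt u0"
    have fin: "finite P" "finite Q" "P \<noteq> {}" "Q \<noteq> {}" using A by (auto simp: energy_bounded_def)
    have n: "n > 0" using A by (intro gr0I) auto
    have adm: "admissible I P (Q \<times> {..<n}) X (\<lambda>x j. dil n (snd x) * Y (fst x) j) (\<lambda>x. dil n (snd x) * t) L (2 * R) s C ((s' + 1) / 2) (M * C') u0"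
      unfolding admissible_def
    proof (intro conjI ballI fin)
      show "finite (Q \<times> {..<n})" "Q \<times> {..<n} \<noteq> {}" using fin n by auto
      show "0 < u0" "u0 \<le> 1" using A by auto
      show "2 + (\<Sum>i\<in>I. (X p i)\<^sup>2) \<le> L" if "p \<in> P" for p using E A that by auto
      show "\<bar>dil n (snd x) * Y (fst x) i\<bar> \<le> 2 * R" if "x \<in> Q \<times> {..<n}" "i \<in> I" for x i
        unfolding abs_mult using that A F[of "fst x" i] dil_bounds[of n "snd x"] dil_bounds(2)[of "snd x" n]
        by (intro mult_mono) auto
      show "riesz_energy I X s u P \<le> C * (real (card P))\<^sup>2" if "u \<in> {u0..1}" for u
        using A that by (auto simp: energy_bounded_def)
      fix u assume u: "u \<in> {u0..1}"
      have "real n * sqrt u0 \<le> real n * sqrt u" using u by (intro mult_left_mono) auto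
      hence "1 \<le> real n * sqrt u" using A by linarith
      thus "gauss_energy I (\<lambda>x j. dil n (snd x) * Y (fst x) j) (\<lambda>x. dil n (snd x) * t) u (Q \<times> {..<n})
     \<le> M * C' * u powr ((s' + 1) / 2) * (real (card (Q \<times> {..<n})))\<^sup>2"
        using A u by (intro en[rule_format]) auto
    qed
    have "\<bar>smoothed_density I X Y L P Q n t a - smoothed_density I X Y L P Q n t u0\<bar> \<le> K * (a powr \<delta> - u0 powr \<delta>) / \<delta>"
    proof -
      have "a > 0" "u0 > 0" using A by auto
      thus ?thesis
        unfolding smoothed_density_eq_osc_avg[OF L0 \<open>a > 0\<close>] smoothed_density_eq_osc_avg[OF L0 \<open>u0 > 0\<close>]
        using A by (intro inc[rule_format, OF adm]) auto
    qed
    also have "\<dots> \<le> K * a powr \<delta> / \<delta>" using K \<delta> by (intro divide_right_mono mult_left_mono) auto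
    finally show "\<bar>smoothed_density I X Y L P Q n t a - smoothed_density I X Y L P Q n t u0\<bar> \<le> K / \<delta> * a powr \<delta>" by simp
  qed
qed

section \<open>The bilinear image of two sets\<close>

lemma smoothed_density_le:
  assumes "finite P" "finite Q" "P \<noteq> {}" "Q \<noteq> {}" "n > 0"
    and "\<And>p q i. p \<in> P \<Longrightarrow> q \<in> Q \<Longrightarrow> i < n \<Longrightarrow>
      heat L u (dil n i * ((\<Sum>j\<in>I. X p j * Y q j) - t)) \<le> \<epsilon>"
  shows "smoothed_density I X Y L P Q n t u \<le> \<epsilon>"
proof -
  have den: "real (card P) * (real (card Q) * real n) > 0" using assms by (simp add: card_gt_0_iff)
  have "(\<Sum>p\<in>P. \<Sum>q\<in>Q. \<Sum>i<n. heat L u (dil n i * ((\<Sum>j\<in>I. X p j * Y q j) - t)))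
    \<le> (\<Sum>p\<in>P. \<Sum>q\<in>Q. \<Sum>i<n. \<epsilon>)"
    using assms(6) by (intro sum_mono) auto
  also have "\<dots> = \<epsilon> * (real (card P) * (real (card Q) * real n))" by simp
  finally show ?thesis using den unfolding smoothed_density_def by (simp add: pos_divide_le_eq)
qed

lemma gaussian_lower_bound:
  fixes L h y :: real
  assumes "L \<ge> 2" "h > 0" "\<bar>y\<bar> \<le> 2 * h"
  shows "sqrt (2 * pi / L) * exp (- 1) / h \<le> heat L (h\<^sup>2) y"
proof -
  have "\<bar>y\<bar>\<^sup>2 \<le> (2 * h)\<^sup>2" using assms by (intro power_mono) auto
  hence "y\<^sup>2 \<le> 4 * h\<^sup>2" by (simp add: power_mult_distrib)
  also have "4 * h\<^sup>2 \<le> (2 * L) * h\<^sup>2" using assms by (intro mult_right_mono) auto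
  finally have "y\<^sup>2 / (2 * (L * h\<^sup>2)) \<le> 1" using assms by (simp add: pos_divide_le_eq)
  hence "exp (- 1) \<le> exp (- y\<^sup>2 / (2 * (L * h\<^sup>2)))" by simp
  moreover have "sqrt (2 * pi / (L * h\<^sup>2)) = sqrt (2 * pi / L) / h"
    using assms by (simp add: real_sqrt_divide real_sqrt_mult)
  ultimately show ?thesis using assms by (simp add: mult_left_mono divide_right_mono)
qed

text \<open>The order of the choices is decisive. \<open>\<tau>\<close>, \<open>G\<close> and
  \<open>h\<close> depend only on the energy bounds. Next come finitely many \<open>t m\<close>
  outside \<open>S\<close>, one in each cell of length \<open>h\<close>; as \<open>S\<close> is
  closed, there is one scale \<open>u0\<close> at which all their kernels are negligible. Only then
  are \<open>P\<close> and \<open>Q\<close> taken, with energy constants that do not depend on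
  \<open>u0\<close>.\<close>

lemma bilinear_image_interior:
  fixes I :: "'i set" and X :: "'p \<Rightarrow> 'i \<Rightarrow> real" and Y :: "'q \<Rightarrow> 'i \<Rightarrow> real"
  assumes I: "finite I" and s: "s' \<ge> 0" "real (card I) + 1 < s + s'" and C: "C \<ge> 0" "C' \<ge> 0" and R: "R \<ge> 0"
    and RX: "\<And>p i. p \<in> E \<Longrightarrow> i \<in> I \<Longrightarrow> \<bar>X p i\<bar> \<le> R" and RY: "\<And>q i. q \<in> F \<Longrightarrow> i \<in> I \<Longrightarrow> \<bar>Y q i\<bar> \<le> R"
    and enE: "\<And>u0. u0 > 0 \<Longrightarrow> \<exists>P\<subseteq>E. energy_bounded I X s C u0 P"
    and enF: "\<And>u0. u0 > 0 \<Longrightarrow> \<exists>Q\<subseteq>F. energy_bounded I Y s' C' u0 Q"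
    and S: "S = {\<Sum>i\<in>I. X p i * Y q i | p q. p \<in> E \<and> q \<in> F}" and cl: "closed S"
  shows "interior S \<noteq> {}"
proof
  assume int: "interior S = {}"
  define w where "w p q = (\<Sum>i\<in>I. X p i * Y q i)" for p q
  have wS: "w p q \<in> S" if "p \<in> E" "q \<in> F" for p q using that S by (auto simp: w_def)
  define T0 where "T0 = real (card I) * R\<^sup>2"
  have T0: "T0 \<ge> 0" by (simp add: T0_def)
  define L where "L = 2 + T0"
  have L: "L \<ge> 2" using T0 by (simp add: L_def)
  have L0: "L > 0" using L by simp
  have EL: "2 + (\<Sum>i\<in>I. (X p i)\<^sup>2) \<le> L" if "p \<in> E" for p
  proof -
    have "(\<Sum>i\<in>I. (X p i)\<^sup>2) \<le> (\<Sum>i\<in>I. R\<^sup>2)"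
      using RX[OF that] R by (intro sum_mono abs_le_square_iff[THEN iffD1]) auto
    thus ?thesis by (simp add: L_def T0_def)
  qed
  have wT: "\<bar>w p q\<bar> \<le> T0" if "p \<in> E" "q \<in> F" for p q
  proof -
    have "\<bar>w p q\<bar> \<le> (\<Sum>i\<in>I. \<bar>X p i * Y q i\<bar>)" unfolding w_def by (rule sum_abs)
    also have "\<dots> \<le> (\<Sum>i\<in>I. R * R)"
      unfolding abs_mult using RX[OF that(1)] RY[OF that(2)] R by (intro sum_mono mult_mono) auto
    finally show ?thesis by (simp add: T0_def power2_eq_square)
  qed
  have "\<exists>K>0. \<forall>\<tau> u0 P Q. 0 < u0 \<and> u0 \<le> \<tau>\<^sup>2 \<and> 0 < \<tau> \<and> \<tau> \<le> 1 \<and> P \<subseteq> E \<and> Q \<subseteq> F \<and> energy_bounded I X s C u0 P \<and> energy_bounded I Y s' C' u0 Q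
    \<longrightarrow> real (card {(p, q). p \<in> P \<and> q \<in> Q \<and> \<bar>\<Sum>i\<in>I. X p i * Y q i\<bar> < \<tau>}) \<le> K * sqrt \<tau> * (real (card P) * real (card Q))" (is "\<exists>K>0. ?mass K")
    by (rule mass_near_zero[OF I s(1) less_imp_le[OF s(2)] C EL RY L])
  then obtain K where K: "K > 0" and mass: "?mass K"
    by (elim exE conjE)
  \<comment> \<open>At most half of all pairs then have a dot product below \<open>\<tau>\<close> in
    absolute value.\<close>
  define \<tau> where "\<tau> = min 1 ((1 / (2 * K))\<^sup>2)"
  have \<tau>: "0 < \<tau>" "\<tau> \<le> 1" using K by (auto simp: \<tau>_def)
  have "sqrt \<tau> \<le> sqrt ((1 / (2 * K))\<^sup>2)"
    unfolding \<tau>_def real_sqrt_le_iff by (rule min.cobounded2)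
  hence "sqrt \<tau> \<le> 1 / (2 * K)" using K by simp
  hence K\<tau>: "K * sqrt \<tau> \<le> 1 / 2" using K by (simp add: field_simps)
  define \<delta> where "\<delta> = min ((s + s' - real (card I) - 1) / 4) (1 / 2)"
  have \<delta>: "0 < \<delta>" "\<delta> < 1" "\<delta> \<le> (s + s' - real (card I) - 1) / 4"
    using s unfolding \<delta>_def by (simp, simp, intro min.cobounded1)
  \<comment> \<open>The points \<open>t m\<close> lie within \<open>h \<le> \<tau> / 2\<close> of
    dot products of size at least \<open>\<tau>\<close>, so they are only bounded away from 0 by
    \<open>\<tau> / 2\<close>.\<close>
  have \<tau>h: "0 < \<tau> / 2" "\<tau> / 2 \<le> 1" using \<tau> by auto
  have "\<exists>G>0. \<forall>t u0 a P Q n. \<tau> / 2 \<le> \<bar>t\<bar> \<and> 0 < u0 \<and> u0 \<le> a \<and> a \<le> 1 \<and> P \<subseteq> E \<and> Q \<subseteq> F \<and> energy_bounded I X s C u0 P \<and> energy_bounded I Y s' C' u0 Q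
     \<and> 1 \<le> real n * sqrt u0
    \<longrightarrow> \<bar>smoothed_density I X Y L P Q n t a - smoothed_density I X Y L P Q n t u0\<bar> \<le> G * a powr \<delta>" (is "\<exists>G>0. ?inc G")
    by (rule smoothed_density_increment[OF I s(1) \<delta> C EL RY L R \<tau>h])
  then obtain G where G: "G > 0" and inc: "?inc G"
    by (elim exE conjE)
  define c where "c = sqrt (2 * pi / L) * exp (- 1)"
  have c: "c > 0" using L0 by (simp add: c_def)
  \<comment> \<open>There are at most \<open>(2 * T0 + 3) / h\<close> relevant cells, each with
    density at most \<open>2 * G * \<sigma> powr \<delta>\<close>.\<close>
  define A where "A = (2 * T0 + 3) * (2 * G)"
  have A: "A > 0" using T0 G by (simp add: A_def)
  \<comment> \<open>As \<open>\<sigma> = h\<^sup>2\<close>, this makes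
    \<open>A * \<sigma> powr \<delta> \<le> c / 4\<close>, half of the lower bound that the good
    pairs will give.\<close>
  define h where "h = min (\<tau> / 2) ((c / (4 * A)) powr (1 / (2 * \<delta>)))"
  have h: "0 < h" "h \<le> \<tau> / 2" "h \<le> 1" using \<tau> c A by (auto simp: h_def)
  define \<sigma> where "\<sigma> = h\<^sup>2"
  have "h \<le> \<tau>" using h \<tau> by linarith
  hence \<sigma>: "0 < \<sigma>" "\<sigma> \<le> 1" "\<sigma> \<le> \<tau>\<^sup>2" using h by (auto simp: \<sigma>_def power_le_one power_mono)
  have "\<sigma> powr \<delta> = h powr (2 * \<delta>)"
  proof -
    have "\<sigma> = h powr 2" using h by (simp add: \<sigma>_def powr_numeral)
    thus ?thesis by (simp only: powr_powr)
  qed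
  also have "\<dots> \<le> ((c / (4 * A)) powr (1 / (2 * \<delta>))) powr (2 * \<delta>)"
    using h \<delta> by (intro powr_mono2) (auto simp: h_def)
  also have "\<dots> = c / (4 * A)" using \<delta> c A by (simp add: powr_powr)
  finally have A\<sigma>: "A * \<sigma> powr \<delta> \<le> c / 4" using A by (simp add: field_simps)
  \<comment> \<open>The same number bounds the density at scale \<open>u0\<close> and its change
    between \<open>u0\<close> and \<open>\<sigma>\<close>; hence
    \<open>f m \<le> 2 * \<epsilon>\<close>.\<close>
  define \<epsilon> where "\<epsilon> = G * \<sigma> powr \<delta>"
  have \<epsilon>: "\<epsilon> > 0" using G \<sigma> by (simp add: \<epsilon>_def)
  have "\<exists>t. t \<notin> S \<and> real_of_int m * h < t \<and> t < (real_of_int m + 1) * h" for m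
  proof -
    have "{real_of_int m * h <..< (real_of_int m + 1) * h} \<noteq> {}" using h by (simp add: algebra_simps)
    hence "\<not> {real_of_int m * h <..< (real_of_int m + 1) * h} \<subseteq> S"
      using interior_maximal[of "{real_of_int m * h <..< (real_of_int m + 1) * h}" S] int by auto
    thus ?thesis by auto
  qed
  then obtain t where t: "\<And>m. t m \<notin> S" "\<And>m. real_of_int m * h < t m" "\<And>m. t m < (real_of_int m + 1) * h"
    by metis
  define Mx where "Mx = \<lceil>T0 / h\<rceil>"
  have "0 \<le> T0 / h" using T0 h by simp
  hence Mx0: "Mx \<ge> 0" unfolding Mx_def by linarith
  define Ms where "Ms = {m \<in> {- Mx..Mx}. \<tau> / 2 \<le> \<bar>t m\<bar>}"
  have Ms_sub: "Ms \<subseteq> {- Mx..Mx}" unfolding Ms_def by (rule Collect_subset)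
  have finMs: "finite Ms" by (rule finite_subset[OF Ms_sub]) simp
  have cardMs: "real (card Ms) \<le> (2 * T0 + 3) / h"
  proof -
    have "card Ms \<le> card {- Mx..Mx}" by (rule card_mono[OF _ Ms_sub]) simp
    hence "real (card Ms) \<le> 2 * real_of_int Mx + 1" using Mx0 by simp
    also have "real_of_int Mx \<le> T0 / h + 1" unfolding Mx_def by linarith
    also have "2 * (T0 / h + 1) + 1 \<le> (2 * T0 + 3) / h" using h by (simp add: field_simps)
    finally show ?thesis by simp
  qed
  \<comment> \<open>The argument \<open>y\<close> is allowed to exceed the distance from
    \<open>z\<close> to \<open>t m\<close> because dilations by factors at least 1 only increase
    it.\<close>
  have ex_v: "\<exists>v>0. \<forall>u z y. 0 < u \<longrightarrow> u \<le> v \<longrightarrow> z \<in> S \<longrightarrow> \<bar>z - t m\<bar> \<le> \<bar>y\<bar> \<longrightarrow> heat L u y \<le> \<epsilon>" for m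
  proof -
    obtain d where d: "d > 0" "\<forall>z\<in>S. d \<le> dist (t m) z" using separate_point_closed[OF cl t(1)] by blast
    obtain v where v: "v > 0" "\<forall>u y. 0 < u \<longrightarrow> u \<le> v \<longrightarrow> d \<le> \<bar>y\<bar> \<longrightarrow> heat L u y \<le> \<epsilon>"
      using gaussian_tail_small[OF L0 d(1) \<epsilon>] by blast
    have "d \<le> \<bar>y\<bar>" if "z \<in> S" "\<bar>z - t m\<bar> \<le> \<bar>y\<bar>" for z y
      using d(2) that by (auto simp: dist_real_def)
    thus ?thesis using v by blast
  qed
  hence "\<forall>m. \<exists>v. v > 0 \<and> (\<forall>u z y. 0 < u \<longrightarrow> u \<le> v \<longrightarrow> z \<in> S \<longrightarrow> \<bar>z - t m\<bar> \<le> \<bar>y\<bar> \<longrightarrow>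
      heat L u y \<le> \<epsilon>)" by blast
  from choice[OF this] obtain v where vv: "\<forall>m. v m > 0 \<and> (\<forall>u z y. 0 < u \<longrightarrow> u \<le> v m \<longrightarrow> z \<in> S \<longrightarrow> \<bar>z - t m\<bar> \<le> \<bar>y\<bar> \<longrightarrow>
      heat L u y \<le> \<epsilon>)" by (elim exE)
  have v0: "v m > 0" for m using vv by blast
  have v: "heat L u y \<le> \<epsilon>"
    if "0 < u" "u \<le> v m" "z \<in> S" "\<bar>z - t m\<bar> \<le> \<bar>y\<bar>" for m u z y using vv that by blast
  define u0 where "u0 = Min (insert \<sigma> (v ` Ms))"
  have u0: "u0 > 0" "u0 \<le> \<sigma>" "\<And>m. m \<in> Ms \<Longrightarrow> u0 \<le> v m"
    using finMs \<sigma> v0 by (auto simp: u0_def)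
  obtain P where P: "P \<subseteq> E" "energy_bounded I X s C u0 P" using enE[OF u0(1)] by blast
  obtain Q where Q: "Q \<subseteq> F" "energy_bounded I Y s' C' u0 Q" using enF[OF u0(1)] by blast
  have fin: "finite P" "P \<noteq> {}" "finite Q" "Q \<noteq> {}" using P Q by (auto simp: energy_bounded_def)
  obtain n :: nat where "1 / sqrt u0 \<le> real n" using real_arch_simple by blast
  hence n: "1 \<le> real n * sqrt u0" using u0 by (simp add: field_simps)
  have n0: "n > 0" using n by (intro gr0I) auto
  define f where "f m = smoothed_density I X Y L P Q n (t m) \<sigma>" for m
  have f_le: "f m \<le> 2 * \<epsilon>" if m: "m \<in> Ms" for m
  proof -
    have "smoothed_density I X Y L P Q n (t m) u0 \<le> \<epsilon>"
    proof (rule smoothed_density_le[OF fin(1,3,2,4) n0])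
      fix p q i assume pq: "p \<in> P" "q \<in> Q" "i < n"
      have "1 * \<bar>w p q - t m\<bar> \<le> dil n i * \<bar>w p q - t m\<bar>" using dil_bounds(1) by (intro mult_right_mono) auto
      also have "\<dots> = \<bar>dil n i * (w p q - t m)\<bar>" using dil_bounds(1)[of n i] by (simp add: abs_mult)
      finally show "heat L u0 (dil n i * ((\<Sum>j\<in>I. X p j * Y q j) - t m)) \<le> \<epsilon>"
        using u0 m pq P Q by (intro v[OF _ _ wS[of p q]]) (auto simp: w_def)
    qed
    moreover have "\<bar>smoothed_density I X Y L P Q n (t m) \<sigma> - smoothed_density I X Y L P Q n (t m) u0\<bar> \<le> \<epsilon>"
      unfolding \<epsilon>_def using m u0 \<sigma> P Q n by (intro inc[rule_format]) (auto simp: Ms_def)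
    ultimately show ?thesis unfolding f_def by linarith
  qed
  define k where "k m p q = (\<Sum>i<n. heat L \<sigma> (dil n i * (w p q - t m)))" for m p q
  have k0: "k m p q \<ge> 0" for m p q using L0 \<sigma> by (auto simp: k_def intro!: sum_nonneg)
  define den where "den = real (card P) * (real (card Q) * real n)"
  have den: "den > 0" using fin n0 by (simp add: den_def card_gt_0_iff)
  have f_eq: "f m * den = (\<Sum>x\<in>P \<times> Q. k m (fst x) (snd x))" for m
  proof -
    have "f m = (\<Sum>p\<in>P. \<Sum>q\<in>Q. k m p q) / den"
      by (simp only: f_def smoothed_density_def k_def w_def den_def)
    hence "f m * den = (\<Sum>p\<in>P. \<Sum>q\<in>Q. k m p q)" using den by (simp add: nonzero_eq_divide_eq)
    thus ?thesis by (simp only: sum_Times fst_conv snd_conv)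
  qed
  define good where "good = {x \<in> P \<times> Q. \<tau> \<le> \<bar>w (fst x) (snd x)\<bar>}"
  have good_card: "real (card P) * real (card Q) \<le> 2 * real (card good)"
  proof -
    define bad where "bad = {(p, q). p \<in> P \<and> q \<in> Q \<and> \<bar>\<Sum>i\<in>I. X p i * Y q i\<bar> < \<tau>}"
    have "real (card bad) \<le> K * sqrt \<tau> * (real (card P) * real (card Q))"
      unfolding bad_def using u0 \<sigma> \<tau> P Q by (intro mass[rule_format]) auto
    also have "\<dots> \<le> 1 / 2 * (real (card P) * real (card Q))" using K\<tau> by (intro mult_right_mono) auto
    finally have "real (card bad) \<le> real (card P) * real (card Q) / 2" by simp
    moreover have "P \<times> Q \<subseteq> good \<union> bad" by (auto simp: good_def bad_def w_def)
    then have "card (P \<times> Q) \<le> card good + card bad"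
    proof -
      assume sub: "P \<times> Q \<subseteq> good \<union> bad"
      have "finite good" "finite bad"
        by (rule finite_subset[of _ "P \<times> Q"]; use fin in \<open>auto simp: good_def bad_def\<close>)+
      hence "card (P \<times> Q) \<le> card (good \<union> bad)" using sub by (intro card_mono) auto
      thus ?thesis using card_Un_le[of good bad] by linarith
    qed
    hence "real (card P) * real (card Q) \<le> real (card good) + real (card bad)"
      by (simp add: card_cartesian_product flip: of_nat_mult of_nat_add)
    ultimately show ?thesis by linarith
  qed
  have lower: "real n * (c / h) \<le> (\<Sum>m\<in>Ms. k m (fst x) (snd x))" if x: "x \<in> good" for x
  proof -
    define z where "z = w (fst x) (snd x)"
    \<comment> \<open>The index of the cell that contains both \<open>z\<close> and
      \<open>t m\<close>.\<close>
    define m where "m = \<lfloor>z / h\<rfloor>"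
    have xPQ: "fst x \<in> E" "snd x \<in> F" using x P Q by (auto simp: good_def)
    have z: "\<tau> \<le> \<bar>z\<bar>" "\<bar>z\<bar> \<le> T0" using x wT[OF xPQ] by (auto simp: good_def z_def)
    have mz: "real_of_int m * h \<le> z" "z < (real_of_int m + 1) * h"
      unfolding m_def using h by (intro floor_divide_lower floor_divide_upper; simp)+
    have zt: "\<bar>z - t m\<bar> \<le> h" using mz t(2,3)[of m] unfolding distrib_right by linarith
    have "m \<in> Ms"
    proof -
      have "\<tau> / 2 \<le> \<bar>t m\<bar>" using zt z h by linarith
      moreover have "z / h \<le> T0 / h" "- (T0 / h) \<le> z / h"
        using z h divide_right_mono[of z T0 h] divide_right_mono[of "- T0" z h] by auto
      hence "m \<le> Mx" "- Mx \<le> m" unfolding m_def Mx_def by linarith+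
      ultimately show ?thesis by (simp add: Ms_def)
    qed
    have "real n * (c / h) = (\<Sum>i<n. c / h)" by simp
    also have "\<dots> \<le> k m (fst x) (snd x)"
      unfolding k_def
    proof (intro sum_mono)
      fix i assume i: "i \<in> {..<n}"
      have "\<bar>dil n i * (z - t m)\<bar> \<le> 2 * h"
        unfolding abs_mult using zt dil_bounds[of n i] dil_bounds(2)[of i n] i h by (intro mult_mono) auto
      thus "c / h \<le> heat L \<sigma> (dil n i * (w (fst x) (snd x) - t m))"
        using gaussian_lower_bound[OF L h(1)] by (simp add: c_def \<sigma>_def z_def)
    qed
    also have "\<dots> \<le> (\<Sum>m\<in>Ms. k m (fst x) (snd x))"
      using \<open>m \<in> Ms\<close> finMs k0 by (intro member_le_sum) auto
    finally show ?thesis .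
  qed
  \<comment> \<open>Two estimates of the sum of \<open>f m * den\<close> over \<open>Ms\<close>: the
    good pairs force at least \<open>den / 2 * (c / h)\<close>, but the smallness of each
    \<open>f m\<close> permits at most half of that.\<close>
  have "den / 2 * (c / h) \<le> real (card good) * (real n * (c / h))"
  proof -
    have "den / 2 \<le> real (card good) * real n"
      using mult_right_mono[OF good_card, of "real n"] by (simp add: den_def mult_ac)
    hence "den / 2 * (c / h) \<le> real (card good) * real n * (c / h)" using c h by (intro mult_right_mono) auto
    thus ?thesis by (simp add: mult_ac)
  qed
  also have "\<dots> = (\<Sum>x\<in>good. real n * (c / h))" by simp
  also have "\<dots> \<le> (\<Sum>x\<in>good. \<Sum>m\<in>Ms. k m (fst x) (snd x))" by (intro sum_mono lower)
  also have "\<dots> \<le> (\<Sum>x\<in>P \<times> Q. \<Sum>m\<in>Ms. k m (fst x) (snd x))"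
    using fin k0 by (intro sum_mono2) (auto simp: good_def intro!: sum_nonneg)
  also have "\<dots> = (\<Sum>m\<in>Ms. f m * den)" unfolding f_eq by (rule sum.swap)
  also have "\<dots> \<le> (\<Sum>m\<in>Ms. 2 * \<epsilon> * den)" using f_le den by (intro sum_mono mult_right_mono) auto
  also have "\<dots> = real (card Ms) * (2 * \<epsilon> * den)" by simp
  also have "\<dots> \<le> (2 * T0 + 3) / h * (2 * \<epsilon> * den)"
    using cardMs \<epsilon> den by (intro mult_right_mono) auto
  also have "\<dots> = A * \<sigma> powr \<delta> * (den / h)" by (simp add: A_def \<epsilon>_def)
  also have "\<dots> \<le> c / 4 * (den / h)" using A\<sigma> den h by (intro mult_right_mono) auto
  finally have "c / 2 * (den / h) \<le> c / 4 * (den / h)" by (simp add: mult.commute)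
  moreover have "c / 4 * (den / h) < c / 2 * (den / h)" using c den h by (intro mult_strict_right_mono) auto
  ultimately show False by linarith
qed

section \<open>Products of energies and bilinear forms\<close>

lemma compact_PiE_UNIV:
  fixes S :: "'i \<Rightarrow> 'a::topological_space set"
  assumes "\<And>i. compact (S i)"
  shows "compact (PiE UNIV S)"
proof -
  have "compactin (product_topology (\<lambda>_. euclidean) UNIV) (PiE UNIV S)"
    using assms by (simp add: compactin_PiE)
  thus ?thesis by (simp add: euclidean_product_topology)
qed

lemma double_sum_PiE_prod:
  fixes f :: "'j \<Rightarrow> 'a \<Rightarrow> 'a \<Rightarrow> real"
  assumes "finite J" "\<And>j. j \<in> J \<Longrightarrow> finite (P j)"
  shows "(\<Sum>p\<in>PiE J P. \<Sum>q\<in>PiE J P. \<Prod>j\<in>J. f j (p j) (q j)) = (\<Prod>j\<in>J. \<Sum>a\<in>P j. \<Sum>b\<in>P j. f j a b)"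
proof -
  have "(\<Prod>j\<in>J. \<Sum>a\<in>P j. \<Sum>b\<in>P j. f j a b) = (\<Sum>p\<in>PiE J P. \<Prod>j\<in>J. \<Sum>b\<in>P j. f j (p j) b)"
    by (rule prod_sum_PiE[OF assms])
  also have "\<dots> = (\<Sum>p\<in>PiE J P. \<Sum>q\<in>PiE J P. \<Prod>j\<in>J. f j (p j) (q j))"
    by (intro sum.cong refl prod_sum_PiE assms)
  finally show ?thesis ..
qed

text \<open>Energy exponents add under products: the total squared distance dominates that of every
  factor, so each \<open>powr (- s j / 2)\<close> may be evaluated at its own factor, and the double
  sum splits.\<close>

lemma energy_bounded_product:
  fixes V :: "'j \<Rightarrow> 'a \<Rightarrow> nat \<Rightarrow> real"
  assumes J: "finite J" and s: "\<And>j. j \<in> J \<Longrightarrow> 0 \<le> s j" and u0: "u0 > 0"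
    and e: "\<And>j. j \<in> J \<Longrightarrow> energy_bounded {..<n j} (V j) (s j) (C j) u0 (P j)"
  shows "energy_bounded (Sigma J (\<lambda>j. {..<n j})) (\<lambda>p x. V (fst x) (p (fst x)) (snd x)) (\<Sum>j\<in>J. s j) (\<Prod>j\<in>J. C j) u0 (PiE J P)"
  unfolding energy_bounded_def
proof (intro conjI allI impI)
  let ?d = "\<lambda>p q. \<Sum>x\<in>Sigma J (\<lambda>j. {..<n j}). (V (fst x) (p (fst x)) (snd x) - V (fst x) (q (fst x)) (snd x))\<^sup>2"
  have fin: "finite (P j)" "P j \<noteq> {}" if "j \<in> J" for j using e[OF that] by (auto simp: energy_bounded_def)
  show "finite (PiE J P)" using J fin by (intro finite_PiE) auto
  show "PiE J P \<noteq> {}" using fin by (simp add: PiE_eq_empty_iff)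
  fix u assume u: "u0 \<le> u"
  define D where "D j a b = (\<Sum>i<n j. (V j a i - V j b i)\<^sup>2)" for j a b
  have D0: "D j a b \<ge> 0" for j a b by (auto simp: D_def intro: sum_nonneg)
  have "(\<Sum>p\<in>PiE J P. \<Sum>q\<in>PiE J P. (u + ?d p q) powr (- (\<Sum>j\<in>J. s j) / 2))
    \<le> (\<Sum>p\<in>PiE J P. \<Sum>q\<in>PiE J P. \<Prod>j\<in>J. (u + D j (p j) (q j)) powr (- s j / 2))"
  proof (intro sum_mono)
    fix p q
    have sig: "?d p q = (\<Sum>j\<in>J. D j (p j) (q j))"
      unfolding D_def by (subst sum.Sigma) (use J in \<open>auto simp: split_def\<close>)
    define w where "w = u + (\<Sum>j\<in>J. D j (p j) (q j))"
    have w: "w > 0" using u u0 D0 by (auto simp: w_def intro!: add_pos_nonneg sum_nonneg)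
    have "- (\<Sum>j\<in>J. s j) / 2 = (\<Sum>j\<in>J. - s j / 2)" by (simp add: sum_divide_distrib sum_negf)
    hence "w powr (- (\<Sum>j\<in>J. s j) / 2) = (\<Prod>j\<in>J. w powr (- s j / 2))"
      using w powr_sum[of w "\<lambda>j. - s j / 2" J] by simp
    also have "\<dots> \<le> (\<Prod>j\<in>J. (u + D j (p j) (q j)) powr (- s j / 2))"
    proof (intro prod_mono conjI powr_mono2')
      fix j assume j: "j \<in> J"
      show "- s j / 2 \<le> 0" using s[OF j] by simp
      show "0 < u + D j (p j) (q j)" using u u0 D0[of j "p j" "q j"] by linarith
      show "u + D j (p j) (q j) \<le> w" unfolding w_def using j J D0 by (intro add_left_mono member_le_sum) auto
    qed simp
    finally show "(u + ?d p q) powr (- (\<Sum>j\<in>J. s j) / 2)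
      \<le> (\<Prod>j\<in>J. (u + D j (p j) (q j)) powr (- s j / 2))"
      by (simp only: sig w_def)
  qed
  also have "\<dots> = (\<Prod>j\<in>J. \<Sum>a\<in>P j. \<Sum>b\<in>P j. (u + D j a b) powr (- s j / 2))"
    by (rule double_sum_PiE_prod[OF J fin(1)])
  also have "\<dots> \<le> (\<Prod>j\<in>J. C j * (real (card (P j)))\<^sup>2)"
    using e u by (intro prod_mono conjI sum_nonneg) (auto simp: energy_bounded_def D_def)
  also have "\<dots> = (\<Prod>j\<in>J. C j) * (real (card (PiE J P)))\<^sup>2"
    by (simp add: prod.distrib card_PiE[OF J] prod_power_distrib)
  finally show "(\<Sum>p\<in>PiE J P. \<Sum>q\<in>PiE J P. (u + ?d p q) powr (- (\<Sum>j\<in>J. s j) / 2))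
    \<le> (\<Prod>j\<in>J. C j) * (real (card (PiE J P)))\<^sup>2" .
qed

text \<open>A map that contracts distances by at most a constant changes Riesz energies by at most a
  constant; \<open>b = min 1 c\<close> makes
  \<open>b * (u + d\<^sup>2) \<le> u + c * d\<^sup>2\<close>.\<close>

lemma energy_bounded_of_expanding:
  fixes V :: "(nat \<Rightarrow> real) \<Rightarrow> nat \<Rightarrow> real"
  assumes E: "compact E" "E \<subseteq> Rn n" "E \<noteq> {}" and s: "0 \<le> s" "s = 0 \<or> s < hausdorff_dim n E"
    and c: "c > 0" "\<And>x y. x \<in> E \<Longrightarrow> y \<in> E \<Longrightarrow> c * (edist n x y)\<^sup>2 \<le> (\<Sum>i<n. (V x i - V y i)\<^sup>2)"
  shows "\<exists>C>0. \<forall>u0>0. \<exists>P\<subseteq>E. energy_bounded {..<n} V s C u0 P"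
proof -
  obtain C where C: "C > 0" and en: "\<And>u0. u0 > 0 \<Longrightarrow> \<exists>P. finite P \<and> P \<noteq> {} \<and> P \<subseteq> E \<and>
     (\<forall>u\<ge>u0. (\<Sum>p\<in>P. \<Sum>p'\<in>P. (u + (edist n p p')\<^sup>2) powr (- s / 2)) \<le> C * (real (card P))\<^sup>2)"
    using finite_energy[OF E s] by blast
  define b where "b = min 1 c"
  have b: "b > 0" "b \<le> 1" "b \<le> c" using c by (auto simp: b_def)
  show ?thesis
  proof (intro exI[of _ "b powr (- s / 2) * C"] conjI allI impI)
    show "b powr (- s / 2) * C > 0" using b C by simp
    fix u0 :: real assume u0: "u0 > 0"
    obtain P where P: "finite P" "P \<noteq> {}" "P \<subseteq> E" and
      le: "\<forall>u\<ge>u0. (\<Sum>p\<in>P. \<Sum>p'\<in>P. (u + (edist n p p')\<^sup>2) powr (- s / 2)) \<le> C * (real (card P))\<^sup>2"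
      using en[OF u0] by blast
    have "energy_bounded {..<n} V s (b powr (- s / 2) * C) u0 P"
      unfolding energy_bounded_def
    proof (intro conjI P allI impI)
      fix u assume u: "u0 \<le> u"
      have "(\<Sum>p\<in>P. \<Sum>p'\<in>P. (u + (\<Sum>i<n. (V p i - V p' i)\<^sup>2)) powr (- s / 2))
        \<le> (\<Sum>p\<in>P. \<Sum>p'\<in>P. b powr (- s / 2) * (u + (edist n p p')\<^sup>2) powr (- s / 2))"
      proof (intro sum_mono)
        fix p p' assume pp: "p \<in> P" "p' \<in> P"
        have "b * (u + (edist n p p')\<^sup>2) \<le> 1 * u + c * (edist n p p')\<^sup>2"
          unfolding distrib_left using b u u0 by (intro add_mono mult_right_mono) auto
        also have "\<dots> \<le> u + (\<Sum>i<n. (V p i - V p' i)\<^sup>2)" using c(2) pp P by auto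
        finally have "(u + (\<Sum>i<n. (V p i - V p' i)\<^sup>2)) powr (- s / 2) \<le> (b * (u + (edist n p p')\<^sup>2)) powr (- s / 2)"
          using b u u0 s by (intro powr_mono2') (auto intro!: mult_pos_pos add_pos_nonneg)
        also have "\<dots> = b powr (- s / 2) * (u + (edist n p p')\<^sup>2) powr (- s / 2)"
          by (rule powr_mult)
        finally show "(u + (\<Sum>i<n. (V p i - V p' i)\<^sup>2)) powr (- s / 2) \<le> b powr (- s / 2) * (u + (edist n p p')\<^sup>2) powr (- s / 2)" .
      qed
      also have "\<dots> = b powr (- s / 2) * (\<Sum>p\<in>P. \<Sum>p'\<in>P. (u + (edist n p p')\<^sup>2) powr (- s / 2))"
        by (simp only: sum_distrib_left)
      also have "\<dots> \<le> b powr (- s / 2) * (C * (real (card P))\<^sup>2)"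
        using le u by (intro mult_left_mono) auto
      finally show "(\<Sum>p\<in>P. \<Sum>p'\<in>P. (u + (\<Sum>i<n. (V p i - V p' i)\<^sup>2)) powr (- s / 2)) \<le> b powr (- s / 2) * C * (real (card P))\<^sup>2"
        by (simp only: mult.assoc)
    qed
    thus "\<exists>P\<subseteq>E. energy_bounded {..<n} V s (b powr (- s / 2) * C) u0 P" using P by blast
  qed
qed

section \<open>Nondegenerate forms in coordinates\<close>

definition unit_vec :: "nat \<Rightarrow> nat \<Rightarrow> real" where
  "unit_vec i = (\<lambda>k. if k = i then 1 else 0)"

lemma unit_vec_Rn: "i < n \<Longrightarrow> unit_vec i \<in> Rn n"
  by (auto simp: unit_vec_def Rn_def)

lemma bilinear_expand:
  assumes Q: "nondeg_sym_bilinear n Q" and x: "x \<in> Rn n" and y: "y \<in> Rn n"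
  shows "Q x y = (\<Sum>i<n. x i * Q (unit_vec i) y)"
proof -
  have lin: "Q (\<lambda>i. a * v i + b * w i) y = a * Q v y + b * Q w y" if "v \<in> Rn n" "w \<in> Rn n" for a b v w
    using Q that y unfolding nondeg_sym_bilinear_def by blast
  have z: "(\<lambda>_. 0) \<in> Rn n" by (simp add: Rn_def)
  \<comment> \<open>Induction on truncations of \<open>x\<close>, each of which adds one multiple of
    a unit vector.\<close>
  have "Q (\<lambda>i. if i < m then x i else 0) y = (\<Sum>i<m. x i * Q (unit_vec i) y)" if "m \<le> n" for m
    using that
  proof (induction m)
    case 0
    show ?case using lin[OF z z, of 0 0] by simp
  next
    case (Suc m)
    have "(\<lambda>i. if i < m then x i else 0) \<in> Rn n" using x by (auto simp: Rn_def)
    moreover have "(\<lambda>i. if i < Suc m then x i else 0) = (\<lambda>i. 1 * (if i < m then x i else 0) + x m * unit_vec m i)"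
      by (auto simp: unit_vec_def fun_eq_iff less_Suc_eq)
    ultimately show ?case
      using lin[of "\<lambda>i. if i < m then x i else 0" "unit_vec m" 1 "x m"] Suc unit_vec_Rn[of m n] by simp
  qed
  from this[of n] have "Q (\<lambda>i. if i < n then x i else 0) y = (\<Sum>i<n. x i * Q (unit_vec i) y)" by simp
  moreover have "(\<lambda>i. if i < n then x i else 0) = x" using x by (auto simp: Rn_def fun_eq_iff)
  ultimately show ?thesis by simp
qed

lemma bilinear_expand_right:
  assumes Q: "nondeg_sym_bilinear n Q" and x: "x \<in> Rn n" and y: "y \<in> Rn n"
  shows "Q x y = (\<Sum>k<n. y k * Q x (unit_vec k))"
proof -
  have sym: "Q v w = Q w v" if "v \<in> Rn n" "w \<in> Rn n" for v w
    using Q that unfolding nondeg_sym_bilinear_def by blast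
  have "Q x y = Q y x" by (rule sym[OF x y])
  also have "\<dots> = (\<Sum>k<n. y k * Q (unit_vec k) x)" by (rule bilinear_expand[OF Q y x])
  also have "\<dots> = (\<Sum>k<n. y k * Q x (unit_vec k))"
    using sym x by (intro sum.cong refl) (simp add: unit_vec_Rn)
  finally show ?thesis .
qed

text \<open>In the product topology the sphere is a closed part of a product of intervals, with the
  factor \<open>{0}\<close> at all indices from \<open>n\<close> on.\<close>

lemma compact_unit_sphere_Rn: "compact {x \<in> Rn n. (\<Sum>i<n. (x i)\<^sup>2) = 1}" (is "compact ?S")
proof -
  let ?B = "PiE UNIV (\<lambda>i. if i < n then {-1..1} else {0}) :: (nat \<Rightarrow> real) set"
  have "?S = ?B \<inter> {x. (\<Sum>i<n. (x i)\<^sup>2) = 1}"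
  proof (intro set_eqI iffI)
    fix x assume x: "x \<in> ?S"
    have "\<bar>x i\<bar> \<le> 1" if "i < n" for i
    proof -
      have "(x i)\<^sup>2 \<le> (\<Sum>i<n. (x i)\<^sup>2)" using that by (intro member_le_sum) auto
      hence "(x i)\<^sup>2 \<le> 1\<^sup>2" using x by simp
      thus ?thesis by (simp add: abs_square_le_1)
    qed
    thus "x \<in> ?B \<inter> {x. (\<Sum>i<n. (x i)\<^sup>2) = 1}" using x by (auto simp: PiE_iff Rn_def abs_le_iff)
  next
    fix x assume x: "x \<in> ?B \<inter> {x. (\<Sum>i<n. (x i)\<^sup>2) = 1}"
    hence "x \<in> ?B" by blast
    from PiE_mem[OF this] have "x i \<in> (if i < n then {-1..1} else {0})" for i by blast
    hence "x i = 0" if "i \<ge> n" for i using that by (metis linorder_not_le singletonD)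
    thus "x \<in> ?S" using x by (auto simp: Rn_def)
  qed
  moreover have "compact ?B" by (intro compact_PiE_UNIV) auto
  moreover have "closed {x::nat \<Rightarrow> real. (\<Sum>i<n. (x i)\<^sup>2) = 1}"
    by (intro closed_Collect_eq continuous_intros continuous_on_coordinatewise_then_product) simp_all
  ultimately show ?thesis by (simp add: compact_Int_closed)
qed

text \<open>The squared norm of the vector of all \<open>Q (unit_vec i) x\<close> attains its
  minimum on the unit sphere. Nondegeneracy makes this minimum positive, and homogeneity transfers
  it to all differences \<open>x - y\<close>.\<close>

lemma nondeg_bilinear_expanding:
  assumes Q: "nondeg_sym_bilinear n Q" and n: "n \<ge> 1"
  shows "\<exists>c>0. \<forall>x\<in>Rn n. \<forall>y\<in>Rn n. c * (edist n x y)\<^sup>2 \<le> (\<Sum>i<n. (Q (unit_vec i) x - Q (unit_vec i) y)\<^sup>2)"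
proof -
  \<comment> \<open>Written through coordinates, \<open>g\<close> is continuous on the whole
    function space, whereas \<open>Q\<close> is controlled only on \<open>Rn n\<close>.\<close>
  define g where "g x = (\<Sum>i<n. (\<Sum>k<n. x k * Q (unit_vec i) (unit_vec k))\<^sup>2)" for x :: "nat \<Rightarrow> real"
  have gQ: "g x = (\<Sum>i<n. (Q (unit_vec i) x)\<^sup>2)" if "x \<in> Rn n" for x
    unfolding g_def using that by (intro sum.cong refl) (simp add: bilinear_expand_right[OF Q, symmetric] unit_vec_Rn)
  let ?K = "{x \<in> Rn n. (\<Sum>i<n. (x i)\<^sup>2) = 1}"
  have "continuous_on ?K g"
    unfolding g_def by (rule continuous_on_subset[of UNIV]) (auto intro!: continuous_intros)
  moreover have "?K \<noteq> {}"
  proof -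
    have "(\<Sum>i<n. (unit_vec 0 i)\<^sup>2) = (\<Sum>i<n. if i = 0 then 1 else 0)" by (intro sum.cong) (auto simp: unit_vec_def)
    hence "unit_vec 0 \<in> ?K" using n unit_vec_Rn[of 0 n] by simp
    thus ?thesis by blast
  qed
  ultimately obtain x0 where x0: "x0 \<in> ?K" "\<And>x. x \<in> ?K \<Longrightarrow> g x0 \<le> g x"
    using continuous_attains_inf[OF compact_unit_sphere_Rn, of n g] by blast
  have "g x0 \<noteq> 0"
  proof
    assume "g x0 = 0"
    hence "(\<Sum>i<n. (Q (unit_vec i) x0)\<^sup>2) = 0" using gQ x0 by auto
    hence z: "Q (unit_vec i) x0 = 0" if "i < n" for i
      using that by (subst (asm) sum_nonneg_eq_0_iff) auto
    have "Q x0 y = 0" if y: "y \<in> Rn n" for y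
    proof -
      have "Q x0 y = Q y x0" using Q x0 y unfolding nondeg_sym_bilinear_def by blast
      also have "\<dots> = (\<Sum>i<n. y i * Q (unit_vec i) x0)" using x0 y by (intro bilinear_expand[OF Q]) auto
      finally show ?thesis using z by simp
    qed
    hence "x0 = (\<lambda>_. 0)" using Q x0 unfolding nondeg_sym_bilinear_def by blast
    thus False using x0 by simp
  qed
  moreover have "g x0 \<ge> 0" unfolding g_def by (intro sum_nonneg) auto
  ultimately have pos: "g x0 > 0" by simp
  show ?thesis
  proof (intro exI[of _ "g x0"] conjI pos ballI)
    fix x y assume xy: "x \<in> Rn n" "y \<in> Rn n"
    define v where "v i = x i - y i" for i
    define r where "r = edist n x y"
    have v: "v \<in> Rn n" using xy by (auto simp: v_def Rn_def)
    have r2: "r\<^sup>2 = (\<Sum>i<n. (v i)\<^sup>2)" by (simp add: r_def edist_def v_def sum_nonneg)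
    have Qv: "Q (unit_vec i) x - Q (unit_vec i) y = Q (unit_vec i) v" if "i < n" for i
      using bilinear_expand_right[OF Q unit_vec_Rn[OF that]] xy v
      by (simp add: v_def left_diff_distrib sum_subtractf)
    have "g x0 * r\<^sup>2 \<le> g v"
    proof (cases "r = 0")
      case True
      thus ?thesis by (simp add: g_def sum_nonneg)
    next
      case False
      define w where "w i = v i / r" for i
      have "w \<in> Rn n" using v by (auto simp: w_def Rn_def)
      moreover have "(\<Sum>i<n. (w i)\<^sup>2) = 1"
        using False by (simp add: w_def power_divide sum_divide_distrib[symmetric] r2[symmetric])
      ultimately have "g x0 \<le> g w" using x0 by auto
      also have "g w = g v / r\<^sup>2"
        by (simp add: g_def w_def sum_divide_distrib[symmetric] power_divide)
      finally show ?thesis using False by (simp add: pos_le_divide_eq)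
    qed
    thus "g x0 * (edist n x y)\<^sup>2 \<le> (\<Sum>i<n. (Q (unit_vec i) x - Q (unit_vec i) y)\<^sup>2)"
      using Qv gQ[OF v] by (simp add: r_def)
  qed
qed

text \<open>The constants of the factors are fixed first; the point sets are chosen separately for
  each \<open>u0\<close>.\<close>

lemma product_family_energy:
  fixes V :: "'j \<Rightarrow> (nat \<Rightarrow> real) \<Rightarrow> nat \<Rightarrow> real" and A :: "'j \<Rightarrow> (nat \<Rightarrow> real) set"
  assumes J: "finite J" and A: "\<And>j. j \<in> J \<Longrightarrow> compact (A j) \<and> A j \<subseteq> Rn (n j) \<and> A j \<noteq> {}"
    and s: "\<And>j. j \<in> J \<Longrightarrow> 0 \<le> s j \<and> (s j = 0 \<or> s j < hausdorff_dim (n j) (A j))"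
    and V: "\<And>j. j \<in> J \<Longrightarrow> \<exists>c>0. \<forall>x\<in>Rn (n j). \<forall>y\<in>Rn (n j). c * (edist (n j) x y)\<^sup>2 \<le> (\<Sum>i<n j. (V j x i - V j y i)\<^sup>2)"
  shows "\<exists>C\<ge>0. \<forall>u0>0. \<exists>P\<subseteq>PiE J A. energy_bounded (Sigma J (\<lambda>j. {..<n j})) (\<lambda>p x. V (fst x) (p (fst x)) (snd x)) (\<Sum>j\<in>J. s j) C u0 P"
proof -
  have "\<forall>j\<in>J. \<exists>C>0. \<forall>u0>0. \<exists>P\<subseteq>A j. energy_bounded {..<n j} (V j) (s j) C u0 P"
  proof
    fix j assume j: "j \<in> J"
    obtain c where c: "c > 0" "\<forall>x\<in>Rn (n j). \<forall>y\<in>Rn (n j). c * (edist (n j) x y)\<^sup>2 \<le> (\<Sum>i<n j. (V j x i - V j y i)\<^sup>2)"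
      using V[OF j] by blast
    show "\<exists>C>0. \<forall>u0>0. \<exists>P\<subseteq>A j. energy_bounded {..<n j} (V j) (s j) C u0 P"
    proof (rule energy_bounded_of_expanding)
      show "c * (edist (n j) x y)\<^sup>2 \<le> (\<Sum>i<n j. (V j x i - V j y i)\<^sup>2)" if "x \<in> A j" "y \<in> A j" for x y
        using c(2) that A[OF j] by blast
    qed (use A[OF j] s[OF j] c in auto)
  qed
  from bchoice[OF this] obtain C where C: "\<forall>j\<in>J. C j > 0 \<and> (\<forall>u0>0. \<exists>P\<subseteq>A j. energy_bounded {..<n j} (V j) (s j) (C j) u0 P)"
    by blast
  show ?thesis
  proof (intro exI[of _ "\<Prod>j\<in>J. C j"] conjI allI impI)
    show "0 \<le> (\<Prod>j\<in>J. C j)" using C by (intro prod_nonneg) (auto simp: less_imp_le)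
    fix u0 :: real assume u0: "u0 > 0"
    hence "\<forall>j\<in>J. \<exists>P. P \<subseteq> A j \<and> energy_bounded {..<n j} (V j) (s j) (C j) u0 P" using C by blast
    from bchoice[OF this] obtain P where P: "\<forall>j\<in>J. P j \<subseteq> A j \<and> energy_bounded {..<n j} (V j) (s j) (C j) u0 (P j)" by blast
    show "\<exists>P\<subseteq>PiE J A. energy_bounded (Sigma J (\<lambda>j. {..<n j})) (\<lambda>p x. V (fst x) (p (fst x)) (snd x)) (\<Sum>j\<in>J. s j) (\<Prod>j\<in>J. C j) u0 P"
    proof (intro exI[of _ "PiE J P"] conjI)
      show "PiE J P \<subseteq> PiE J A" using P by (intro PiE_mono) blast
      show "energy_bounded (Sigma J (\<lambda>j. {..<n j})) (\<lambda>p x. V (fst x) (p (fst x)) (snd x)) (\<Sum>j\<in>J. s j) (\<Prod>j\<in>J. C j) u0 (PiE J P)"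
        using P s by (intro energy_bounded_product J u0) auto
    qed
  qed
qed

section \<open>Compactness of the image and reduction to a dot product\<close>

lemma finite_family_bounded:
  fixes g :: "'x \<Rightarrow> 'a::topological_space \<Rightarrow> real"
  assumes "finite I" "\<And>x. x \<in> I \<Longrightarrow> compact (A x)" "\<And>x. x \<in> I \<Longrightarrow> continuous_on (A x) (g x)"
  shows "\<exists>R\<ge>0. \<forall>x\<in>I. \<forall>y\<in>A x. \<bar>g x y\<bar> \<le> R"
proof -
  have "\<forall>x\<in>I. \<exists>r. \<forall>y\<in>A x. \<bar>g x y\<bar> \<le> r"
  proof
    fix x assume x: "x \<in> I"
    have "bounded (g x ` A x)" using assms x by (intro compact_imp_bounded compact_continuous_image) auto
    thus "\<exists>r. \<forall>y\<in>A x. \<bar>g x y\<bar> \<le> r" by (auto simp: bounded_iff)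
  qed
  from bchoice[OF this] obtain r where r: "\<forall>x\<in>I. \<forall>y\<in>A x. \<bar>g x y\<bar> \<le> r x" by blast
  show ?thesis
  proof (intro exI[of _ "\<Sum>x\<in>I. \<bar>r x\<bar>"] conjI ballI)
    show "0 \<le> (\<Sum>x\<in>I. \<bar>r x\<bar>)" by (intro sum_nonneg) auto
    fix x y assume xy: "x \<in> I" "y \<in> A x"
    have "\<bar>r x\<bar> \<le> (\<Sum>x\<in>I. \<bar>r x\<bar>)" using assms(1) xy by (intro member_le_sum) auto
    thus "\<bar>g x y\<bar> \<le> (\<Sum>x\<in>I. \<bar>r x\<bar>)" using r xy by fastforce
  qed
qed

lemma sum_odd_even: "(\<Sum>i=1..2*l. f i) = (\<Sum>j=1..l. f (2*j - 1)) + (\<Sum>j=1..l. f (2*j :: nat) :: real)"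
  by (induction l) auto

lemma continuous_on_coordinate2:
  "continuous_on UNIV (\<lambda>x :: 'a \<Rightarrow> 'b \<Rightarrow> real. x a b)"
  by (rule continuous_on_product_then_coordinatewise[OF continuous_on_product_coordinates])

lemma bilinear_coordinates:
  assumes "nondeg_sym_bilinear n Q" "x \<in> Rn n" "y \<in> Rn n"
  shows "Q x y = (\<Sum>i<n. \<Sum>k<n. x i * y k * Q (unit_vec i) (unit_vec k))"
proof -
  have "Q x y = (\<Sum>i<n. x i * Q (unit_vec i) y)" by (rule bilinear_expand[OF assms])
  also have "\<dots> = (\<Sum>i<n. \<Sum>k<n. x i * y k * Q (unit_vec i) (unit_vec k))"
  proof (intro sum.cong refl)
    fix i assume "i \<in> {..<n}"
    hence "Q (unit_vec i) y = (\<Sum>k<n. y k * Q (unit_vec i) (unit_vec k))"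
      by (intro bilinear_expand_right[OF assms(1) _ assms(3)] unit_vec_Rn) simp
    thus "x i * Q (unit_vec i) y = (\<Sum>k<n. x i * y k * Q (unit_vec i) (unit_vec k))"
      by (simp add: sum_distrib_left mult.assoc)
  qed
  finally show ?thesis .
qed

lemma closed_bilinear_sum_image:
  fixes E :: "nat \<Rightarrow> (nat \<Rightarrow> real) set"
  assumes Q: "\<And>j. j \<in> {1..l} \<Longrightarrow> nondeg_sym_bilinear (n j) (Q j)"
    and E: "\<And>i. i \<in> {1..2*l} \<Longrightarrow> compact (E i)"
    and Rn: "\<And>j. j \<in> {1..l} \<Longrightarrow> E (2*j - 1) \<subseteq> Rn (n j) \<and> E (2*j) \<subseteq> Rn (n j)"
  shows "closed {\<Sum>j=1..l. Q j (x (2*j - 1)) (x (2*j)) | x. \<forall>i\<in>{1..2*l}. x i \<in> E i}" (is "closed ?S")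
proof -
  \<comment> \<open>A polynomial in the coordinates, hence continuous everywhere, that agrees with
    the sum of the forms on the sets \<open>E i\<close>.\<close>
  define \<Phi> where "\<Phi> x = (\<Sum>j=1..l. \<Sum>i<n j. \<Sum>k<n j. x (2*j - 1) i * x (2*j) k * Q j (unit_vec i) (unit_vec k))" for x :: "nat \<Rightarrow> nat \<Rightarrow> real"
  \<comment> \<open>Indices outside \<open>{1..2*l}\<close> are pinned to the zero function, so that
    the product over all of \<open>nat\<close> is compact.\<close>
  let ?A = "\<lambda>i. if i \<in> {1..2*l} then E i else {\<lambda>_. 0}"
  have idx: "2 * j - 1 \<in> {1..2*l}" "2 * j \<in> {1..2*l}" if "j \<in> {1..l}" for j using that by auto
  have \<Phi>: "\<Phi> x = (\<Sum>j=1..l. Q j (x (2*j - 1)) (x (2*j)))" if "\<forall>i\<in>{1..2*l}. x i \<in> E i" for x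
    unfolding \<Phi>_def
  proof (intro sum.cong refl)
    fix j assume j: "j \<in> {1..l}"
    have "x (2*j - 1) \<in> Rn (n j)" "x (2*j) \<in> Rn (n j)" using that idx[OF j] Rn[OF j] by blast+
    thus "(\<Sum>i<n j. \<Sum>k<n j. x (2*j - 1) i * x (2*j) k * Q j (unit_vec i) (unit_vec k)) = Q j (x (2*j - 1)) (x (2*j))"
      by (rule bilinear_coordinates[OF Q[OF j], symmetric])
  qed
  have "?S = \<Phi> ` PiE UNIV ?A"
  proof (intro set_eqI iffI)
    fix y assume "y \<in> ?S"
    then obtain x where x: "y = (\<Sum>j=1..l. Q j (x (2*j - 1)) (x (2*j)))" "\<forall>i\<in>{1..2*l}. x i \<in> E i" by blast
    define x' where "x' i = (if i \<in> {1..2*l} then x i else (\<lambda>_. 0))" for i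
    have "\<forall>i\<in>{1..2*l}. x' i \<in> E i" using x(2) by (simp add: x'_def)
    moreover have "(\<Sum>j=1..l. Q j (x (2*j - 1)) (x (2*j))) = (\<Sum>j=1..l. Q j (x' (2*j - 1)) (x' (2*j)))"
      using idx by (intro sum.cong refl) (simp add: x'_def)
    ultimately have "y = \<Phi> x'" using x(1) \<Phi> by simp
    moreover have "x' \<in> PiE UNIV ?A" using x(2) by (auto simp: x'_def)
    ultimately show "y \<in> \<Phi> ` PiE UNIV ?A" by blast
  next
    fix y assume "y \<in> \<Phi> ` PiE UNIV ?A"
    then obtain x where x: "y = \<Phi> x" "x \<in> PiE UNIV ?A" by blast
    have "x i \<in> E i" if "i \<in> {1..2*l}" for i using PiE_mem[OF x(2), of i] that by simp
    thus "y \<in> ?S" using x \<Phi> by blast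
  qed
  moreover have "compact (PiE UNIV ?A)" using E by (intro compact_PiE_UNIV) auto
  moreover have "continuous_on UNIV \<Phi>"
    unfolding \<Phi>_def by (intro continuous_intros continuous_on_coordinate2)
  hence "continuous_on (PiE UNIV ?A) \<Phi>" by (rule continuous_on_subset) simp
  ultimately have "compact ?S"
    by (simp only: compact_continuous_image)
  thus ?thesis by (rule compact_imp_closed)
qed

theorem theorem6p1:
  fixes l :: nat and n :: "nat \<Rightarrow> nat" and d :: "nat \<Rightarrow> nat"
    and Q :: "nat \<Rightarrow> (nat \<Rightarrow> real) \<Rightarrow> (nat \<Rightarrow> real) \<Rightarrow> real"
    and E :: "nat \<Rightarrow> (nat \<Rightarrow> real) set"
  assumes "l \<ge> 1"
    and "\<forall>j\<in>{1..l}. n j \<ge> 1 \<and> nondeg_sym_bilinear (n j) (Q j)"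
    and "\<forall>j\<in>{1..l}. d (2*j - 1) = n j \<and> d (2*j) = n j"
    and "\<forall>i\<in>{1..2*l}. E i \<subseteq> Rn (d i) \<and> compact (E i) \<and> E i \<noteq> {}"
    and "(\<Sum>i=1..2*l. hausdorff_dim (d i) (E i)) > 1 + (\<Sum>j=1..l. real (n j))"
  shows "interior {\<Sum>j=1..l. Q j (x (2*j - 1)) (x (2*j)) | x.
                    \<forall>i\<in>{1..2*l}. x i \<in> E i} \<noteq> {}"
proof -
  define J where "J = {1..l}"
  define I where "I = Sigma J (\<lambda>j. {..<n j})"
  define A where "A j = E (2*j - 1)" for j
  define B where "B j = E (2*j)" for j
  have finJ: "finite J" and finI: "finite I" by (auto simp: J_def I_def)
  have idx: "2 * j - 1 \<in> {1..2*l}" "2 * j \<in> {1..2*l}" if "j \<in> J" for j using that by (auto simp: J_def)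
  have Q: "nondeg_sym_bilinear (n j) (Q j)" "n j \<ge> 1" if "j \<in> J" for j using assms(2) that by (auto simp: J_def)
  have d: "d (2*j - 1) = n j" "d (2*j) = n j" if "j \<in> J" for j using assms(3) that by (auto simp: J_def)
  have A: "compact (A j) \<and> A j \<subseteq> Rn (n j) \<and> A j \<noteq> {}" if "j \<in> J" for j
    using bspec[OF assms(4) idx(1)[OF that]] d(1)[OF that] by (simp add: A_def)
  have B: "compact (B j) \<and> B j \<subseteq> Rn (n j) \<and> B j \<noteq> {}" if "j \<in> J" for j
    using bspec[OF assms(4) idx(2)[OF that]] d(2)[OF that] by (simp add: B_def)
  define dim where "dim i = hausdorff_dim (d i) (E i)" for i
  define N where "N = (\<Sum>j\<in>J. real (n j))"
  have cardI: "real (card I) = N" by (simp add: I_def N_def finJ)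
  \<comment> \<open>Each of the \<open>2 * l\<close> exponents may fall short of the dimension by
    \<open>\<eta>\<close>, which costs half of the excess in total.\<close>
  define \<eta> where "\<eta> = ((\<Sum>i=1..2*l. dim i) - (1 + N)) / (4 * real l)"
  have gap: "1 + N < (\<Sum>i=1..2*l. dim i)" using assms(5) by (simp add: dim_def N_def J_def)
  hence \<eta>: "\<eta> > 0" using assms(1) by (simp add: \<eta>_def)
  \<comment> \<open>A dimension may lie below \<open>\<eta>\<close>. The exponent 0 is always
    available, and the cutoff only increases the sum.\<close>
  define s where "s i = max 0 (dim i - \<eta>)" for i
  have s0: "0 \<le> s i" "s i = 0 \<or> s i < dim i" for i using \<eta> by (auto simp: s_def)
  have "(\<Sum>i=1..2*l. dim i) - 2 * real l * \<eta> = (\<Sum>i=1..2*l. dim i - \<eta>)" by (simp add: sum_subtractf)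
  also have "\<dots> \<le> (\<Sum>i=1..2*l. s i)" by (intro sum_mono) (simp add: s_def)
  also have "\<dots> = (\<Sum>j\<in>J. s (2*j - 1)) + (\<Sum>j\<in>J. s (2*j))" unfolding J_def by (rule sum_odd_even)
  finally have "(\<Sum>i=1..2*l. dim i) - 2 * real l * \<eta> \<le> (\<Sum>j\<in>J. s (2*j - 1)) + (\<Sum>j\<in>J. s (2*j))" .
  moreover have "2 * real l * \<eta> = ((\<Sum>i=1..2*l. dim i) - (1 + N)) / 2" using assms(1) by (simp add: \<eta>_def)
  moreover have "c < P" if "a - b \<le> P" "b = (a - c) / 2" "c < a" for a b c P :: real using that by (simp add: field_simps)
  ultimately have "1 + N < (\<Sum>j\<in>J. s (2*j - 1)) + (\<Sum>j\<in>J. s (2*j))" using gap by blast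
  hence ssum: "real (card I) + 1 < (\<Sum>j\<in>J. s (2*j - 1)) + (\<Sum>j\<in>J. s (2*j))" by (simp only: cardI add.commute)
  define X where "X p x = p (fst x) (snd x)" for p :: "nat \<Rightarrow> nat \<Rightarrow> real" and x :: "nat \<times> nat"
  \<comment> \<open>Pairing with unit vectors turns the sum of the forms into a dot product:
    \<open>Y\<close> is the linear change of variables given by the matrices of the
    \<open>Q j\<close>.\<close>
  define Y where "Y q x = Q (fst x) (unit_vec (snd x)) (q (fst x))" for q :: "nat \<Rightarrow> nat \<Rightarrow> real" and x :: "nat \<times> nat"
  obtain C where C: "C \<ge> 0" and enA: "\<forall>u0>0. \<exists>P\<subseteq>PiE J A. energy_bounded I X (\<Sum>j\<in>J. s (2*j - 1)) C u0 P"
  proof -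
    have "\<exists>C\<ge>0. \<forall>u0>0. \<exists>P\<subseteq>PiE J A. energy_bounded (Sigma J (\<lambda>j. {..<n j})) (\<lambda>p x. (\<lambda>j y. y) (fst x) (p (fst x)) (snd x)) (\<Sum>j\<in>J. s (2*j - 1)) C u0 P"
    proof (rule product_family_energy[OF finJ A])
      fix j assume j: "j \<in> J"
      show "0 \<le> s (2*j - 1) \<and> (s (2*j - 1) = 0 \<or> s (2*j - 1) < hausdorff_dim (n j) (A j))"
        using s0[of "2*j - 1"] d(1)[OF j] by (simp add: dim_def A_def)
      show "\<exists>c>0. \<forall>x\<in>Rn (n j). \<forall>y\<in>Rn (n j). c * (edist (n j) x y)\<^sup>2 \<le> (\<Sum>i<n j. (x i - y i)\<^sup>2)"
        by (intro exI[of _ 1]) (simp add: edist_def sum_nonneg)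
    qed
    thus ?thesis using that unfolding I_def X_def by blast
  qed
  obtain C' where C': "C' \<ge> 0" and enB: "\<forall>u0>0. \<exists>P\<subseteq>PiE J B. energy_bounded I Y (\<Sum>j\<in>J. s (2*j)) C' u0 P"
  proof -
    have "\<exists>C\<ge>0. \<forall>u0>0. \<exists>P\<subseteq>PiE J B. energy_bounded (Sigma J (\<lambda>j. {..<n j})) (\<lambda>p x. (\<lambda>j y i. Q j (unit_vec i) y) (fst x) (p (fst x)) (snd x)) (\<Sum>j\<in>J. s (2*j)) C u0 P"
    proof (rule product_family_energy[OF finJ B])
      fix j assume j: "j \<in> J"
      show "0 \<le> s (2*j) \<and> (s (2*j) = 0 \<or> s (2*j) < hausdorff_dim (n j) (B j))"
        using s0[of "2*j"] d(2)[OF j] by (simp add: dim_def B_def)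
      show "\<exists>c>0. \<forall>x\<in>Rn (n j). \<forall>y\<in>Rn (n j). c * (edist (n j) x y)\<^sup>2 \<le> (\<Sum>i<n j. (Q j (unit_vec i) x - Q j (unit_vec i) y)\<^sup>2)"
        by (rule nondeg_bilinear_expanding[OF Q[OF j]])
    qed
    thus ?thesis using that unfolding I_def Y_def by blast
  qed
  obtain R1 where R1: "R1 \<ge> 0" "\<forall>x\<in>I. \<forall>y\<in>A (fst x). \<bar>y (snd x)\<bar> \<le> R1"
  proof -
    have "\<exists>R\<ge>0. \<forall>x\<in>I. \<forall>y\<in>A (fst x). \<bar>y (snd x)\<bar> \<le> R"
    proof (rule finite_family_bounded[OF finI])
      fix x assume "x \<in> I"
      thus "compact (A (fst x))" using A by (auto simp: I_def)
      show "continuous_on (A (fst x)) (\<lambda>y. y (snd x))"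
        by (rule continuous_on_subset[OF continuous_on_product_coordinates]) simp
    qed
    thus ?thesis using that by blast
  qed
  obtain R2 where R2: "R2 \<ge> 0" "\<forall>x\<in>I. \<forall>y\<in>B (fst x). \<bar>\<Sum>k<n (fst x). y k * Q (fst x) (unit_vec (snd x)) (unit_vec k)\<bar> \<le> R2"
  proof -
    have "\<exists>R\<ge>0. \<forall>x\<in>I. \<forall>y\<in>B (fst x). \<bar>\<Sum>k<n (fst x). y k * Q (fst x) (unit_vec (snd x)) (unit_vec k)\<bar> \<le> R"
    proof (rule finite_family_bounded[OF finI])
      fix x assume "x \<in> I"
      thus "compact (B (fst x))" using B by (auto simp: I_def)
      show "continuous_on (B (fst x)) (\<lambda>y. \<Sum>k<n (fst x). y k * Q (fst x) (unit_vec (snd x)) (unit_vec k))"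
        by (rule continuous_on_subset[of UNIV]) (auto intro!: continuous_intros)
    qed
    thus ?thesis using that by blast
  qed
  have sumXY: "(\<Sum>x\<in>I. X p x * Y q x) = (\<Sum>j=1..l. Q j (p j) (q j))" if p: "p \<in> PiE J A" and q: "q \<in> PiE J B" for p q
  proof -
    have "(\<Sum>x\<in>I. X p x * Y q x) = (\<Sum>j\<in>J. \<Sum>i<n j. p j i * Q j (unit_vec i) (q j))"
      unfolding I_def X_def Y_def by (subst sum.Sigma) (use finJ in \<open>auto simp: split_def\<close>)
    also have "\<dots> = (\<Sum>j\<in>J. Q j (p j) (q j))"
    proof (intro sum.cong refl)
      fix j assume j: "j \<in> J"
      have "p j \<in> Rn (n j)" "q j \<in> Rn (n j)" using PiE_mem[OF p j] PiE_mem[OF q j] A[OF j] B[OF j] by blast+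
      thus "(\<Sum>i<n j. p j i * Q j (unit_vec i) (q j)) = Q j (p j) (q j)"
        by (rule bilinear_expand[OF Q(1)[OF j], symmetric])
    qed
    finally show ?thesis by (simp add: J_def)
  qed
  let ?S = "{\<Sum>j=1..l. Q j (x (2*j - 1)) (x (2*j)) | x. \<forall>i\<in>{1..2*l}. x i \<in> E i}"
  have S: "?S = {\<Sum>x\<in>I. X p x * Y q x | p q. p \<in> PiE J A \<and> q \<in> PiE J B}"
  proof (intro set_eqI iffI)
    fix y assume "y \<in> ?S"
    then obtain x where x: "y = (\<Sum>j=1..l. Q j (x (2*j - 1)) (x (2*j)))" "\<forall>i\<in>{1..2*l}. x i \<in> E i" by blast
    define p where "p = restrict (\<lambda>j. x (2*j - 1)) J"
    define q where "q = restrict (\<lambda>j. x (2*j)) J"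
    have "p \<in> PiE J A" "q \<in> PiE J B" unfolding p_def q_def using x(2) idx by (auto simp: A_def B_def)
    moreover from this have "y = (\<Sum>x\<in>I. X p x * Y q x)"
      unfolding x(1) sumXY[OF \<open>p \<in> PiE J A\<close> \<open>q \<in> PiE J B\<close>] by (intro sum.cong) (auto simp: p_def q_def J_def)
    ultimately show "y \<in> {\<Sum>x\<in>I. X p x * Y q x | p q. p \<in> PiE J A \<and> q \<in> PiE J B}"
      by (intro CollectI exI conjI)
  next
    fix y assume "y \<in> {\<Sum>x\<in>I. X p x * Y q x | p q. p \<in> PiE J A \<and> q \<in> PiE J B}"
    then obtain p q where pq: "y = (\<Sum>x\<in>I. X p x * Y q x)" "p \<in> PiE J A" "q \<in> PiE J B"
      by (elim CollectE exE conjE)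
    \<comment> \<open>\<open>Suc i div 2\<close> recovers \<open>j\<close> from the odd index
      \<open>2 * j - 1\<close>.\<close>
    define x where "x i = (if odd i then p (Suc i div 2) else q (i div 2))" for i
    have "x i \<in> E i" if i: "i \<in> {1..2*l}" for i
    proof (cases "odd i")
      case True
      then obtain m where m: "i = 2 * m + 1" by (rule oddE)
      have "Suc m \<in> J" using i unfolding J_def m atLeastAtMost_iff by linarith
      from PiE_mem[OF pq(2) this] show ?thesis using m by (simp add: x_def A_def)
    next
      case False
      then obtain m where m: "i = 2 * m" using evenE by blast
      have "m \<in> J" using i unfolding J_def m atLeastAtMost_iff by linarith
      from PiE_mem[OF pq(3) this] show ?thesis using m by (simp add: x_def B_def)
    qed
    moreover have "x (2*j - 1) = p j" "x (2*j) = q j" if "j \<in> {1..l}" for j using that by (auto simp: x_def)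
    hence "y = (\<Sum>j=1..l. Q j (x (2*j - 1)) (x (2*j)))" unfolding pq(1) sumXY[OF pq(2,3)] by (intro sum.cong refl) simp
    ultimately show "y \<in> ?S" by blast
  qed
  have cl: "closed ?S"
  proof (rule closed_bilinear_sum_image)
    show "nondeg_sym_bilinear (n j) (Q j)" if "j \<in> {1..l}" for j using assms(2) that by blast
    show "compact (E i)" if "i \<in> {1..2*l}" for i using assms(4) that by blast
    show "E (2*j - 1) \<subseteq> Rn (n j) \<and> E (2*j) \<subseteq> Rn (n j)" if "j \<in> {1..l}" for j
    proof -
      have "j \<in> J" using that by (simp only: J_def)
      from A[OF this] B[OF this] show ?thesis unfolding A_def B_def by blast
    qed
  qed
  have s2: "0 \<le> (\<Sum>j\<in>J. s (2*j))" using s0 by (intro sum_nonneg) auto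
  show ?thesis
  proof (rule bilinear_image_interior[OF finI s2 ssum C C' _ _ _ _ _ S cl])
    show "0 \<le> max R1 R2" using R1 by simp
    show "\<bar>X p x\<bar> \<le> max R1 R2" if "p \<in> PiE J A" "x \<in> I" for p x
    proof -
      have "fst x \<in> J" using that(2) by (auto simp: I_def)
      from PiE_mem[OF that(1) this] R1(2) that(2) have "\<bar>p (fst x) (snd x)\<bar> \<le> R1" by blast
      thus ?thesis by (simp add: X_def)
    qed
    show "\<bar>Y q x\<bar> \<le> max R1 R2" if "q \<in> PiE J B" "x \<in> I" for q x
    proof -
      have x: "fst x \<in> J" "snd x < n (fst x)" using that(2) by (auto simp: I_def)
      have qB: "q (fst x) \<in> B (fst x)" by (rule PiE_mem[OF that(1) x(1)])
      hence "q (fst x) \<in> Rn (n (fst x))" using B[OF x(1)] by blast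
      hence "Y q x = (\<Sum>k<n (fst x). q (fst x) k * Q (fst x) (unit_vec (snd x)) (unit_vec k))"
        unfolding Y_def by (rule bilinear_expand_right[OF Q(1)[OF x(1)] unit_vec_Rn[OF x(2)]])
      moreover have "\<bar>\<Sum>k<n (fst x). q (fst x) k * Q (fst x) (unit_vec (snd x)) (unit_vec k)\<bar> \<le> R2" using R2(2) that(2) qB by blast
      ultimately show ?thesis by simp
    qed
    show "\<exists>P\<subseteq>PiE J A. energy_bounded I X (\<Sum>j\<in>J. s (2*j - 1)) C u0 P" if "u0 > 0" for u0 using enA that by blast
    show "\<exists>P\<subseteq>PiE J B. energy_bounded I Y (\<Sum>j\<in>J. s (2*j)) C' u0 P" if "u0 > 0" for u0 using enB that by blast
  qed
qed

end
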